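(* Let $\{\nu_{nk}: n\ge 1,\ 1\le k\le k_n\}\subset\mathcal{M}_{\mathbb{T}}^{\times}$ be an infinitesimal triangular array of Borel probability measures on the unit circle $\mathbb{T}$ with nonzero first moments, let $\tau\in(0,\pi)$, and let $b_{nk}$, $\nu_{nk}^\circ$ be the centering constants and centered measures associated with $\tau$ (see context). Let $\{\lambda_n\}_{n=1}^\infty\subset\mathbb{T}$ be a sequence, let $\gamma\in\mathbb{R}$, and let $\sigma$ be a finite positive Borel measure on $\mathbb{T}$. The following assertions are equivalent: (1) The sequence $\nu_{n1}\boxtimes\nu_{n2}\boxtimes\cdots\boxtimes\nu_{nk_n}\boxtimes\delta_{\lambda_n}$ converges weakly to $\nu_{\boxtimes}^{\gamma,\sigma}$ as $n\to\infty$. (2) The sequence of measures $$d\sigma_n(t)=\sum_{k=1}^{k_n}(1-\Re t)\,d\nu_{nk}^{\circ}(t)$$ converges weakly on $\mathbb{T}$ to $\sigma$, and the limit $$\lim_{n\to\infty}e^{i\gamma_n}=e^{i\gamma}$$ exists, where $$\gamma_n=\arg\lambda_n+\sum_{k=1}^{k_n}\left[\int_{\mathbb{T}}\Im t\,d\nu_{nk}^{\circ}(t)+\arg b_{nk}\right].$$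
   Context: $\mathbb{T}=\{z\in\mathbb{C}:|z|=1\}$, $\mathbb{D}=\{z\in\mathbb{C}:|z|<1\}$. $\mathcal{M}_{\mathbb{T}}^{\times}$ is the set of Borel probability measures $\nu$ on $\mathbb{T}$ with $\int_{\mathbb{T}}t\,d\nu(t)\ne0$; $\delta_\lambda$ is the unit point mass at $\lambda$. $\arg$ denotes the principal value of the argument, and for $t\in\mathbb{T}$, $\log t=i\arg t$ is the principal branch. Free multiplicative convolution: for probability measures $\mu,\nu$ on $\mathbb{T}$, $\mu\boxtimes\nu$ is the distribution of $UV$, where $U,V$ are freely independent unitary random variables with distributions $\mu,\nu$. Transforms: for $\nu\in\mathcal{M}_{\mathbb{T}}^\times$ put $\psi_\nu(z)=\int_{\mathbb{T}}\frac{tz}{1-tz}\,d\nu(t)$, $z\in\mathbb{D}$; since $\psi_\nu'(0)\neq0$, $\psi_\nu$ has an inverse $\psi_\nu^{-1}$ near $0$. Put $S_\nu(z)=\frac{1+z}{z}\psi_\nu^{-1}(z)$ and $\Sigma_\nu(z)=S_\nu\left(\frac{z}{1-z}\right)$ in a neighborhood of $0$. One has $\Sigma_{\mu\boxtimes\nu}=\Sigma_\mu\Sigma_\nu$ near $0$. The measure $\nu_{\boxtimes}^{\gamma,\sigma}$: for $\gamma\in\mathbb{R}$ and $\sigma$ a finite positive Borel measure on $\mathbb{T}$, put $$u_{\gamma,\sigma}(z)=-i\gamma+\int_{\mathbb{T}}\frac{1+tz}{1-tz}\,d\sigma(t),\qquad z\in\mathbb{D}.$$ Then $\nu_{\boxtimes}^{\gamma,\sigma}\in\mathcal{M}_{\mathbb{T}}^\times$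 is the ($\boxtimes$-infinitely divisible) measure with $\Sigma(z)=\exp(u_{\gamma,\sigma}(z))$. Infinitesimality: the array is infinitesimal if for every $\varepsilon>0$, $\lim_{n\to\infty}\max_{1\le k\le k_n}\nu_{nk}(\{t\in\mathbb{T}:|\arg t|\ge\varepsilon\})=0$. Centering: $b_{nk}=\exp\left(\int_{|\arg t|<\tau}\log t\,d\nu_{nk}(t)\right)\in\mathbb{T}$, and $\nu_{nk}^\circ$ is defined by $d\nu_{nk}^{\circ}(t)=d\nu_{nk}(b_{nk}t)$, i.e. $\nu_{nk}^\circ(A)=\nu_{nk}(b_{nk}A)$ for Borel $A\subset\mathbb{T}$. *)

theory Defs
  imports
    "HOL-Probability.Probability"
    "HOL-Complex_Analysis.Complex_Analysis"
    "HOL-Algebra.Module"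
    "HOL-Algebra.Algebraic_Closure_Type"
begin

section \<open>Measures on the unit circle\<close>

abbreviation circle :: "complex set" where
  "circle \<equiv> sphere 0 1"

abbreviation circle_borel :: "complex measure" where
  "circle_borel \<equiv> restrict_space borel circle"

definition circle_prob :: "complex measure \<Rightarrow> bool" where
  "circle_prob \<nu> \<longleftrightarrow> prob_space \<nu> \<and> sets \<nu> = sets circle_borel"

definition circle_prob_nz :: "complex measure set" where
  "circle_prob_nz = {\<nu>. circle_prob \<nu> \<and> (LINT t|\<nu>. t) \<noteq> 0}"

definition weak_conv_circle :: "(nat \<Rightarrow> complex measure) \<Rightarrow> complex measure \<Rightarrow> bool" where
  "weak_conv_circle M_seq M \<longleftrightarrow>
     (\<forall>f :: complex \<Rightarrow> real. continuous_on circle f \<longrightarrow>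
        (\<lambda>n. LINT t|M_seq n. f t) \<longlonglongrightarrow> (LINT t|M. f t))"


section \<open>Noncommutative probability\<close>

record 'a star_algebra = "(complex, 'a) module" +
  star :: "'a \<Rightarrow> 'a"

text \<open>
  A unital complex *-algebra \<open>A\<close> with a state \<open>\<phi>\<close>. The algebra is not assumed to be a
  C*- or W*-algebra: only *-moments of unitaries enter below, and by the GNS construction
  unitaries in such a space can be represented by unitary operators with the same *-moments.
\<close>

locale star_prob_space =
  module "ring_of_type_algebra :: complex ring" A + ring A
  for A :: "('a, 'm) star_algebra_scheme" (structure) +
  fixes \<phi> :: "'a \<Rightarrow> complex"
  assumes smult_mult_left:
      "\<lbrakk>x \<in> carrier A; y \<in> carrier A\<rbrakk> \<Longrightarrow> (c \<odot> x) \<otimes> y = c \<odot> (x \<otimes> y)"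
    and smult_mult_right:
      "\<lbrakk>x \<in> carrier A; y \<in> carrier A\<rbrakk> \<Longrightarrow> x \<otimes> (c \<odot> y) = c \<odot> (x \<otimes> y)"
    and star_closed: "x \<in> carrier A \<Longrightarrow> star A x \<in> carrier A"
    and star_star: "x \<in> carrier A \<Longrightarrow> star A (star A x) = x"
    and star_add:
      "\<lbrakk>x \<in> carrier A; y \<in> carrier A\<rbrakk> \<Longrightarrow> star A (x \<oplus> y) = star A x \<oplus> star A y"
    and star_smult: "x \<in> carrier A \<Longrightarrow> star A (c \<odot> x) = cnj c \<odot> star A x"
    and star_mult:
      "\<lbrakk>x \<in> carrier A; y \<in> carrier A\<rbrakk> \<Longrightarrow> star A (x \<otimes> y) = star A y \<otimes> star A x"
    and state_add: "\<lbrakk>x \<in> carrier A; y \<in> carrier A\<rbrakk> \<Longrightarrow> \<phi> (x \<oplus> y) = \<phi> x + \<phi> y"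
    and state_smult: "x \<in> carrier A \<Longrightarrow> \<phi> (c \<odot> x) = c * \<phi> x"
    and state_one: "\<phi> \<one> = 1"
    and state_pos: "x \<in> carrier A \<Longrightarrow> \<phi> (star A x \<otimes> x) \<in> \<real>\<^sub>\<ge>\<^sub>0"

definition unitary_elem :: "('a, 'm) star_algebra_scheme \<Rightarrow> 'a \<Rightarrow> bool" where
  "unitary_elem A u \<longleftrightarrow> u \<in> carrier A \<and>
     star A u \<otimes>\<^bsub>A\<^esub> u = \<one>\<^bsub>A\<^esub> \<and> u \<otimes>\<^bsub>A\<^esub> star A u = \<one>\<^bsub>A\<^esub>"

text \<open>The distribution of a unitary is the measure on the circle with the same *-moments.\<close>

definition has_circle_distr ::
    "('a, 'm) star_algebra_scheme \<Rightarrow> ('a \<Rightarrow> complex) \<Rightarrow> 'a \<Rightarrow> complex measure \<Rightarrow> bool" where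
  "has_circle_distr A \<phi> u \<mu> \<longleftrightarrow> circle_prob \<mu> \<and>
     (\<forall>m n :: nat. \<phi> (u [^]\<^bsub>A\<^esub> m \<otimes>\<^bsub>A\<^esub> star A u [^]\<^bsub>A\<^esub> n) = (LINT t|\<mu>. t ^ m * cnj t ^ n))"

definition star_subalgebra :: "('a, 'm) star_algebra_scheme \<Rightarrow> 'a set \<Rightarrow> bool" where
  "star_subalgebra A B \<longleftrightarrow> B \<subseteq> carrier A \<and> \<one>\<^bsub>A\<^esub> \<in> B \<and>
     (\<forall>x\<in>B. \<forall>y\<in>B. x \<oplus>\<^bsub>A\<^esub> y \<in> B \<and> x \<otimes>\<^bsub>A\<^esub> y \<in> B) \<and>
     (\<forall>x\<in>B. star A x \<in> B \<and> (\<forall>c. c \<odot>\<^bsub>A\<^esub> x \<in> B))"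

definition star_generated :: "('a, 'm) star_algebra_scheme \<Rightarrow> 'a set \<Rightarrow> 'a set" where
  "star_generated A G = \<Inter>{B. star_subalgebra A B \<and> G \<subseteq> B}"

text \<open>
  Freeness of a family of subalgebras: the state vanishes on every nonempty product of
  centered elements in which neighbouring factors come from different subalgebras. A factor
  is encoded as a pair of its index and its value.
\<close>

definition free_subalgebras ::
    "('a, 'm) star_algebra_scheme \<Rightarrow> ('a \<Rightarrow> complex) \<Rightarrow> 'i set \<Rightarrow> ('i \<Rightarrow> 'a set) \<Rightarrow> bool" where
  "free_subalgebras A \<phi> I B \<longleftrightarrow>
     (\<forall>w :: ('i \<times> 'a) list.
        w \<noteq> [] \<and> (\<forall>(i, a) \<in> set w. i \<in> I \<and> a \<in> B i \<and> \<phi> a = 0) \<and>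
        successively (\<lambda>p q. fst p \<noteq> fst q) w \<longrightarrow>
        \<phi> (foldr (\<otimes>\<^bsub>A\<^esub>) (map snd w) \<one>\<^bsub>A\<^esub>) = 0)"

definition free_elems ::
    "('a, 'm) star_algebra_scheme \<Rightarrow> ('a \<Rightarrow> complex) \<Rightarrow> 'a \<Rightarrow> 'a \<Rightarrow> bool" where
  "free_elems A \<phi> u v \<longleftrightarrow>
     free_subalgebras A \<phi> UNIV (\<lambda>b :: bool. star_generated A {if b then u else v})"

text \<open>
  \<open>\<mu> \<boxtimes> \<nu>\<close> is the distribution of \<open>u v\<close> for free unitaries \<open>u\<close>, \<open>v\<close> with distributions
  \<open>\<mu>\<close>, \<open>\<nu>\<close>; it depends only on \<open>\<mu>\<close> and \<open>\<nu>\<close>. A definition cannot quantify over the carrier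
  type, so the elements of the algebra are taken to be functions on complex sequences. This
  excludes nothing: only the *-subalgebra generated by \<open>u\<close> and \<open>v\<close> matters, and it has
  countable dimension and hence a copy in this type.
\<close>

definition free_mult_conv :: "complex measure \<Rightarrow> complex measure \<Rightarrow> complex measure"
    (infixr \<open>\<boxtimes>\<close> 70) where
  "\<mu> \<boxtimes> \<nu> = (THE \<rho>.
     \<exists>(A :: ((nat \<Rightarrow> complex) \<Rightarrow> (nat \<Rightarrow> complex)) star_algebra) \<phi> u v.
       star_prob_space A \<phi> \<and> unitary_elem A u \<and> unitary_elem A v \<and> free_elems A \<phi> u v \<and>
       has_circle_distr A \<phi> u \<mu> \<and> has_circle_distr A \<phi> v \<nu> \<and>
       has_circle_distr A \<phi> (u \<otimes>\<^bsub>A\<^esub> v) \<rho>)"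


section \<open>Transforms\<close>

definition psi :: "complex measure \<Rightarrow> complex \<Rightarrow> complex" where
  "psi \<nu> z = (LINT t|\<nu>. t * z / (1 - t * z))"

text \<open>
  The inverse of \<open>psi \<nu>\<close> near \<open>0\<close>. Only its germ at \<open>0\<close> is determined, so all statements
  about \<open>psi_inv\<close>, \<open>S_transform\<close> and \<open>Sigma_transform\<close> have to be local at \<open>0\<close>. The last
  two take a junk value at the removable singularity \<open>0\<close> itself.
\<close>

definition psi_inv :: "complex measure \<Rightarrow> complex \<Rightarrow> complex" where
  "psi_inv \<nu> = (SOME g. g analytic_on {0} \<and> g 0 = 0 \<and>
     (\<forall>\<^sub>F w in nhds 0. psi \<nu> (g w) = w) \<and> (\<forall>\<^sub>F z in nhds 0. g (psi \<nu> z) = z))"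

definition S_transform :: "complex measure \<Rightarrow> complex \<Rightarrow> complex" where
  "S_transform \<nu> z = (1 + z) / z * psi_inv \<nu> z"

definition Sigma_transform :: "complex measure \<Rightarrow> complex \<Rightarrow> complex" where
  "Sigma_transform \<nu> z = S_transform \<nu> (z / (1 - z))"

definition u_fun :: "real \<Rightarrow> complex measure \<Rightarrow> complex \<Rightarrow> complex" where
  "u_fun \<gamma> \<sigma> z = - \<i> * of_real \<gamma> + (LINT t|\<sigma>. (1 + t * z) / (1 - t * z))"

definition nu_boxtimes :: "real \<Rightarrow> complex measure \<Rightarrow> complex measure" where
  "nu_boxtimes \<gamma> \<sigma> = (THE \<nu>. \<nu> \<in> circle_prob_nz \<and>
     (\<forall>\<^sub>F z in at 0. Sigma_transform \<nu> z = exp (u_fun \<gamma> \<sigma> z)))"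


section \<open>Triangular arrays\<close>

definition infinitesimal_array :: "(nat \<Rightarrow> nat) \<Rightarrow> (nat \<Rightarrow> nat \<Rightarrow> complex measure) \<Rightarrow> bool" where
  "infinitesimal_array k \<nu> \<longleftrightarrow>
     (\<forall>\<epsilon>>0. (\<lambda>n. MAX j\<in>{1..k n}. measure (\<nu> n j) {t \<in> circle. \<bar>Arg t\<bar> \<ge> \<epsilon>}) \<longlonglongrightarrow> 0)"

definition centering :: "real \<Rightarrow> complex measure \<Rightarrow> complex" where
  "centering \<tau> \<nu> = exp (LINT t:{t. \<bar>Arg t\<bar> < \<tau>}|\<nu>. \<i> * of_real (Arg t))"

text \<open>
  With \<open>b = centering \<tau> \<nu>\<close>, this is the measure \<open>A \<mapsto> \<nu> (b A)\<close>, since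
  \<open>t / b \<in> A\<close> iff \<open>t \<in> b A\<close>.
\<close>

definition centered :: "real \<Rightarrow> complex measure \<Rightarrow> complex measure" where
  "centered \<tau> \<nu> = distr \<nu> circle_borel (\<lambda>t. t / centering \<tau> \<nu>)"

definition sigma_row :: "real \<Rightarrow> nat \<Rightarrow> (nat \<Rightarrow> complex measure) \<Rightarrow> complex measure" where
  "sigma_row \<tau> m \<nu> = measure_of circle (sets circle_borel)
     (\<lambda>A. \<Sum>j=1..m. \<integral>\<^sup>+t\<in>A. ennreal (1 - Re t) \<partial>centered \<tau> (\<nu> j))"

definition gamma_row :: "real \<Rightarrow> nat \<Rightarrow> (nat \<Rightarrow> complex measure) \<Rightarrow> complex \<Rightarrow> real" where
  "gamma_row \<tau> m \<nu> l = Arg l +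
     (\<Sum>j=1..m. (LINT t|centered \<tau> (\<nu> j). Im t) + Arg (centering \<tau> (\<nu> j)))"

end

theory Submission imports Defs "HOL-Library.Poly_Mapping" begin

text \<open>
  Every transform is treated as a formal power series at \<open>0\<close>, and convergence means convergence of each
  coefficient. Weak convergence on the circle is convergence of all moments
  (\<open>weak_conv_iff_moments\<close>), and for measures with nonzero mean this is convergence of the Sigma-series
  (\<open>mom_tendsto_iff_Sigma\<close>). Since the Sigma-series is multiplicative, assertion (1) says that
  products of Sigma-series over the rows of the array tend to the exponential of a series \<open>u\<close>.
  A product becomes a sum by passing to the logarithmic derivative together with the constant term
  (\<open>ctends_iff_logder\<close>).

  For one centered measure \<open>\<mu>\<close> close to the unit mass at \<open>1\<close>, put \<open>\<delta> = \<integral> (1 - Re t) d\<mu>\<close>. Its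
  Sigma-series satisfies an exact equation (\<open>Sigma_equation\<close>), which shows that the logarithmic
  derivative is the derivative of \<open>u\<close> for the data \<open>\<integral> Im t d\<mu>\<close> and \<open>(1 - Re t) d\<mu>\<close>, up to
  \<open>O(\<delta>\<^sup>2)\<close> (\<open>Sigma_linearization\<close>). This rests on the centering, which makes the mean of \<open>Im t\<close> of order
  \<open>\<delta>\<close> (\<open>imbalance_bound\<close>). Summed over a row, the linear terms are exactly the series \<open>u\<close> of
  \<open>\<gamma>\<^sub>n\<close> and \<open>\<sigma>\<^sub>n\<close>, and the error is at most a constant times the largest \<open>\<delta>\<close> in the row times the mass of \<open>\<sigma>\<^sub>n\<close>.
  The first factor vanishes in the limit by infinitesimality. The mass is bounded under either assertion: under
  (2) it converges, and under (1) the constant term of the product, which is the reciprocal of a mean, has modulus at least the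
  exponential of half the mass (\<open>prod_Sigma_growth\<close>). So both assertions amount to convergence of
  \<open>exp (u\<^sub>n(0))\<close> and of the derivatives of \<open>u\<^sub>n\<close> (\<open>array_limit\<close>); the modulus of the former is the
  mass of \<open>\<sigma>\<^sub>n\<close> in exponential form and its phase is that of \<open>- \<gamma>\<^sub>n\<close>, while the derivatives carry the
  other moments.

  Two definite descriptions have to be shown to be meaningful. For the convolution
  (\<open>free_mult_conv\<close>), a free pair of unitaries with given distributions acts on the span of words
  in centered powers (\<open>free_unitaries_exist\<close>), the product has a distribution by
  the trigonometric moment problem (\<open>unitary_has_distr\<close>), and its Sigma-series is computed by factoring the
  resolvent of a product of free elements (\<open>resolvent_mult\<close>). For the limit law
  (\<open>nu_boxtimes\<close>), the inverse function of \<open>z exp (u z)\<close> maps the disc into itself because \<open>u\<close> has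
  nonnegative real part, and the Herglotz representation turns it into a measure.
\<close>

unbundle no vec_syntax

section \<open>Freeness and resolvents\<close>

text \<open>
  Freeness of two subalgebras with respect to a linear functional. The ring is a type, so that formal
  power series over it are available and resolvents of free elements can be multiplied as series.
\<close>

locale free_functional =
  fixes cst :: "complex \<Rightarrow> 'p::ring_1" and \<Phi> :: "'p \<Rightarrow> complex" and B :: "bool \<Rightarrow> 'p set"
  assumes cst_add: "cst (c + d) = cst c + cst d"
    and cst_mult: "cst (c * d) = cst c * cst d"
    and cst_1: "cst 1 = 1"
    and cst_central: "cst c * p = p * cst c"
    and \<Phi>_add: "\<Phi> (p + q) = \<Phi> p + \<Phi> q"
    and \<Phi>_cst: "\<Phi> (cst c * p) = c * \<Phi> p"
    and \<Phi>_1: "\<Phi> 1 = 1"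
    and B_cst: "cst c \<in> B b"
    and B_add: "p \<in> B b \<Longrightarrow> q \<in> B b \<Longrightarrow> p + q \<in> B b"
    and B_mult: "p \<in> B b \<Longrightarrow> q \<in> B b \<Longrightarrow> p * q \<in> B b"
    and free: "w \<noteq> [] \<Longrightarrow> (\<forall>(b, p) \<in> set w. p \<in> B b \<and> \<Phi> p = 0) \<Longrightarrow>
       successively (\<lambda>p q. fst p \<noteq> fst q) w \<Longrightarrow> \<Phi> (prod_list (map snd w)) = 0"
begin

lemma cst_0: "cst 0 = 0"
  using cst_add[of 0 0] by simp

lemma B_0: "0 \<in> B b"
  using B_cst[of 0] by (simp add: cst_0)

lemma cst_minus: "cst (- c) = - cst c"
  using cst_add[of c "- c"] by (simp add: cst_0 eq_neg_iff_add_eq_0 add.commute)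

lemma cst_sum: "cst (sum f A) = (\<Sum>i\<in>A. cst (f i))"
  by (induction A rule: infinite_finite_induct) (auto simp: cst_0 cst_add)

lemma B_minus: "p \<in> B b \<Longrightarrow> - p \<in> B b"
  using B_mult[OF B_cst[of "-1"], of p b] by (simp add: cst_minus cst_1)

lemma B_diff: "p \<in> B b \<Longrightarrow> q \<in> B b \<Longrightarrow> p - q \<in> B b"
  using B_add[of p b "- q"] B_minus by simp

lemma B_sum: "(\<And>i. i \<in> A \<Longrightarrow> f i \<in> B b) \<Longrightarrow> sum f A \<in> B b"
  by (induction A rule: infinite_finite_induct) (auto simp: B_0 B_add)

lemma \<Phi>_0: "\<Phi> 0 = 0"
  using \<Phi>_add[of 0 0] by simp

lemma \<Phi>_minus: "\<Phi> (- p) = - \<Phi> p"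
  using \<Phi>_add[of p "- p"] by (simp add: \<Phi>_0 eq_neg_iff_add_eq_0 add.commute)

lemma \<Phi>_diff: "\<Phi> (p - q) = \<Phi> p - \<Phi> q"
  using \<Phi>_add[of p "- q"] by (simp add: \<Phi>_minus)

lemma \<Phi>_sum: "\<Phi> (sum f A) = (\<Sum>i\<in>A. \<Phi> (f i))"
  by (induction A rule: infinite_finite_induct) (auto simp: \<Phi>_0 \<Phi>_add)

lemma \<Phi>_of_cst: "\<Phi> (cst c) = c"
  using \<Phi>_cst[of c 1] by (simp add: \<Phi>_1)

text \<open>
  The span of the alternating products of centered elements with first factor in
  \<open>B a\<close> and last factor in \<open>B b\<close>. The indices record the two ends so that a product can be
  extended on either side.
\<close>

inductive alt :: "bool \<Rightarrow> bool \<Rightarrow> 'p \<Rightarrow> bool" where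
  base: "p \<in> B a \<Longrightarrow> \<Phi> p = 0 \<Longrightarrow> alt a a (p)"
| zero: "alt a b (0)"
| add: "alt a b (p) \<Longrightarrow> alt a b (q) \<Longrightarrow> alt a b (p + q)"
| cons: "p \<in> B a \<Longrightarrow> \<Phi> p = 0 \<Longrightarrow> alt (\<not> a) b (q) \<Longrightarrow> alt a b (p * q)"

text \<open>
  A word of centered factors in front serves as an accumulator: the leading factor of an
  alternating product moves to the end of this word until freeness applies to the whole word.
\<close>

lemma alt_prefix:
  assumes "alt a b (p)"
  shows "(\<forall>(c, q) \<in> set w. q \<in> B c \<and> \<Phi> q = 0) \<Longrightarrow> successively (\<lambda>p q. fst p \<noteq> fst q) w \<Longrightarrow>
     (w \<noteq> [] \<Longrightarrow> fst (last w) \<noteq> a) \<Longrightarrow> \<Phi> (prod_list (map snd w) * p) = 0"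
  using assms
proof (induction arbitrary: w rule: alt.induct)
  case (base p a)
  have "\<Phi> (prod_list (map snd (w @ [(a, p)]))) = 0"
    by (rule free) (use base in \<open>auto simp: successively_append_iff\<close>)
  then show ?case by simp
next
  case (cons p a b q)
  have "\<Phi> (prod_list (map snd (w @ [(a, p)])) * q) = 0"
    by (rule cons.IH) (use cons in \<open>auto simp: successively_append_iff\<close>)
  then show ?case by (simp add: mult.assoc)
qed (auto simp: \<Phi>_0 \<Phi>_add distrib_left)

lemma \<Phi>_alt: "alt a b (p) \<Longrightarrow> \<Phi> p = 0"
  using alt_prefix[of a b p "[]"] by simp

lemma alt_sum: "(\<And>i. i \<in> A \<Longrightarrow> alt a b (f i)) \<Longrightarrow> alt a b (sum f A)"
  by (induction A rule: infinite_finite_induct) (auto intro: alt.zero alt.add)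

lemma alt_snoc:
  assumes "alt a b (p)" "q \<in> B (\<not> b)" "\<Phi> q = 0"
  shows "alt a (\<not> b) (p * q)"
  using assms
proof (induction rule: alt.induct)
  case (base p a)
  then show ?case by (auto intro!: alt.cons alt.base)
qed (auto intro: alt.intros simp: distrib_right mult.assoc)

definition emb :: "complex fps \<Rightarrow> 'p fps" where
  "emb f = Abs_fps (\<lambda>n. cst (f $ n))"

definition \<Phi>f :: "'p fps \<Rightarrow> complex fps" where
  "\<Phi>f F = Abs_fps (\<lambda>n. \<Phi> (F $ n))"

lemma emb_add: "emb (f + g) = emb f + emb g"
  by (rule fps_ext) (simp add: emb_def cst_add)

lemma emb_mult: "emb (f * g) = emb f * emb g"
  by (rule fps_ext) (simp add: emb_def fps_mult_nth cst_sum cst_mult)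

lemma emb_1: "emb 1 = 1"
  by (rule fps_ext) (simp add: emb_def cst_1 cst_0)

lemma emb_central: "emb f * F = F * emb f"
proof (rule fps_ext)
  fix n
  have "(F * emb f) $ n = (\<Sum>i=0..n. F $ i * cst (f $ (n - i)))"
    by (simp add: fps_mult_nth emb_def)
  also have "\<dots> = (\<Sum>i=0..n. F $ (n - i) * cst (f $ (n - (n - i))))"
    by (rule sum.reindex_bij_witness[of _ "\<lambda>i. n - i" "\<lambda>i. n - i"]) auto
  also have "\<dots> = (\<Sum>i=0..n. cst (f $ i) * F $ (n - i))"
    by (intro sum.cong) (auto simp: cst_central)
  finally show "(emb f * F) $ n = (F * emb f) $ n"
    by (simp add: fps_mult_nth emb_def)
qed

lemma \<Phi>f_add: "\<Phi>f (F + G) = \<Phi>f F + \<Phi>f G"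
  by (rule fps_ext) (simp add: \<Phi>f_def \<Phi>_add)

lemma \<Phi>f_emb: "\<Phi>f (emb f * F) = f * \<Phi>f F"
  by (rule fps_ext) (simp add: \<Phi>f_def emb_def fps_mult_nth \<Phi>_sum \<Phi>_cst)

lemma \<Phi>f_const: "\<Phi>f (fps_const p) = fps_const (\<Phi> p)"
  by (rule fps_ext) (simp add: \<Phi>f_def \<Phi>_0)

lemma \<Phi>f_alt: "(\<And>n. alt a b (F $ n)) \<Longrightarrow> \<Phi>f F = 0"
  by (rule fps_ext) (use \<Phi>_alt in \<open>auto simp: \<Phi>f_def\<close>)

text \<open>
  The inverse of \<open>1 - \<alpha> U\<close>; it exists as a series because \<open>\<alpha>\<close> has no constant term.
\<close>

definition resolvent :: "complex fps \<Rightarrow> 'p \<Rightarrow> 'p fps" where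
  "resolvent \<alpha> U = fps_right_inverse (1 - emb \<alpha> * fps_const U) 1"

lemma resolvent:
  assumes "\<alpha> $ 0 = 0"
  shows "(1 - emb \<alpha> * fps_const U) * resolvent \<alpha> U = 1"
    and "resolvent \<alpha> U * (1 - emb \<alpha> * fps_const U) = 1"
proof -
  have 0: "(1 - emb \<alpha> * fps_const U) $ 0 = 1"
    using assms by (simp add: emb_def cst_0)
  show "(1 - emb \<alpha> * fps_const U) * resolvent \<alpha> U = 1"
    unfolding resolvent_def by (rule fps_right_inverse) (use 0 in simp)
  have "fps_left_inverse (1 - emb \<alpha> * fps_const U) 1 = resolvent \<alpha> U"
    unfolding resolvent_def by (rule fps_left_inverse_eq_fps_right_inverse) (use 0 in simp_all)
  then show "resolvent \<alpha> U * (1 - emb \<alpha> * fps_const U) = 1"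
    using fps_left_inverse[of 1 "1 - emb \<alpha> * fps_const U"] 0 by simp
qed

lemma resolvent_eq:
  assumes "\<alpha> $ 0 = 0"
  shows "resolvent \<alpha> U = 1 + emb \<alpha> * (fps_const U * resolvent \<alpha> U)"
  using resolvent(1)[OF assms, of U] by (simp add: algebra_simps)

lemma resolvent_unique:
  assumes "\<alpha> $ 0 = 0" "(1 - emb \<alpha> * fps_const U) * W = 1"
  shows "W = resolvent \<alpha> U"
proof -
  have "W = (resolvent \<alpha> U * (1 - emb \<alpha> * fps_const U)) * W"
    using resolvent(2)[OF assms(1)] by simp
  also have "\<dots> = resolvent \<alpha> U"
    using assms(2) by (simp add: mult.assoc)
  finally show ?thesis .
qed

lemma resolvent_B:
  assumes "\<alpha> $ 0 = 0" "U \<in> B b"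
  shows "resolvent \<alpha> U $ n \<in> B b"
proof (induction n rule: less_induct)
  case (less n)
  have "resolvent \<alpha> U $ n = (1 :: 'p fps) $ n + (\<Sum>i=0..n. cst (\<alpha> $ i) * (U * resolvent \<alpha> U $ (n - i)))"
    by (subst resolvent_eq[OF assms(1)]) (simp add: fps_mult_nth[of "emb \<alpha>"], simp add: emb_def)
  moreover have "cst (\<alpha> $ i) * (U * resolvent \<alpha> U $ (n - i)) \<in> B b" if "i \<le> n" for i
  proof (cases "i = 0")
    case True then show ?thesis by (simp add: assms cst_0 B_0)
  next
    case False then show ?thesis
      using that by (intro B_mult B_cst assms less.IH) auto
  qed
  moreover have "(1 :: 'p fps) $ n \<in> B b"
    using B_cst[of 1 b] B_0[of b] by (auto simp: cst_1)
  ultimately show ?case by (metis (no_types, lifting) B_add B_sum atLeastAtMost_iff)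
qed

text \<open>
  Iterating \<open>R = 1 + \<alpha> U R\<close> gives the geometric series in \<open>\<alpha> U\<close>. The remainder after
  \<open>n\<close> steps is divisible by \<open>\<alpha>\<close> to the power \<open>n + 1\<close> and is invisible in coefficient \<open>n\<close>.
\<close>

lemma \<Phi>f_resolvent:
  assumes "\<alpha> $ 0 = 0"
  shows "\<Phi>f (resolvent \<alpha> U) = Abs_fps (\<lambda>k. \<Phi> (U ^ k)) oo \<alpha>"
proof (rule fps_ext)
  fix n
  define G where "G k = \<Phi>f (fps_const (U ^ k) * resolvent \<alpha> U)" for k
  have G: "G k = fps_const (\<Phi> (U ^ k)) + \<alpha> * G (Suc k)" for k
  proof -
    have "fps_const (U ^ k) * resolvent \<alpha> U =
       fps_const (U ^ k) + fps_const (U ^ k) * (emb \<alpha> * (fps_const U * resolvent \<alpha> U))"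
      by (subst resolvent_eq[OF assms]) (simp add: distrib_left)
    also have "fps_const (U ^ k) * (emb \<alpha> * (fps_const U * resolvent \<alpha> U)) =
       emb \<alpha> * (fps_const (U ^ Suc k) * resolvent \<alpha> U)"
      by (simp add: mult.assoc[symmetric] emb_central) (simp add: mult.assoc power_commutes)
    finally show ?thesis
      unfolding G_def by (simp add: \<Phi>f_add \<Phi>f_emb \<Phi>f_const)
  qed
  have "G 0 = (\<Sum>k=0..m. fps_const (\<Phi> (U ^ k)) * \<alpha> ^ k) + \<alpha> ^ Suc m * G (Suc m)" for m
  proof (induction m)
    case 0 show ?case using G[of 0] by simp
  next
    case (Suc m) then show ?case
      by (simp add: G[of "Suc m"] algebra_simps)
  qed
  from this[of n] have "G 0 $ n = (\<Sum>k=0..n. fps_const (\<Phi> (U ^ k)) * \<alpha> ^ k) $ n + (\<alpha> ^ Suc n * G (Suc n)) $ n"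
    by simp
  also have "(\<alpha> ^ Suc n * G (Suc n)) $ n = (\<Sum>i=0..n. (\<alpha> ^ Suc n) $ i * G (Suc n) $ (n - i))"
    by (simp only: fps_mult_nth)
  also have "\<dots> = 0"
    by (intro sum.neutral ballI) (use startsby_zero_power_prefix[OF assms, of "Suc n"] in auto)
  finally show "\<Phi>f (resolvent \<alpha> U) $ n = (Abs_fps (\<lambda>k. \<Phi> (U ^ k)) oo \<alpha>) $ n"
    by (simp add: G_def fps_compose_nth fps_sum_nth)
qed

lemma emb_X: "emb fps_X = fps_X"
  by (rule fps_ext) (simp add: emb_def cst_1 cst_0 fps_X_def)

lemma B_fps_mult_alt:
  assumes "\<And>n. F $ n \<in> B a" "\<And>n. \<Phi> (F $ n) = 0" "\<And>n. alt (\<not> a) b (G $ n)"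
  shows "alt a b ((F * G) $ n)"
  using assms by (auto simp: fps_mult_nth intro!: alt_sum alt.cons)

lemma alt_mult_B_fps:
  assumes "\<And>n. F $ n \<in> B (\<not> b)" "\<And>n. \<Phi> (F $ n) = 0" "\<And>n. alt a b (G $ n)"
  shows "alt a (\<not> b) ((G * F) $ n)"
  using assms by (auto simp: fps_mult_nth intro!: alt_sum alt_snoc)

text \<open>
  The core of the multiplicativity of the S-transform, following Haagerup's algebraic proof.
  With \<open>z\<close> the formal variable, \<open>P\<close>, \<open>Q\<close> the resolvents of \<open>U\<close>, \<open>V\<close>, the hypotheses say
  that \<open>x = P - (1 + z)\<close> and \<open>y = Q - (1 + z)\<close> are centered. The relation between \<open>\<alpha>\<close>, \<open>\<beta>\<close>
  and \<open>\<gamma>\<close> gives \<open>P (1 - \<gamma> U V) Q = (1 + z) - x y / z\<close>, so the resolvent of \<open>U V\<close> is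
  \<open>Q R P / (1 + z)\<close>, where \<open>R\<close> is the Neumann series of the alternating product
  \<open>T = x y / (z (1 + z))\<close>. After expanding, freeness kills every term but the scalar one,
  whose value is \<open>(1 + z)\<^sup>2 / (1 + z)\<close>.
\<close>

lemma resolvent_mult:
  assumes \<alpha>: "\<alpha> $ 0 = 0" and \<beta>: "\<beta> $ 0 = 0"
    and U: "U \<in> B True" and V: "V \<in> B False"
    and RU: "\<Phi>f (resolvent \<alpha> U) = 1 + fps_X" and RV: "\<Phi>f (resolvent \<beta> V) = 1 + fps_X"
    and \<gamma>: "fps_X * \<gamma> = \<alpha> * \<beta> * (1 + fps_X)"
  shows "\<gamma> $ 0 = 0" "\<Phi>f (resolvent \<gamma> (U * V)) = 1 + fps_X"
proof -
  have "(fps_X * \<gamma>) $ Suc 0 = 0"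
    unfolding \<gamma> using \<alpha> \<beta> by (simp add: fps_mult_nth)
  then show \<gamma>0: "\<gamma> $ 0 = 0" by simp
  define P where "P = resolvent \<alpha> U"
  define Q where "Q = resolvent \<beta> V"
  define z where "z = emb fps_X"
  define ii where "ii = emb (inverse (1 + fps_X))"
  define x where "x = P - (1 + z)"
  define y where "y = Q - (1 + z)"
  define A where "A = emb \<alpha> * fps_const U"
  define C where "C = emb \<beta> * fps_const V"
  define D where "D = emb \<gamma> * fps_const (U * V)"
  \<comment> \<open>The series \<open>y\<close> has no constant term and can be divided by the variable.\<close>
  define y' where "y' = fps_shift 1 y"
  have zc: "z * F = F * z" for F unfolding z_def by (rule emb_central)
  have o: "1 + z = emb (1 + fps_X)" by (simp add: z_def emb_add emb_1)
  have emb_left: "F * (emb f * G) = emb f * (F * G)" for f F G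
    by (simp only: mult.assoc[symmetric] emb_central[of f F, symmetric])
  have ii: "ii * (1 + z) = 1"
    unfolding ii_def o emb_mult[symmetric] by (subst inverse_mult_eq_1) (auto simp: emb_1)
  have oB: "(1 + z) $ n \<in> B b" for n b unfolding o by (simp add: emb_def B_cst)
  have xB: "x $ n \<in> B True" and yB: "y $ n \<in> B False" for n
    using oB[of n] resolvent_B[OF \<alpha> U, of n] resolvent_B[OF \<beta> V, of n] B_diff
    by (simp_all add: x_def y_def P_def Q_def del: fps_add_nth)
  have \<Phi>fo: "\<Phi>f (1 + z) = 1 + fps_X"
    unfolding o using \<Phi>f_emb[of "1 + fps_X" 1] \<Phi>f_const[of 1] by (simp add: \<Phi>_1)
  have "\<Phi>f x + \<Phi>f (1 + z) = \<Phi>f P" "\<Phi>f y + \<Phi>f (1 + z) = \<Phi>f Q"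
    unfolding \<Phi>f_add[symmetric] by (simp_all add: x_def y_def)
  then have \<Phi>fx: "\<Phi>f x = 0" and \<Phi>fy: "\<Phi>f y = 0"
    using RU RV by (simp_all add: \<Phi>fo P_def Q_def)
  have x0: "\<Phi> (x $ n) = 0" and y0: "\<Phi> (y $ n) = 0" for n
    using \<Phi>fx \<Phi>fy by (auto simp: \<Phi>f_def fps_eq_iff)
  have Q0: "Q $ 0 = 1"
    unfolding Q_def using \<beta> by (subst resolvent_eq[OF \<beta>]) (simp add: emb_def cst_0)
  have "y $ 0 = 0" by (simp add: y_def Q0 z_def emb_X)
  then have y_z: "y = z * y'"
    unfolding y'_def z_def emb_X by (intro fps_ext) (simp add: fps_X_mult_nth)
  have AP: "(1 - A) * P = 1" and XA: "P * (1 - A) = 1"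
    unfolding A_def P_def using resolvent[OF \<alpha>] by auto
  have CY: "(1 - C) * Q = 1" and YC: "Q * (1 - C) = 1"
    unfolding C_def Q_def using resolvent[OF \<beta>] by auto
  have XA': "P * A = P - 1" using XA by (simp add: algebra_simps)
  have CY': "C * Q = Q - 1" using CY by (simp add: algebra_simps)
  have zD: "z * D = (1 + z) * (A * C)"
  proof -
    have "z * D = emb (fps_X * \<gamma>) * fps_const (U * V)"
      by (simp add: z_def D_def emb_mult mult.assoc)
    also have "\<dots> = (1 + z) * (emb \<alpha> * (emb \<beta> * fps_const U) * fps_const V)"
      unfolding \<gamma> o by (simp add: emb_mult mult.assoc emb_central[of "1 + fps_X"])
    also have "\<dots> = (1 + z) * (A * C)"
      by (subst emb_central[of \<beta> "fps_const U"]) (simp add: A_def C_def mult.assoc)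
    finally show ?thesis .
  qed
  have P: "P = 1 + z + x" and Q: "Q = 1 + z + y" by (simp_all add: x_def y_def)
  note rules = zc[of x, symmetric] zc[of y, symmetric]
  have xz: "x * (z * F) = z * (x * F)" and yz: "y * (z * F) = z * (y * F)" for F
    unfolding z_def by (simp_all add: emb_left)
  have "z * (P * (1 - D) * Q) = z * (P * Q) - P * (z * D) * Q"
    unfolding z_def by (simp add: left_diff_distrib right_diff_distrib mult.assoc emb_left)
  also have "P * (z * D) * Q = (1 + z) * ((P * A) * (C * Q))"
    unfolding zD o by (simp add: emb_left mult.assoc)
  also have "z * (P * Q) - (1 + z) * ((P * A) * (C * Q)) = z * (1 + z) - x * y"
    unfolding XA' CY' unfolding P Q by (simp add: algebra_simps rules xz yz)
  also have "x * y = z * (x * y')"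
    unfolding y_z by (simp add: xz)
  finally have "z * (P * (1 - D) * Q) = z * ((1 + z) - x * y')"
    by (simp add: right_diff_distrib)
  then have "(fps_X * (P * (1 - D) * Q)) $ Suc n = (fps_X * ((1 + z) - x * y')) $ Suc n" for n
    unfolding z_def emb_X by (rule arg_cong)
  then have XDY: "P * (1 - D) * Q = (1 + z) - x * y'"
    by (intro fps_ext) simp
  define T where "T = (ii * x) * y'"
  have oT: "(1 + z) * (1 - T) = (1 + z) - x * y'"
  proof -
    have "(1 + z) * ii = 1" using ii unfolding ii_def o by (simp only: emb_central[of "1 + fps_X"])
    then have "(1 + z) * T = x * y'" by (simp add: T_def mult.assoc[symmetric])
    then show ?thesis by (simp add: right_diff_distrib)
  qed
  have x_0: "x $ 0 = 0"
    unfolding x_def P_def using \<alpha> by (subst resolvent_eq[OF \<alpha>]) (simp add: emb_def cst_0 z_def emb_X)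
  then have T0: "T $ 0 = 0" by (simp add: T_def)
  define R where "R = fps_right_inverse (1 - T) 1"
  have R: "(1 - T) * R = 1"
    unfolding R_def by (rule fps_right_inverse) (simp add: T0)
  have D: "1 - D = (1 - A) * ((1 + z) * (1 - T)) * (1 - C)"
  proof -
    have "1 - D = ((1 - A) * P) * (1 - D) * (Q * (1 - C))" by (simp add: AP YC)
    also have "\<dots> = (1 - A) * (P * (1 - D) * Q) * (1 - C)" by (simp add: mult.assoc)
    finally show ?thesis by (simp add: XDY oT)
  qed
  \<comment> \<open>The candidate for the resolvent of \<open>U V\<close>.\<close>
  define W where "W = ii * (Q * R * P)"
  have "(1 - D) * W = (1 - A) * (ii * (1 + z)) * (1 - T) * ((1 - C) * Q) * R * P"
    unfolding D W_def ii_def by (simp add: mult.assoc emb_left)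
  also have "\<dots> = (1 - A) * ((1 - T) * R) * P"
    by (simp add: ii CY mult.assoc)
  finally have "(1 - D) * W = 1" by (simp add: R AP)
  then have W: "W = resolvent \<gamma> (U * V)"
    unfolding D_def by (rule resolvent_unique[OF \<gamma>0])
  define S where "S = R - 1"
  have S: "S = T + T * S"
    using R by (simp add: S_def algebra_simps)
  have iix: "(ii * x) $ n \<in> B True" "\<Phi> ((ii * x) $ n) = 0" for n
  proof -
    have "ii $ k \<in> B True" for k by (simp add: ii_def emb_def B_cst)
    then show "(ii * x) $ n \<in> B True" by (auto simp: fps_mult_nth intro!: B_sum B_mult xB)
    have "\<Phi>f (ii * x) = 0" unfolding ii_def by (simp add: \<Phi>f_emb \<Phi>fx)
    then show "\<Phi> ((ii * x) $ n) = 0" by (auto simp: \<Phi>f_def fps_eq_iff)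
  qed
  have y'B: "y' $ n \<in> B False" "\<Phi> (y' $ n) = 0" for n
    using yB y0 by (auto simp: y'_def)
  have Talt: "alt True False (T $ n)" for n
    unfolding T_def by (intro B_fps_mult_alt iix) (simp add: alt.base y'B)
  have Salt: "alt True False (S $ n)" for n
  proof (induction n rule: less_induct)
    case (less n)
    have "S $ n = T $ n + (\<Sum>i=0..n. T $ i * S $ (n - i))"
      by (subst S) (simp add: fps_mult_nth)
    moreover have "alt True False (T $ i * S $ (n - i))" if "i \<le> n" for i
    proof (cases "i = 0")
      case True then show ?thesis by (simp add: T0 alt.zero)
    next
      case False
      then have SS: "alt True False (S $ (n - i))" using less.IH that by simp
      have "T $ i * S $ (n - i) = (\<Sum>j=0..i. (ii * x) $ j * (y' $ (i - j) * S $ (n - i)))"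
        unfolding T_def fps_mult_nth[of "ii * x" y'] by (simp only: sum_distrib_right mult.assoc)
      also have "alt True False \<dots>"
        by (rule alt_sum, rule alt.cons, rule iix, rule iix, rule alt.cons) (simp_all add: y'B SS)
      finally show ?thesis .
    qed
    ultimately show ?case
      using alt.add[OF Talt[of n] alt_sum[where A = "{0..n}" and f = "\<lambda>i. T $ i * S $ (n - i)"]] by simp
  qed
  have Sx: "alt True True ((S * x) $ n)" for n
    using alt_mult_B_fps[of x False True S n] xB x0 Salt by simp
  have yS: "alt False False ((y * S) $ n)" for n
    using B_fps_mult_alt[of y False False S n] yB y0 Salt by simp
  have ySx: "alt False True ((y * (S * x)) $ n)" for n
    using B_fps_mult_alt[of y False True "S * x" n] yB y0 Sx by simp
  have yx: "alt False True ((y * x) $ n)" for n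
    using B_fps_mult_alt[of y False True x n] yB y0 xB x0 alt.base by simp
  have "Q * R * P = (1 + z) * (1 + z) + (1 + z) * x + (1 + z) * y + y * x + (1 + z) * ((1 + z) * S)
     + (1 + z) * (S * x) + (1 + z) * (y * S) + y * (S * x)"
  proof -
    have RS: "R = 1 + S" by (simp add: S_def)
    have Sz: "S * z = z * S" "S * (z * F) = z * (S * F)" for F
      by (rule zc[symmetric]) (unfold z_def, rule emb_left)
    show ?thesis unfolding P Q RS by (simp add: algebra_simps rules xz yz Sz)
  qed
  then have "\<Phi>f (Q * R * P) = \<Phi>f ((1 + z) * (1 + z)) + \<Phi>f ((1 + z) * x) + \<Phi>f ((1 + z) * y) + \<Phi>f (y * x)
     + \<Phi>f ((1 + z) * ((1 + z) * S)) + \<Phi>f ((1 + z) * (S * x)) + \<Phi>f ((1 + z) * (y * S)) + \<Phi>f (y * (S * x))"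
    by (simp only: \<Phi>f_add)
  also have "\<dots> = (1 + fps_X) * (1 + fps_X)"
    using \<Phi>f_alt[OF Sx] \<Phi>f_alt[OF yS] \<Phi>f_alt[OF ySx] \<Phi>f_alt[OF yx] \<Phi>f_alt[OF Salt] \<Phi>fo
    unfolding o by (simp add: \<Phi>f_emb \<Phi>fx \<Phi>fy)
  finally have "\<Phi>f W = inverse (1 + fps_X) * ((1 + fps_X) * (1 + fps_X))"
    unfolding W_def ii_def by (simp add: \<Phi>f_emb)
  also have "\<dots> = 1 + fps_X"
    by (simp add: mult.assoc[symmetric] inverse_mult_eq_1)
  finally show "\<Phi>f (resolvent \<gamma> (U * V)) = 1 + fps_X" by (simp add: W)
qed

end

section \<open>Noncommutative polynomials in two elements\<close>

lemma poly_mapping_induct_single [case_names single add]: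
  fixes p :: "'k \<Rightarrow>\<^sub>0 'c::comm_monoid_add"
  assumes single: "\<And>k c. P (Poly_Mapping.single k c)" and add: "\<And>p q. P p \<Longrightarrow> P q \<Longrightarrow> P (p + q)"
  shows "P p"
proof -
  have "p = (\<Sum>k\<in>Poly_Mapping.keys p. Poly_Mapping.single k (Poly_Mapping.lookup p k))"
    by (rule poly_mapping_eqI) (auto simp: lookup_sum lookup_single when_def in_keys_iff)
  moreover have "P (\<Sum>k\<in>F. Poly_Mapping.single k (Poly_Mapping.lookup p k))" for F
    using single[of undefined 0]
    by (induction F rule: infinite_finite_induct) (auto intro: single add)
  ultimately show ?thesis by metis
qed

text \<open>
  Words in two letters as an additive monoid: the finitely supported functions on it, with
  convolution, form the free algebra on two generators.
\<close>

datatype fword = FWord (letters: "bool list")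

instantiation fword :: monoid_add
begin
definition zero_fword where "0 = FWord []"
definition plus_fword where "v + w = FWord (letters v @ letters w)"
instance by standard (simp_all add: zero_fword_def plus_fword_def)
end

lemma letters_zero: "letters 0 = []"
  by (simp add: zero_fword_def)

context star_prob_space
begin

lemma smult_closed' [simp, intro]: "x \<in> carrier A \<Longrightarrow> c \<odot> x \<in> carrier A"
  by (rule smult_closed) (simp add: ring_of_type_algebra_def)

lemma smult_smult: "x \<in> carrier A \<Longrightarrow> c \<odot> (d \<odot> x) = (c * d) \<odot> x"
  using smult_assoc1[of c d x] by (simp add: ring_of_type_algebra_def)

lemma smult_one': "x \<in> carrier A \<Longrightarrow> 1 \<odot> x = x"
  using smult_one[of x] by (simp add: ring_of_type_algebra_def)

lemma star_subalgebra_star_generated: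
  assumes "G \<subseteq> carrier A"
  shows "star_subalgebra A (star_generated A G)" "G \<subseteq> star_generated A G"
proof -
  have "star_subalgebra A (carrier A)"
    by (auto simp: star_subalgebra_def star_closed)
  then have "star_generated A G \<subseteq> carrier A"
    using assms unfolding star_generated_def by blast
  then show "star_subalgebra A (star_generated A G)"
    unfolding star_subalgebra_def star_generated_def by blast
qed (auto simp: star_generated_def)

definition word_value :: "(bool \<Rightarrow> 'a) \<Rightarrow> fword \<Rightarrow> 'a" where
  "word_value g w = foldr (\<lambda>b a. g b \<otimes> a) (letters w) \<one>"

text \<open>
  Substitution of elements of \<open>A\<close> into a noncommutative polynomial, as a relation that
  follows the way in which the polynomial is built from monomials.
\<close>

inductive evaluates :: "(bool \<Rightarrow> 'a) \<Rightarrow> (fword \<Rightarrow>\<^sub>0 complex) \<Rightarrow> 'a \<Rightarrow> bool" for g where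
  single: "evaluates g (Poly_Mapping.single w c) (c \<odot> word_value g w)"
| add: "evaluates g p a \<Longrightarrow> evaluates g q b \<Longrightarrow> evaluates g (p + q) (a \<oplus> b)"

definition pulled_state :: "(bool \<Rightarrow> 'a) \<Rightarrow> (fword \<Rightarrow>\<^sub>0 complex) \<Rightarrow> complex" where
  "pulled_state g p = (\<Sum>w\<in>Poly_Mapping.keys p. Poly_Mapping.lookup p w * \<phi> (word_value g w))"

lemma word_value_closed [simp, intro]: "range g \<subseteq> carrier A \<Longrightarrow> word_value g w \<in> carrier A"
proof -
  assume "range g \<subseteq> carrier A"
  then have "foldr (\<lambda>b a. g b \<otimes> a) l \<one> \<in> carrier A" for l by (induction l) auto
  then show ?thesis by (simp add: word_value_def)
qed

lemma word_value_add: "range g \<subseteq> carrier A \<Longrightarrow> word_value g (v + w) = word_value g v \<otimes> word_value g w"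
proof -
  assume g: "range g \<subseteq> carrier A"
  then have g': "g b \<in> carrier A" for b by auto
  then have c: "foldr (\<lambda>b a. g b \<otimes> a) l \<one> \<in> carrier A" for l by (induction l) auto
  have "foldr (\<lambda>b a. g b \<otimes> a) (l @ m) \<one> = foldr (\<lambda>b a. g b \<otimes> a) l \<one> \<otimes> foldr (\<lambda>b a. g b \<otimes> a) m \<one>" for l m
    using g' c by (induction l) (auto simp: m_assoc)
  then show ?thesis by (simp add: word_value_def plus_fword_def)
qed

lemma evaluates_closed: "range g \<subseteq> carrier A \<Longrightarrow> evaluates g p a \<Longrightarrow> a \<in> carrier A"
  by (rotate_tac, induction rule: evaluates.induct) auto

lemma pulled_state_single: "pulled_state g (Poly_Mapping.single w c) = c * \<phi> (word_value g w)"
  by (simp add: pulled_state_def)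

lemma pulled_state_add: "pulled_state g (p + q) = pulled_state g p + pulled_state g q"
  unfolding pulled_state_def
  by (rule setsum_keys_plus_distrib) (auto simp: distrib_right)

lemma evaluates_state:
  assumes "range g \<subseteq> carrier A" "evaluates g p a"
  shows "\<phi> a = pulled_state g p"
  using assms(2)
  by induction (use assms(1) evaluates_closed in \<open>auto simp: state_smult state_add pulled_state_single pulled_state_add\<close>)

lemma evaluates_mult:
  assumes g: "range g \<subseteq> carrier A" and p: "evaluates g p a" and q: "evaluates g q b"
  shows "evaluates g (p * q) (a \<otimes> b)"
  using p
proof induction
  case (single w c)
  from q show ?case
  proof induction
    case (single v d)
    have "(c \<odot> word_value g w) \<otimes> (d \<odot> word_value g v) = (c * d) \<odot> word_value g (w + v)"
      using g by (simp add: smult_mult_left smult_mult_right smult_smult word_value_add mult.commute)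
    then show ?case by (simp add: mult_single evaluates.single)
  next
    case (add p a q b)
    then show ?case
      using g by (simp add: distrib_left r_distr evaluates_closed evaluates.add)
  qed
next
  case (add p a q' b')
  then show ?case
    using g q by (simp add: distrib_right l_distr evaluates_closed evaluates.add)
qed

lemma evaluates_one:
  shows "evaluates g 1 \<one>"
  using evaluates.single[of g 0 1] by (simp add: word_value_def letters_zero smult_one')

lemma evaluates_pow:
  assumes g: "range g \<subseteq> carrier A" and p: "evaluates g p a"
  shows "evaluates g (p ^ k) (a [^] k)"
  by (induction k) (auto simp: evaluates_one evaluates_mult[OF g _ p] power_Suc2 simp del: power_Suc)

text \<open>
  Evaluation is multiplicative and carries the pulled back state to \<open>\<phi>\<close>, so a vanishing
  alternating moment in \<open>A\<close> is a vanishing alternating moment of polynomials. This moves freeness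
  from a ring with a carrier to a ring that is a type.
\<close>

lemma free_functional_pulled_state:
  assumes g: "range g \<subseteq> carrier A"
    and free: "free_subalgebras A \<phi> UNIV (\<lambda>b. star_generated A {g b})"
  shows "free_functional (Poly_Mapping.single 0) (pulled_state g)
     (\<lambda>b. {p. \<exists>a\<in>star_generated A {g b}. evaluates g p a})"
proof
  have sub: "star_subalgebra A (star_generated A {g b})" for b
    using g by (intro star_subalgebra_star_generated) auto
  have cl: "a \<in> carrier A" if "a \<in> star_generated A {g b}" for a b
    using that sub[of b] by (auto simp: star_subalgebra_def)
  fix c d :: complex and p q :: "fword \<Rightarrow>\<^sub>0 complex" and b :: bool
  show "Poly_Mapping.single 0 (c + d) = Poly_Mapping.single 0 c + (Poly_Mapping.single 0 d :: fword \<Rightarrow>\<^sub>0 complex)"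
    by (rule single_add)
  show "Poly_Mapping.single 0 (c * d) = Poly_Mapping.single 0 c * (Poly_Mapping.single 0 d :: fword \<Rightarrow>\<^sub>0 complex)"
    by (simp add: mult_single)
  show "Poly_Mapping.single 0 1 = (1 :: fword \<Rightarrow>\<^sub>0 complex)" by simp
  show "Poly_Mapping.single 0 c * p = p * Poly_Mapping.single 0 c"
    by (induction p rule: poly_mapping_induct_single) (auto simp: mult_single distrib_left distrib_right mult.commute)
  show "pulled_state g (p + q) = pulled_state g p + pulled_state g q" by (rule pulled_state_add)
  show "pulled_state g (Poly_Mapping.single 0 c * p) = c * pulled_state g p"
    by (induction p rule: poly_mapping_induct_single)
      (auto simp: mult_single pulled_state_single distrib_left pulled_state_add)
  show "pulled_state g 1 = 1"
    using evaluates_state[OF g evaluates_one] by (simp add: state_one)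
  show "Poly_Mapping.single 0 c \<in> {p. \<exists>a\<in>star_generated A {g b}. evaluates g p a}"
    using evaluates.single[of g 0 c] sub[of b]
    by (auto simp: word_value_def zero_fword_def star_subalgebra_def)
  show "p + q \<in> {p. \<exists>a\<in>star_generated A {g b}. evaluates g p a}"
    if "p \<in> {p. \<exists>a\<in>star_generated A {g b}. evaluates g p a}"
       "q \<in> {p. \<exists>a\<in>star_generated A {g b}. evaluates g p a}"
    using that sub[of b] by (auto simp: star_subalgebra_def dest: evaluates.add)
  show "p * q \<in> {p. \<exists>a\<in>star_generated A {g b}. evaluates g p a}"
    if "p \<in> {p. \<exists>a\<in>star_generated A {g b}. evaluates g p a}"
       "q \<in> {p. \<exists>a\<in>star_generated A {g b}. evaluates g p a}"
    using that sub[of b] by (auto simp: star_subalgebra_def dest: evaluates_mult[OF g])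
  show "pulled_state g (prod_list (map snd w)) = 0"
    if "w \<noteq> []"
      and w: "\<forall>(b, p) \<in> set w. p \<in> {p. \<exists>a\<in>star_generated A {g b}. evaluates g p a} \<and> pulled_state g p = 0"
      and alt: "successively (\<lambda>p q. fst p \<noteq> fst q) w" for w
  proof -
    obtain h where h: "\<And>b p. (b, p) \<in> set w \<Longrightarrow> h b p \<in> star_generated A {g b} \<and> evaluates g p (h b p)"
      using w by (simp add: case_prod_beta Ball_def) metis
    define w' where "w' = map (\<lambda>(b, p). (b, h b p)) w"
    have "evaluates g (prod_list (map snd v)) (foldr (\<otimes>) (map snd (map (\<lambda>(b, p). (b, h b p)) v)) \<one>)"
      if "set v \<subseteq> set w" for v
      using that by (induction v) (auto simp: evaluates_one intro!: evaluates_mult[OF g] dest: h)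
    then have "evaluates g (prod_list (map snd w)) (foldr (\<otimes>) (map snd w') \<one>)"
      unfolding w'_def by blast
    moreover have "\<phi> (foldr (\<otimes>) (map snd w') \<one>) = 0"
    proof -
      have "w' \<noteq> []" using \<open>w \<noteq> []\<close> by (simp add: w'_def)
      moreover have "\<forall>(i, a)\<in>set w'. i \<in> UNIV \<and> a \<in> star_generated A {g i} \<and> \<phi> a = 0"
        using h w evaluates_state[OF g] unfolding w'_def by fastforce
      moreover have "successively (\<lambda>p q. fst p \<noteq> fst q) w'"
        using alt unfolding w'_def successively_map by (simp add: case_prod_beta)
      ultimately show ?thesis using free unfolding free_subalgebras_def by blast
    qed
    ultimately show ?thesis using evaluates_state[OF g] by metis
  qed
qed

text \<open>
  In terms of \<open>\<psi>\<close>, the series \<open>\<alpha>\<close>, \<open>\<beta>\<close>, \<open>\<gamma>\<close> are the compositional inverses for \<open>u\<close>, \<open>v\<close>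
  and \<open>u v\<close>, and the relation between them is multiplicativity of the S-transform. Stated for
  solutions of equations, it also shows that \<open>u v\<close> has nonzero mean: its moment series can be inverted.
\<close>

theorem moment_series_mult:
  assumes u: "u \<in> carrier A" and v: "v \<in> carrier A" and free: "free_elems A \<phi> u v"
    and \<alpha>: "\<alpha> $ 0 = 0" "Abs_fps (\<lambda>k. \<phi> (u [^] k)) oo \<alpha> = 1 + fps_X"
    and \<beta>: "\<beta> $ 0 = 0" "Abs_fps (\<lambda>k. \<phi> (v [^] k)) oo \<beta> = 1 + fps_X"
    and \<gamma>: "fps_X * \<gamma> = \<alpha> * \<beta> * (1 + fps_X)"
  shows "\<gamma> $ 0 = 0" "Abs_fps (\<lambda>k. \<phi> ((u \<otimes> v) [^] k)) oo \<gamma> = 1 + fps_X"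
proof -
  define g where "g = (\<lambda>b. if b then u else v)"
  have g: "range g \<subseteq> carrier A" using u v by (auto simp: g_def)
  interpret free_functional "Poly_Mapping.single 0" "pulled_state g"
     "\<lambda>b. {p. \<exists>a\<in>star_generated A {g b}. evaluates g p a}"
    using free by (intro free_functional_pulled_state g) (simp add: free_elems_def g_def if_distrib)
  define U V where "U = Poly_Mapping.single (FWord [True]) (1 :: complex)"
    and "V = Poly_Mapping.single (FWord [False]) (1 :: complex)"
  have U: "evaluates g U u" and V: "evaluates g V v"
    using evaluates.single[of g "FWord [True]" 1] evaluates.single[of g "FWord [False]" 1] u v
    by (simp_all add: U_def V_def word_value_def g_def smult_one')
  have UV: "evaluates g (U * V) (u \<otimes> v)" by (rule evaluates_mult[OF g U V])
  have st: "pulled_state g (p ^ k) = \<phi> (a [^] k)" if "evaluates g p a" for p a and k :: nat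
    using evaluates_state[OF g evaluates_pow[OF g that]] by simp
  have gen: "g b \<in> star_generated A {g b}" for b
    using star_subalgebra_star_generated(2)[of "{g b}"] g by auto
  have "u \<in> star_generated A {g True}" "v \<in> star_generated A {g False}"
    using gen[of True] gen[of False] by (simp_all add: g_def)
  then show "\<gamma> $ 0 = 0" "Abs_fps (\<lambda>k. \<phi> ((u \<otimes> v) [^] k)) oo \<gamma> = 1 + fps_X"
    using resolvent_mult[OF \<alpha>(1) \<beta>(1) _ _ _ _ \<gamma>, of U V] \<alpha> \<beta> U V
    by (auto simp: \<Phi>f_resolvent st[OF U] st[OF V] st[OF UV])
qed

end

section \<open>Continuous functions on the circle\<close>

lemma circle_finite_measure_integrable:
  fixes f :: "complex \<Rightarrow> 'b::{banach, second_countable_topology}"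
  assumes "finite_measure \<mu>" "sets \<mu> = sets circle_borel" "continuous_on circle f"
  shows "integrable \<mu> f"
proof -
  interpret finite_measure \<mu> by fact
  have sp: "space \<mu> = circle"
    using sets_eq_imp_space_eq[OF assms(2)] by (simp add: space_restrict_space)
  have "f \<in> borel_measurable circle_borel"
    using assms(3) by (rule borel_measurable_continuous_on_restrict)
  then have m: "f \<in> borel_measurable \<mu>"
    using measurable_cong_sets[OF assms(2) refl] by blast
  have "bounded (f ` circle)"
    by (intro compact_imp_bounded compact_continuous_image assms(3)) simp
  then obtain K where "\<And>t. t \<in> circle \<Longrightarrow> norm (f t) \<le> K"
    unfolding bounded_iff by blast
  then show ?thesis
    by (intro integrable_const_bound[of _ K] m) (auto simp: sp)
qed

lemma circle_prob_space: "circle_prob \<mu> \<Longrightarrow> space \<mu> = circle"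
  using sets_eq_imp_space_eq[of \<mu> circle_borel] by (auto simp: circle_prob_def space_restrict_space)

lemma circle_prob_integrable:
  fixes f :: "complex \<Rightarrow> 'b::{banach, second_countable_topology}"
  assumes "circle_prob \<mu>" "continuous_on circle f"
  shows "integrable \<mu> f"
  using assms by (intro circle_finite_measure_integrable) (auto simp: circle_prob_def prob_space_def)

lemma circle_measurable:
  fixes f :: "complex \<Rightarrow> 'b::topological_space"
  assumes "sets \<mu> = sets circle_borel" "continuous_on circle f"
  shows "f \<in> borel_measurable \<mu>"
  using borel_measurable_continuous_on_restrict[OF assms(2)] measurable_cong_sets[OF assms(1) refl] by blast

lemma cnj_power_int_circle: "t \<in> circle \<Longrightarrow> cnj (t powi k) = t powi (- k)"
proof -
  assume "t \<in> circle"
  then have "cnj t = inverse t"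
    by (simp add: inverse_complex_def complex_norm_square[symmetric] divide_inverse complex_eq_iff Re_divide Im_divide cmod_def)
  then show ?thesis by (simp add: power_int_minus power_int_inverse)
qed

definition zmom :: "complex measure \<Rightarrow> int \<Rightarrow> complex" where
  "zmom \<mu> k = (LINT t|\<mu>. t powi k)"

section \<open>Linear algebra on finitely supported functions\<close>

definition cscale :: "complex \<Rightarrow> ('k \<Rightarrow>\<^sub>0 complex) \<Rightarrow> ('k \<Rightarrow>\<^sub>0 complex)" where
  "cscale c x = Poly_Mapping.map ((*) c) x"

lemma lookup_cscale: "Poly_Mapping.lookup (cscale c x) k = c * Poly_Mapping.lookup x k"
  by (simp add: cscale_def Poly_Mapping.map.rep_eq when_def)

lemma cscale_add: "cscale c (x + y) = cscale c x + cscale c y"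
  and cscale_add': "cscale (c + d) x = cscale c x + cscale d x"
  and cscale_scale: "cscale c (cscale d x) = cscale (c * d) x"
  and cscale_1: "cscale 1 x = x"
  and cscale_0: "cscale 0 x = 0"
  and cscale_0': "cscale c 0 = 0"
  and cscale_single: "cscale c (Poly_Mapping.single k d) = Poly_Mapping.single k (c * d)"
  by (rule poly_mapping_eqI; simp add: lookup_cscale lookup_add lookup_single when_def algebra_simps)+

definition clinear :: "(('k \<Rightarrow>\<^sub>0 complex) \<Rightarrow> ('l \<Rightarrow>\<^sub>0 complex)) \<Rightarrow> bool" where
  "clinear T \<longleftrightarrow> (\<forall>x y. T (x + y) = T x + T y) \<and> (\<forall>c x. T (cscale c x) = cscale c (T x))"

lemma clinear_eqI:
  assumes "clinear S" "clinear T" "\<And>k. S (Poly_Mapping.single k 1) = T (Poly_Mapping.single k 1)"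
  shows "S x = T x"
proof (induction x rule: poly_mapping_induct_single)
  case (single k c)
  have "Poly_Mapping.single k c = cscale c (Poly_Mapping.single k 1)" by (simp add: cscale_single)
  then show ?case using assms by (simp add: clinear_def)
qed (use assms in \<open>simp add: clinear_def\<close>)

text \<open>
  Linear extension of a map on the basis.
\<close>

definition lext :: "('k \<Rightarrow> ('l \<Rightarrow>\<^sub>0 complex)) \<Rightarrow> ('k \<Rightarrow>\<^sub>0 complex) \<Rightarrow> ('l \<Rightarrow>\<^sub>0 complex)" where
  "lext F x = (\<Sum>k\<in>Poly_Mapping.keys x. cscale (Poly_Mapping.lookup x k) (F k))"

lemma lext_add: "lext F (x + y) = lext F x + lext F y"
  unfolding lext_def by (rule setsum_keys_plus_distrib) (auto simp: cscale_0 cscale_add')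

lemma lext_single: "lext F (Poly_Mapping.single k c) = cscale c (F k)"
  by (simp add: lext_def cscale_0)

lemma lext_scale: "lext F (cscale c x) = cscale c (lext F x)"
  by (induction x rule: poly_mapping_induct_single)
    (simp_all add: lext_add cscale_add lext_single cscale_single cscale_scale)

lemma clinear_lext: "clinear (lext F)"
  by (simp add: clinear_def lext_add lext_scale)

lemma clinear_comp: "clinear S \<Longrightarrow> clinear T \<Longrightarrow> clinear (\<lambda>x. S (T x))"
  by (simp add: clinear_def)

lemma keys_scale: "Poly_Mapping.keys (cscale c x) \<subseteq> Poly_Mapping.keys x"
  by (auto simp: in_keys_iff lookup_cscale)

lemma keys_lext: "Poly_Mapping.keys (lext F x) \<subseteq> (\<Union>k\<in>Poly_Mapping.keys x. Poly_Mapping.keys (F k))"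
  unfolding lext_def by (rule order_trans[OF keys_sum]) (intro UN_mono keys_scale order_refl)

definition sform :: "('k \<Rightarrow> 'k \<Rightarrow> complex) \<Rightarrow> ('k \<Rightarrow>\<^sub>0 complex) \<Rightarrow> ('k \<Rightarrow>\<^sub>0 complex) \<Rightarrow> complex" where
  "sform K x y = (\<Sum>w\<in>Poly_Mapping.keys x. \<Sum>v\<in>Poly_Mapping.keys y.
     Poly_Mapping.lookup x w * cnj (Poly_Mapping.lookup y v) * K w v)"

lemma sform_add: "sform K (x + y) z = sform K x z + sform K y z"
  unfolding sform_def by (rule setsum_keys_plus_distrib) (auto simp: distrib_right sum.distrib)

lemma sform_flip: "sform K x y = (\<Sum>v\<in>Poly_Mapping.keys y. \<Sum>w\<in>Poly_Mapping.keys x.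
     Poly_Mapping.lookup x w * cnj (Poly_Mapping.lookup y v) * K w v)"
  unfolding sform_def by (rule sum.swap)

lemma sform_add': "sform K z (x + y) = sform K z x + sform K z y"
  unfolding sform_flip by (rule setsum_keys_plus_distrib) (auto simp: distrib_right distrib_left sum.distrib)

lemma sform_single: "sform K (Poly_Mapping.single w c) (Poly_Mapping.single v d) = c * cnj d * K w v"
  by (simp add: sform_def)

lemma sform_scale: "sform K (cscale c x) y = c * sform K x y"
proof (induction x rule: poly_mapping_induct_single)
  case (single k d)
  show ?case
    by (induction y rule: poly_mapping_induct_single)
      (simp_all add: cscale_single sform_single sform_add' distrib_left)
qed (simp add: cscale_add sform_add distrib_left)

lemma sform_scale': "sform K x (cscale c y) = cnj c * sform K x y"
proof (induction x rule: poly_mapping_induct_single)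
  case (single k d)
  show ?case
    by (induction y rule: poly_mapping_induct_single)
      (simp_all add: cscale_single cscale_add sform_single sform_add' distrib_left)
qed (simp add: cscale_add sform_add distrib_left)

lemma sform_herm:
  assumes "\<And>w v. K v w = cnj (K w v)"
  shows "sform K y x = cnj (sform K x y)"
  unfolding sform_flip[of K y x] by (simp add: sform_def assms[symmetric] mult.commute)

lemma sform_adjoint:
  assumes "clinear S" "clinear T"
    and "\<And>w v. sform K (S (Poly_Mapping.single w 1)) (Poly_Mapping.single v 1) =
      sform K (Poly_Mapping.single w 1) (T (Poly_Mapping.single v 1))"
  shows "sform K (S x) y = sform K x (T y)"
proof (induction x rule: poly_mapping_induct_single)
  case (single w c)
  have c: "Poly_Mapping.single w c = cscale c (Poly_Mapping.single w 1)" for w c by (simp add: cscale_single)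
  show ?case
  proof (induction y rule: poly_mapping_induct_single)
    case (single v d)
    show ?case unfolding c[of w c] c[of v d]
      using assms by (simp add: clinear_def sform_scale sform_scale')
  qed (use assms in \<open>simp add: clinear_def sform_add'\<close>)
qed (use assms in \<open>simp add: clinear_def sform_add\<close>)

section \<open>The algebra of adjointable pairs\<close>

text \<open>
  An operator with a formal adjoint. The form may be degenerate, and then the operator does
  not determine its adjoint; hence the pair.
\<close>

type_synonym 'k opair = "(('k \<Rightarrow>\<^sub>0 complex) \<Rightarrow> ('k \<Rightarrow>\<^sub>0 complex)) \<times> (('k \<Rightarrow>\<^sub>0 complex) \<Rightarrow> ('k \<Rightarrow>\<^sub>0 complex))"

definition adjointable :: "('k \<Rightarrow> 'k \<Rightarrow> complex) \<Rightarrow> 'k opair set" where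
  "adjointable K = {(S, T). clinear S \<and> clinear T \<and> (\<forall>x y. sform K (S x) y = sform K x (T y))}"

definition op_algebra :: "('k \<Rightarrow> 'k \<Rightarrow> complex) \<Rightarrow> ('k opair \<Rightarrow> 'b) \<Rightarrow> 'b star_algebra" where
  "op_algebra K enc =
    \<lparr> carrier = enc ` adjointable K,
      monoid.mult = (\<lambda>a b. enc (fst (inv_into UNIV enc a) \<circ> fst (inv_into UNIV enc b), snd (inv_into UNIV enc b) \<circ> snd (inv_into UNIV enc a))),
      one = enc (id, id),
      ring.zero = enc (\<lambda>x. 0, \<lambda>x. 0),
      add = (\<lambda>a b. enc (\<lambda>x. fst (inv_into UNIV enc a) x + fst (inv_into UNIV enc b) x, \<lambda>x. snd (inv_into UNIV enc a) x + snd (inv_into UNIV enc b) x)),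
      smult = (\<lambda>c a. enc (\<lambda>x. cscale c (fst (inv_into UNIV enc a) x), \<lambda>x. cscale (cnj c) (snd (inv_into UNIV enc a) x))),
      star = (\<lambda>a. enc (snd (inv_into UNIV enc a), fst (inv_into UNIV enc a))) \<rparr>"

text \<open>
  The vector state of the basis vector \<open>\<Omega>\<close>.
\<close>

definition op_state :: "('k \<Rightarrow> 'k \<Rightarrow> complex) \<Rightarrow> ('k opair \<Rightarrow> 'b) \<Rightarrow> 'k \<Rightarrow> 'b \<Rightarrow> complex" where
  "op_state K enc \<Omega> a = sform K (fst (inv_into UNIV enc a) (Poly_Mapping.single \<Omega> 1)) (Poly_Mapping.single \<Omega> 1)"

lemma star_prob_space_op_algebra:
  assumes enc: "inj enc" and herm: "\<And>w v. K v w = cnj (K w v)"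
    and pos: "\<And>x. sform K x x \<in> \<real>\<^sub>\<ge>\<^sub>0" and \<Omega>: "K \<Omega> \<Omega> = 1"
  shows "star_prob_space (op_algebra K enc) (op_state K enc \<Omega>)"
proof -
  let ?A = "op_algebra K enc"
  have dec: "inv_into UNIV enc (enc p) = p" for p using enc by simp
  have herm': "sform K y x = cnj (sform K x y)" for x y by (rule sform_herm[OF herm])
  have comp: "(S \<circ> S', T' \<circ> T) \<in> adjointable K" if "(S, T) \<in> adjointable K" "(S', T') \<in> adjointable K" for S S' T T'
    using that by (auto simp: adjointable_def clinear_def)
  have swap: "(T, S) \<in> adjointable K" if "(S, T) \<in> adjointable K" for S T
    using that unfolding adjointable_def by (auto simp: herm'[of _ "S _"]) (metis herm')
  have plus: "(\<lambda>x. S x + S' x, \<lambda>x. T x + T' x) \<in> adjointable K"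
    if "(S, T) \<in> adjointable K" "(S', T') \<in> adjointable K" for S S' T T'
    using that by (auto simp: adjointable_def clinear_def sform_add sform_add' cscale_add algebra_simps)
  have sc: "(\<lambda>x. cscale c (S x), \<lambda>x. cscale (cnj c) (T x)) \<in> adjointable K"
    if "(S, T) \<in> adjointable K" for S T c
    using that by (auto simp: adjointable_def clinear_def sform_scale sform_scale' cscale_add cscale_scale mult.commute)
  have zero: "(\<lambda>x. 0, \<lambda>x. 0) \<in> adjointable K"
    by (auto simp: adjointable_def clinear_def cscale_0' sform_def)
  have one: "(id, id) \<in> adjointable K" "(\<lambda>x. x, \<lambda>x. x) \<in> adjointable K"
    by (auto simp: adjointable_def clinear_def)
  have neg: "(\<lambda>x. - S x, \<lambda>x. - T x) \<in> adjointable K" if "(S, T) \<in> adjointable K" for S T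
  proof -
    have "cscale (-1) x = - x" for x :: "'a \<Rightarrow>\<^sub>0 complex"
      by (rule poly_mapping_eqI) (simp add: lookup_cscale)
    then show ?thesis using sc[OF that, of "-1"] by simp
  qed
  have lin: "S (x + y) = S x + S y" "S (cscale c x) = cscale c (S x)" "T (x + y) = T x + T y" "T (cscale c x) = cscale c (T x)"
    if "(S, T) \<in> adjointable K" for S T x y c
    using that by (auto simp: adjointable_def clinear_def)
  have cg: "abelian_group ?A"
  proof (rule abelian_groupI)
    fix a assume "a \<in> carrier ?A"
    then show "\<exists>b\<in>carrier ?A. b \<oplus>\<^bsub>?A\<^esub> a = \<zero>\<^bsub>?A\<^esub>"
      by (auto simp: op_algebra_def dec intro!: bexI[OF _ neg])
  qed (auto simp: op_algebra_def dec plus zero add_ac)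
  have mo: "monoid ?A"
    by (rule monoidI) (auto simp: op_algebra_def dec comp one comp_assoc)
  have ri: "ring ?A"
    by (rule ringI[OF cg mo]) (auto simp: op_algebra_def dec comp_def lin)
  have cr: "cring (ring_of_type_algebra :: complex ring)" by (rule cring_from_type_algebra)
  have mod: "module (ring_of_type_algebra :: complex ring) ?A"
    by (rule moduleI[OF cr cg])
      (auto simp: op_algebra_def ring_of_type_algebra_def dec sc cscale_add cscale_add' cscale_scale cscale_1)
  show ?thesis
  proof (intro star_prob_space.intro mod ri, unfold_locales)
    fix a b c assume a: "a \<in> carrier ?A" 
    show "op_state K enc \<Omega> (c \<odot>\<^bsub>?A\<^esub> a) = c * op_state K enc \<Omega> a"
      using a by (auto simp: op_algebra_def op_state_def dec sform_scale)
    show "star ?A a \<in> carrier ?A" using a swap by (auto simp: op_algebra_def dec)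
    show "star ?A (star ?A a) = a" using a by (auto simp: op_algebra_def dec)
    show "star ?A (c \<odot>\<^bsub>?A\<^esub> a) = cnj c \<odot>\<^bsub>?A\<^esub> star ?A a" using a by (auto simp: op_algebra_def dec)
    show "op_state K enc \<Omega> (star ?A a \<otimes>\<^bsub>?A\<^esub> a) \<in> \<real>\<^sub>\<ge>\<^sub>0"
    proof -
      obtain S T where ST: "a = enc (S, T)" "(S, T) \<in> adjointable K" using a by (auto simp: op_algebra_def)
      have "sform K (T (S x)) y = sform K (S x) (S y)" for x y
        using swap[OF ST(2)] by (auto simp: adjointable_def)
      then show ?thesis using pos by (simp add: ST(1) op_algebra_def op_state_def dec)
    qed
    assume b: "b \<in> carrier ?A"
    show "(c \<odot>\<^bsub>?A\<^esub> a) \<otimes>\<^bsub>?A\<^esub> b = c \<odot>\<^bsub>?A\<^esub> (a \<otimes>\<^bsub>?A\<^esub> b)"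
      using a b by (auto simp: op_algebra_def dec comp_def lin)
    show "a \<otimes>\<^bsub>?A\<^esub> (c \<odot>\<^bsub>?A\<^esub> b) = c \<odot>\<^bsub>?A\<^esub> (a \<otimes>\<^bsub>?A\<^esub> b)"
      using a b by (auto simp: op_algebra_def dec comp_def lin)
    show "star ?A (a \<oplus>\<^bsub>?A\<^esub> b) = star ?A a \<oplus>\<^bsub>?A\<^esub> star ?A b"
      using a b by (auto simp: op_algebra_def dec)
    show "star ?A (a \<otimes>\<^bsub>?A\<^esub> b) = star ?A b \<otimes>\<^bsub>?A\<^esub> star ?A a"
      using a b by (auto simp: op_algebra_def dec)
    show "op_state K enc \<Omega> (a \<oplus>\<^bsub>?A\<^esub> b) = op_state K enc \<Omega> a + op_state K enc \<Omega> b"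
      using a b by (auto simp: op_algebra_def op_state_def dec sform_add)
  next
    show "op_state K enc \<Omega> \<one>\<^bsub>?A\<^esub> = 1"
      by (simp add: op_algebra_def op_state_def dec sform_single \<Omega>)
  qed
qed

text \<open>
  Over a countable basis vectors are complex sequences; the values of the operator and of its
  adjoint are interleaved at the even and odd places of one sequence.
\<close>

lemma ex_encoding: "\<exists>enc :: ('k::countable) opair \<Rightarrow> ((nat \<Rightarrow> complex) \<Rightarrow> (nat \<Rightarrow> complex)). inj enc"
proof -
  define S where "S x = (\<lambda>n. Poly_Mapping.lookup x (from_nat n :: 'k))" for x :: "'k \<Rightarrow>\<^sub>0 complex"
  have "inj S"
  proof (rule injI)
    fix x y assume "S x = S y"
    then have "Poly_Mapping.lookup x (from_nat n) = Poly_Mapping.lookup y (from_nat n)" for n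
      by (simp add: S_def fun_eq_iff)
    then show "x = y" by (intro poly_mapping_eqI) (metis from_nat_to_nat)
  qed
  then have D: "inv_into UNIV S (S x) = x" for x by simp
  define enc where "enc p = (\<lambda>s n. if even n then S (fst p (inv_into UNIV S s)) (n div 2) else S (snd p (inv_into UNIV S s)) (n div 2))"
    for p :: "'k opair"
  have "inj enc"
  proof (rule injI)
    fix p q assume pq: "enc p = enc q"
    have 1: "S (fst p x) n = S (fst q x) n" for x n
      using fun_cong[OF fun_cong[OF pq, of "S x"], of "2 * n"] by (simp add: enc_def D)
    have 2: "S (snd p x) n = S (snd q x) n" for x n
      using fun_cong[OF fun_cong[OF pq, of "S x"], of "Suc (2 * n)"] by (simp add: enc_def D)
    have "fst p x = fst q x" "snd p x = snd q x" for x
      using \<open>inj S\<close> 1[of x] 2[of x] by (auto simp: inj_def fun_eq_iff)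
    then show "p = q" by (simp add: prod_eq_iff fun_eq_iff)
  qed
  then show ?thesis by blast
qed

section \<open>The free product of two circle representations\<close>

type_synonym letter = "bool \<times> int"
type_synonym laurent = "int \<Rightarrow>\<^sub>0 complex"

text \<open>
  The mean of a Laurent polynomial whose powers have the means \<open>m\<close>. For \<open>m = 1\<close> it is the
  evaluation at the point \<open>1\<close>, a character.
\<close>

definition zmean :: "(int \<Rightarrow> complex) \<Rightarrow> laurent \<Rightarrow> complex" where
  "zmean m f = (\<Sum>k\<in>Poly_Mapping.keys f. Poly_Mapping.lookup f k * m k)"

lemma zmean_add: "zmean m (f + g) = zmean m f + zmean m g"
  unfolding zmean_def by (rule setsum_keys_plus_distrib) (auto simp: distrib_right)

lemma zmean_single: "zmean m (Poly_Mapping.single k c) = c * m k"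
  by (simp add: zmean_def)

lemma zmean_scale: "zmean m (cscale c f) = c * zmean m f"
  by (induction f rule: poly_mapping_induct_single)
    (simp_all add: zmean_add cscale_add cscale_single zmean_single distrib_left)

lemma zmean_one_mult: "zmean (\<lambda>_. 1) (f * g) = zmean (\<lambda>_. 1) f * zmean (\<lambda>_. 1) g"
proof (induction f rule: poly_mapping_induct_single)
  case (single k c)
  show ?case
    by (induction g rule: poly_mapping_induct_single)
      (simp_all add: mult_single zmean_single distrib_left zmean_add)
qed (simp add: distrib_right zmean_add)

definition lstar :: "laurent \<Rightarrow> laurent" where
  "lstar f = (\<Sum>k\<in>Poly_Mapping.keys f. Poly_Mapping.single (- k) (cnj (Poly_Mapping.lookup f k)))"

lemma lstar_add: "lstar (f + g) = lstar f + lstar g"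
  unfolding lstar_def by (rule setsum_keys_plus_distrib) (auto simp: single_add)

lemma lstar_single: "lstar (Poly_Mapping.single k c) = Poly_Mapping.single (- k) (cnj c)"
  by (simp add: lstar_def)

lemma lstar_lstar: "lstar (lstar f) = f"
  by (induction f rule: poly_mapping_induct_single) (simp_all add: lstar_add lstar_single)

lemma lstar_mult: "lstar (f * g) = lstar f * lstar g"
proof (induction f rule: poly_mapping_induct_single)
  case (single k c)
  show ?case
    by (induction g rule: poly_mapping_induct_single)
      (simp_all add: mult_single lstar_single distrib_left lstar_add)
qed (simp add: distrib_right lstar_add)

lemma lstar_scale: "lstar (cscale c f) = cscale (cnj c) (lstar f)"
  by (induction f rule: poly_mapping_induct_single)
    (simp_all add: lstar_add cscale_add cscale_single lstar_single)

lemma cscale_mult: "cscale c (f * g) = cscale c f * g" "cscale c (f * g) = f * cscale c (g :: laurent)"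
proof -
  show "cscale c (f * g) = cscale c f * g"
    unfolding cscale_def mult_map_scale_conv_mult by (simp add: mult.assoc)
  then show "cscale c (f * g) = f * cscale c g"
    unfolding cscale_def mult_map_scale_conv_mult by (simp add: mult_ac)
qed

text \<open>
  The Gram matrix of words in the free product of two spaces \<open>L\<^sup>2\<close> of measures on the circle.
  The letter \<open>(i, k)\<close> stands for the centered function \<open>t\<^sup>k - m\<^sub>k\<close> in the space of the measure \<open>i\<close>, and
  a word is the tensor product of its letters.
\<close>

fun fock_kernel :: "(bool \<Rightarrow> int \<Rightarrow> complex) \<Rightarrow> letter list \<Rightarrow> letter list \<Rightarrow> complex" where
  "fock_kernel m [] [] = 1"
| "fock_kernel m ((i, k) # w) ((j, l) # v) =
     (if i = j then (m i (k - l) - m i k * cnj (m i l)) * fock_kernel m w v else 0)"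
| "fock_kernel m _ _ = 0"

text \<open>
  A letter with exponent \<open>0\<close> would stand for the zero vector.
\<close>

definition reduced :: "letter list \<Rightarrow> bool" where
  "reduced w \<longleftrightarrow> successively (\<lambda>p q. fst p \<noteq> fst q) w \<and> (\<forall>p\<in>set w. snd p \<noteq> 0)"

text \<open>
  All words serve as a basis; those that are not reduced become null vectors.
\<close>

definition reduced_kernel :: "(bool \<Rightarrow> int \<Rightarrow> complex) \<Rightarrow> letter list \<Rightarrow> letter list \<Rightarrow> complex" where
  "reduced_kernel m w v = (if reduced w \<and> reduced v then fock_kernel m w v else 0)"

definition starts :: "bool \<Rightarrow> letter list \<Rightarrow> bool" where
  "starts i w \<longleftrightarrow> w \<noteq> [] \<and> fst (hd w) = i"

lemma reduced_Cons: "reduced ((i, k) # w) \<longleftrightarrow> k \<noteq> 0 \<and> reduced w \<and> \<not> starts i w"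
  by (cases w) (auto simp: reduced_def starts_def)

lemma reduced_Nil: "reduced []"
  by (simp add: reduced_def)

text \<open>
  The vector \<open>t\<^sup>k \<otimes> w\<close>, split as \<open>(t\<^sup>k - m\<^sub>k) \<otimes> w + m\<^sub>k w\<close>.
\<close>

definition shifted :: "(bool \<Rightarrow> int \<Rightarrow> complex) \<Rightarrow> bool \<Rightarrow> letter list \<Rightarrow> int \<Rightarrow> (letter list \<Rightarrow>\<^sub>0 complex)" where
  "shifted m i w k = (if k = 0 then Poly_Mapping.single w 1
     else Poly_Mapping.single ((i, k) # w) 1 + Poly_Mapping.single w (m i k))"

text \<open>
  The copy \<open>f \<mapsto> f \<otimes> w\<close> of the Laurent polynomials over a word \<open>w\<close> that does not start in the
  factor \<open>i\<close>. The unitary of the factor \<open>i\<close> acts on each of these copies by multiplication.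
\<close>

definition fiber :: "(bool \<Rightarrow> int \<Rightarrow> complex) \<Rightarrow> bool \<Rightarrow> letter list \<Rightarrow> laurent \<Rightarrow> (letter list \<Rightarrow>\<^sub>0 complex)" where
  "fiber m i w = lext (shifted m i w)"

text \<open>
  A reduced word that starts in the factor \<open>i\<close> lies in the fiber over its tail, every other reduced
  word is the constant function \<open>1\<close> in its own fiber. On the null vectors Laurent polynomials
  act by the character at \<open>1\<close>, which keeps the action multiplicative there.
\<close>

definition rep_basis :: "(bool \<Rightarrow> int \<Rightarrow> complex) \<Rightarrow> bool \<Rightarrow> laurent \<Rightarrow> letter list \<Rightarrow> (letter list \<Rightarrow>\<^sub>0 complex)" where
  "rep_basis m i f x = (if \<not> reduced x then cscale (zmean (\<lambda>_. 1) f) (Poly_Mapping.single x 1)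
     else if starts i x then fiber m i (tl x) (f * (Poly_Mapping.single (snd (hd x)) 1 - Poly_Mapping.single 0 (m i (snd (hd x)))))
     else fiber m i x f)"

definition rep :: "(bool \<Rightarrow> int \<Rightarrow> complex) \<Rightarrow> bool \<Rightarrow> laurent \<Rightarrow> (letter list \<Rightarrow>\<^sub>0 complex) \<Rightarrow> (letter list \<Rightarrow>\<^sub>0 complex)" where
  "rep m i f = lext (rep_basis m i f)"

lemma fiber_add: "fiber m i w (f + g) = fiber m i w f + fiber m i w g"
  by (simp add: fiber_def lext_add)

lemma fiber_scale: "fiber m i w (cscale c f) = cscale c (fiber m i w f)"
  by (simp add: fiber_def lext_scale)

lemma fiber_single: "fiber m i w (Poly_Mapping.single k c) = cscale c (shifted m i w k)"
  by (simp add: fiber_def lext_single)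

lemma clinear_rep: "clinear (rep m i f)"
  by (simp add: rep_def clinear_lext)

lemma rep_add: "rep m i f (x + y) = rep m i f x + rep m i f y"
  and rep_scale: "rep m i f (cscale c x) = cscale c (rep m i f x)"
  using clinear_rep[of m i f] by (auto simp: clinear_def)

lemma rep_single: "rep m i f (Poly_Mapping.single x 1) = rep_basis m i f x"
  by (simp add: rep_def lext_single cscale_1)

lemma single_scale: "Poly_Mapping.single k c = cscale c (Poly_Mapping.single k 1)"
  by (simp add: cscale_single)

text \<open>
  On a fiber the action is multiplication of functions; the two basis words that make up
  \<open>shifted\<close> fall under different cases of \<open>rep_basis\<close>, and their contributions add up to this.
\<close>

lemma rep_shifted:
  assumes "reduced w" "\<not> starts i w"
  shows "rep m i f (shifted m i w k) = fiber m i w (f * Poly_Mapping.single k 1)"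
proof (cases "k = 0")
  case True
  then show ?thesis using assms by (simp add: shifted_def rep_single rep_basis_def)
next
  case False
  have "reduced ((i, k) # w)" "starts i ((i, k) # w)"
    using assms False by (auto simp: reduced_Cons starts_def)
  then have "rep m i f (shifted m i w k) =
      fiber m i w (f * (Poly_Mapping.single k 1 - Poly_Mapping.single 0 (m i k))) + cscale (m i k) (fiber m i w f)"
    using False assms unfolding shifted_def single_scale[of w "m i k"]
    by (simp add: rep_add rep_scale rep_single rep_basis_def)
  also have "cscale (m i k) (fiber m i w f) = fiber m i w (f * Poly_Mapping.single 0 (m i k))"
    unfolding fiber_scale[symmetric] single_scale[of 0 "m i k"] cscale_mult(2)[symmetric] by simp
  finally show ?thesis
    unfolding fiber_add[symmetric] by (simp add: distrib_left[symmetric])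
qed

lemma rep_fiber:
  assumes "reduced w" "\<not> starts i w"
  shows "rep m i f (fiber m i w g) = fiber m i w (f * g)"
proof (induction g rule: poly_mapping_induct_single)
  case (single k c)
  show ?case
    unfolding single_scale[of k c] fiber_scale rep_scale cscale_mult(2)[symmetric]
    by (simp add: fiber_single cscale_1 rep_shifted[OF assms])
qed (simp add: distrib_left fiber_add rep_add)

lemma reduced_cases:
  assumes "reduced x"
  obtains w g where "reduced w" "\<not> starts i w" "Poly_Mapping.single x 1 = fiber m i w g"
proof (cases "starts i x")
  case True
  then obtain k w where x: "x = (i, k) # w"
    by (cases x) (auto simp: starts_def)
  then have w: "reduced w" "\<not> starts i w" "k \<noteq> 0" using assms by (auto simp: reduced_Cons)
  have "Poly_Mapping.single x 1 = fiber m i w (Poly_Mapping.single k 1 + Poly_Mapping.single 0 (- m i k))"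
    using w unfolding fiber_add fiber_single shifted_def x by (simp add: cscale_1 cscale_single single_uminus)
  then show ?thesis using that w by blast
next
  case False
  have "Poly_Mapping.single x 1 = fiber m i x (Poly_Mapping.single 0 1)"
    by (simp add: fiber_single shifted_def cscale_1 del: single_one)
  then show ?thesis using that False assms by blast
qed

lemma rep_rep: "rep m i f (rep m i g x) = rep m i (f * g) x"
proof (rule clinear_eqI[OF clinear_comp[OF clinear_rep clinear_rep] clinear_rep])
  fix x
  show "rep m i f (rep m i g (Poly_Mapping.single x 1)) = rep m i (f * g) (Poly_Mapping.single x 1)"
  proof (cases "reduced x")
    case True
    then show ?thesis
      by (elim reduced_cases[of x i m]) (simp add: rep_fiber mult.assoc)
  next
    case False
    then show ?thesis by (simp add: rep_single rep_basis_def rep_scale cscale_scale zmean_one_mult mult.commute)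
  qed
qed

lemma rep_1: "rep m i 1 x = x"
proof (rule clinear_eqI[OF clinear_rep])
  show "clinear (\<lambda>x. x)" by (simp add: clinear_def)
  fix x
  show "rep m i 1 (Poly_Mapping.single x 1) = Poly_Mapping.single x 1"
  proof (cases "reduced x")
    case True
    then show ?thesis
      by (elim reduced_cases[of x i m]) (simp add: rep_fiber)
  next
    case False
    have "zmean (\<lambda>_. 1) 1 = 1" using zmean_single[of "\<lambda>_. 1" 0 1] by simp
    then show ?thesis using False by (simp add: rep_single rep_basis_def cscale_1)
  qed
qed

lemma rep_basis_add: "rep_basis m i (f + g) x = rep_basis m i f x + rep_basis m i g x"
  by (simp add: rep_basis_def zmean_add cscale_add' distrib_right fiber_add)

lemma rep_basis_scale: "rep_basis m i (cscale c f) x = cscale c (rep_basis m i f x)"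
  by (simp add: rep_basis_def zmean_scale cscale_scale cscale_mult(1)[symmetric] fiber_scale)

lemma rep_plus: "rep m i (f + g) x = rep m i f x + rep m i g x"
  by (rule clinear_eqI) (auto simp: clinear_def rep_add rep_scale cscale_add rep_single rep_basis_add add_ac)

lemma rep_cscale: "rep m i (cscale c f) x = cscale c (rep m i f x)"
  by (rule clinear_eqI) (auto simp: clinear_def rep_add rep_scale cscale_add cscale_scale rep_single rep_basis_scale mult.commute)

locale circle_pair =
  fixes M :: "bool \<Rightarrow> complex measure"
  assumes circle_prob: "circle_prob (M b)"
begin

definition mm :: "bool \<Rightarrow> int \<Rightarrow> complex" where "mm b k = zmom (M b) k"

abbreviation "Kf \<equiv> fock_kernel mm"
abbreviation "Kr \<equiv> reduced_kernel mm"
abbreviation "Vac \<equiv> Poly_Mapping.single ([] :: letter list) (1 :: complex)"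

lemma integrable_M: "continuous_on circle f \<Longrightarrow> integrable (M b) f"
  for f :: "complex \<Rightarrow> complex"
  by (rule circle_prob_integrable[OF circle_prob])

lemma mm_0: "mm b 0 = 1"
proof -
  interpret prob_space "M b" using circle_prob by (simp add: circle_prob_def)
  show ?thesis by (simp add: mm_def zmom_def prob_space)
qed

lemma mm_minus: "mm b (- k) = cnj (mm b k)"
proof -
  have "cnj (mm b k) = (LINT t|M b. cnj (t powi k))"
    unfolding mm_def zmom_def by (simp del: complex_cnj_power_int)
  also have "\<dots> = mm b (- k)"
    unfolding mm_def zmom_def
    by (rule Bochner_Integration.integral_cong) (simp_all add: circle_prob_space[OF circle_prob] cnj_power_int_circle del: complex_cnj_power_int)
  finally show ?thesis by simp
qed

lemma Kf_herm: "Kf v w = cnj (Kf w v)"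
  by (induction mm w v rule: fock_kernel.induct) (auto simp: mm_minus[symmetric])

lemma Kr_herm: "Kr v w = cnj (Kr w v)"
  using Kf_herm[of v w] by (simp add: reduced_kernel_def)

lemma integral_centered_powers:
  "(LINT t|M i. (t powi k - mm i k) * cnj (t powi l - mm i l)) = mm i (k - l) - mm i k * cnj (mm i l)"
proof -
  interpret prob_space "M i" using circle_prob by (simp add: circle_prob_def)
  have "(LINT t|M i. (t powi k - mm i k) * cnj (t powi l - mm i l)) =
     (LINT t|M i. t powi (k - l) - cnj (mm i l) * t powi k - mm i k * t powi (- l) + mm i k * cnj (mm i l))"
  proof (rule Bochner_Integration.integral_cong[OF refl])
    fix t assume "t \<in> space (M i)"
    then have t: "t \<in> circle" by (simp add: circle_prob_space[OF circle_prob])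
    then have "t \<noteq> 0" by auto
    then have "t powi (k - l) = t powi k * t powi (- l)"
      by (simp add: power_int_diff power_int_minus divide_inverse)
    then show "(t powi k - mm i k) * cnj (t powi l - mm i l) =
       t powi (k - l) - cnj (mm i l) * t powi k - mm i k * t powi (- l) + mm i k * cnj (mm i l)"
      using cnj_power_int_circle[OF t, of l] by (simp add: algebra_simps)
  qed
  also have "\<dots> = mm i (k - l) - cnj (mm i l) * mm i k - mm i k * mm i (- l) + mm i k * cnj (mm i l)"
    unfolding mm_def zmom_def
    by (subst Bochner_Integration.integral_add Bochner_Integration.integral_diff;
        (intro integrable_M continuous_intros)?; (auto simp: prob_space)?)+
  also have "\<dots> = mm i (k - l) - mm i k * cnj (mm i l)" by (simp add: mm_minus)
  finally show ?thesis .
qed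

lemma nonneg_complex_sum: "(\<And>i. i \<in> A \<Longrightarrow> f i \<in> \<real>\<^sub>\<ge>\<^sub>0) \<Longrightarrow> sum f A \<in> (\<real>\<^sub>\<ge>\<^sub>0 :: complex set)"
  by (induction A rule: infinite_finite_induct) (auto intro: nonneg_Reals_add_I)

lemma nonneg_complex_integral:
  assumes "continuous_on circle f" "\<And>t. t \<in> circle \<Longrightarrow> f t \<in> \<real>\<^sub>\<ge>\<^sub>0"
  shows "(LINT t|M i. f t) \<in> (\<real>\<^sub>\<ge>\<^sub>0 :: complex set)"
proof -
  have i: "integrable (M i) f" by (rule integrable_M[OF assms(1)])
  have f: "0 \<le> Re (f t)" "Im (f t) = 0" if "t \<in> space (M i)" for t
    using assms(2)[of t] that by (auto simp: circle_prob_space[OF circle_prob] complex_nonneg_Reals_iff)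
  have "0 \<le> (LINT t|M i. Re (f t))"
    by (rule Bochner_Integration.integral_nonneg) (use f in auto)
  moreover have "(LINT t|M i. Im (f t)) = (LINT t|M i. 0)"
    by (rule Bochner_Integration.integral_cong) (use f in auto)
  ultimately show ?thesis
    using i by (simp add: complex_nonneg_Reals_iff)
qed

text \<open>
  By induction on the length of the words: the Gram matrix of the first letters is an
  integral of matrices of rank one (\<open>integral_centered_powers\<close>), so the form on words of length at
  most \<open>N + 1\<close> is the vacuum part plus an integral of forms on their tails.
\<close>

lemma fock_kernel_pos:
  fixes c :: "letter list \<Rightarrow> complex"
  assumes "finite S" "\<And>w. w \<in> S \<Longrightarrow> length w \<le> N"
  shows "(\<Sum>w\<in>S. \<Sum>v\<in>S. c w * cnj (c v) * Kf w v) \<in> \<real>\<^sub>\<ge>\<^sub>0"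
  using assms
proof (induction N arbitrary: S c)
  case 0
  then have "S \<subseteq> {[]}" by auto
  then consider "S = {}" | "S = {[]}" by blast
  then show ?case
  proof cases
    case 2
    have "c [] * cnj (c []) \<in> \<real>\<^sub>\<ge>\<^sub>0"
      by (simp add: complex_nonneg_Reals_iff)
    then show ?thesis using 2 by simp
  qed simp
next
  case (Suc N)
  define c' where "c' w = (if w \<in> S then c w else 0)" for w
  define cons :: "bool \<times> int \<times> letter list \<Rightarrow> letter list" where "cons = (\<lambda>(i, k, w). (i, k) # w)"
  define W where "W = tl ` S"
  define Z where "Z = (snd \<circ> hd) ` S"
  have fin: "finite W" "finite Z" using Suc.prems(1) by (auto simp: W_def Z_def)
  have len: "length w \<le> N" if "w \<in> W" for w
    using Suc.prems(2) that by (fastforce simp: W_def)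
  define T where "T = (UNIV :: bool set) \<times> Z \<times> W"
  define S' where "S' = insert [] (cons ` T)"
  have finT: "finite T" using fin by (simp add: T_def)
  then have fin': "finite S'" by (simp add: S'_def)
  have sub: "S \<subseteq> S'"
  proof
    fix w assume w: "w \<in> S"
    show "w \<in> S'"
    proof (cases w)
      case (Cons p v)
      have "cons (fst p, snd (hd w), tl w) \<in> cons ` T"
        using w by (intro imageI) (auto simp: T_def W_def Z_def)
      then show ?thesis by (simp add: cons_def S'_def Cons)
    qed (simp add: S'_def)
  qed
  have inj: "inj_on cons T" by (auto simp: inj_on_def cons_def)
  have [simp]: "cons p \<noteq> []" "Kf [] (cons p) = 0" "Kf (cons p) [] = 0" for p
    by (cases p; simp add: cons_def)+
  have "(\<Sum>w\<in>S. \<Sum>v\<in>S. c w * cnj (c v) * Kf w v) = (\<Sum>w\<in>S'. \<Sum>v\<in>S'. c' w * cnj (c' v) * Kf w v)"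
  proof -
    have "(\<Sum>w\<in>S. \<Sum>v\<in>S. c w * cnj (c v) * Kf w v) = (\<Sum>w\<in>S. \<Sum>v\<in>S. c' w * cnj (c' v) * Kf w v)"
      by (intro sum.cong) (auto simp: c'_def)
    also have "\<dots> = (\<Sum>w\<in>S. \<Sum>v\<in>S'. c' w * cnj (c' v) * Kf w v)"
      by (intro sum.cong refl sum.mono_neutral_left fin' sub) (auto simp: c'_def)
    also have "\<dots> = (\<Sum>w\<in>S'. \<Sum>v\<in>S'. c' w * cnj (c' v) * Kf w v)"
      by (intro sum.mono_neutral_left fin' sub) (auto simp: c'_def)
    finally show ?thesis .
  qed
  also have "\<dots> = c' [] * cnj (c' []) + (\<Sum>p\<in>T. \<Sum>q\<in>T. c' (cons p) * cnj (c' (cons q)) * Kf (cons p) (cons q))"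
  proof -
    have ni: "[] \<notin> cons ` T" by (auto dest: sym)
    show ?thesis
      unfolding S'_def by (simp add: ni finT sum.reindex[OF inj] comp_def)
  qed
  also have "(\<Sum>p\<in>T. \<Sum>q\<in>T. c' (cons p) * cnj (c' (cons q)) * Kf (cons p) (cons q)) =
     (\<Sum>i\<in>UNIV. \<Sum>p\<in>Z \<times> W. \<Sum>j\<in>UNIV. \<Sum>q\<in>Z \<times> W.
        c' (cons (i, p)) * cnj (c' (cons (j, q))) * Kf (cons (i, p)) (cons (j, q)))"
    unfolding T_def by (simp add: sum.cartesian_product')
  also have "\<dots> = (\<Sum>i\<in>UNIV. LINT t|M i. (\<Sum>w\<in>W. \<Sum>v\<in>W.
      (\<Sum>k\<in>Z. c' ((i, k) # w) * (t powi k - mm i k)) *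
      cnj (\<Sum>k\<in>Z. c' ((i, k) # v) * (t powi k - mm i k)) * Kf w v))"
    (is "_ = (\<Sum>i\<in>UNIV. LINT t|M i. ?I i t)")
  proof (rule sum.cong[OF refl])
    fix i :: bool
    let ?g = "\<lambda>p q. c' (cons (i, p)) * cnj (c' (cons (i, q))) * Kf (snd p) (snd q)"
    have "(\<Sum>p\<in>Z \<times> W. \<Sum>j\<in>UNIV. \<Sum>q\<in>Z \<times> W.
        c' (cons (i, p)) * cnj (c' (cons (j, q))) * Kf (cons (i, p)) (cons (j, q))) =
      (\<Sum>p\<in>Z \<times> W. \<Sum>q\<in>Z \<times> W. ?g p q * (mm i (fst p - fst q) - mm i (fst p) * cnj (mm i (fst q))))"
      (is "?L = _")
    proof (rule sum.cong[OF refl])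
      fix p
      have z: "Kf (cons (i, p)) (cons (j, q)) = 0" if "j \<noteq> i" for j q
        using that by (cases p; cases q; auto simp: cons_def)
      have "(\<Sum>j\<in>UNIV. \<Sum>q\<in>Z \<times> W. c' (cons (i, p)) * cnj (c' (cons (j, q))) * Kf (cons (i, p)) (cons (j, q)))
        = (\<Sum>j\<in>{i}. \<Sum>q\<in>Z \<times> W. c' (cons (i, p)) * cnj (c' (cons (j, q))) * Kf (cons (i, p)) (cons (j, q)))"
        by (rule sum.mono_neutral_right) (auto simp: z)
      also have "\<dots> = (\<Sum>q\<in>Z \<times> W. ?g p q * (mm i (fst p - fst q) - mm i (fst p) * cnj (mm i (fst q))))"
        by (auto simp: cons_def mult_ac split: prod.splits intro!: sum.cong)
      finally show "(\<Sum>j\<in>UNIV. \<Sum>q\<in>Z \<times> W. c' (cons (i, p)) * cnj (c' (cons (j, q))) * Kf (cons (i, p)) (cons (j, q)))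
        = (\<Sum>q\<in>Z \<times> W. ?g p q * (mm i (fst p - fst q) - mm i (fst p) * cnj (mm i (fst q))))" .
    qed
    also have "\<dots> = (LINT t|M i. (\<Sum>p\<in>Z \<times> W. \<Sum>q\<in>Z \<times> W. ?g p q * ((t powi fst p - mm i (fst p)) * cnj (t powi fst q - mm i (fst q)))))"
    proof -
      have int: "integrable (M i) (\<lambda>t. ?g p q * ((t powi fst p - mm i (fst p)) * cnj (t powi fst q - mm i (fst q))))" for p q
        by (intro integrable_M continuous_intros) auto
      show ?thesis
        by (subst Bochner_Integration.integral_sum, intro Bochner_Integration.integrable_sum int,
            rule sum.cong[OF refl], subst Bochner_Integration.integral_sum, intro int)
          (simp only: Bochner_Integration.integral_mult_right_zero integral_centered_powers)
    qed
    also have "\<dots> = (LINT t|M i. ?I i t)"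
    proof (rule Bochner_Integration.integral_cong[OF refl])
      fix t
      let ?e = "\<lambda>k. t powi k - mm i k"
      let ?c = "\<lambda>k w. c' ((i, k) # w)"
      have "(\<Sum>p\<in>Z \<times> W. \<Sum>q\<in>Z \<times> W. ?g p q * (?e (fst p) * cnj (?e (fst q)))) =
         (\<Sum>k\<in>Z. \<Sum>w\<in>W. \<Sum>l\<in>Z. \<Sum>v\<in>W. ?c k w * ?e k * cnj (?c l v * ?e l) * Kf w v)"
        by (simp add: sum.cartesian_product' cons_def mult_ac)
      also have "\<dots> = (\<Sum>w\<in>W. \<Sum>k\<in>Z. \<Sum>v\<in>W. \<Sum>l\<in>Z. ?c k w * ?e k * cnj (?c l v * ?e l) * Kf w v)"
        by (subst sum.swap) (intro sum.cong refl sum.swap)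
      also have "\<dots> = (\<Sum>w\<in>W. \<Sum>v\<in>W. \<Sum>k\<in>Z. \<Sum>l\<in>Z. ?c k w * ?e k * cnj (?c l v * ?e l) * Kf w v)"
        by (intro sum.cong refl sum.swap)
      also have "\<dots> = (\<Sum>w\<in>W. \<Sum>v\<in>W. \<Sum>l\<in>Z. \<Sum>k\<in>Z. ?c k w * ?e k * cnj (?c l v * ?e l) * Kf w v)"
        by (intro sum.cong refl sum.swap)
      also have "\<dots> = ?I i t"
        by (simp only: cnj_sum sum_distrib_left sum_distrib_right)
      finally show "(\<Sum>p\<in>Z \<times> W. \<Sum>q\<in>Z \<times> W. ?g p q * (?e (fst p) * cnj (?e (fst q)))) = ?I i t" .
    qed
    finally show "?L = (LINT t|M i. ?I i t)" .
  qed
  also have "c' [] * cnj (c' []) + (\<Sum>i\<in>UNIV. LINT t|M i. ?I i t) \<in> \<real>\<^sub>\<ge>\<^sub>0"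
  proof (rule nonneg_Reals_add_I, goal_cases)
    case 1
    show "c' [] * cnj (c' []) \<in> \<real>\<^sub>\<ge>\<^sub>0" by (simp add: complex_nonneg_Reals_iff)
  next
    case 2
    have c: "continuous_on circle (\<lambda>t. ?I i t)" for i :: bool
      by (intro continuous_intros) auto
    have p: "?I i t \<in> \<real>\<^sub>\<ge>\<^sub>0" for i t by (rule Suc.IH[OF fin(1) len])
    show ?case by (rule nonneg_complex_sum, rule nonneg_complex_integral, rule c, rule p)
  qed
  finally show ?case .
qed

lemma sform_Kr_pos: "sform Kr x x \<in> \<real>\<^sub>\<ge>\<^sub>0"
proof -
  define S where "S = Poly_Mapping.keys x"
  define R where "R = {w \<in> S. reduced w}"
  have fin: "finite S" "finite R" by (simp_all add: S_def R_def)
  have "sform Kr x x = (\<Sum>w\<in>S. \<Sum>v\<in>S. Poly_Mapping.lookup x w * cnj (Poly_Mapping.lookup x v) * Kr w v)"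
    by (simp add: sform_def S_def)
  also have "\<dots> = (\<Sum>w\<in>R. \<Sum>v\<in>S. Poly_Mapping.lookup x w * cnj (Poly_Mapping.lookup x v) * Kr w v)"
    by (rule sum.mono_neutral_right) (auto simp: fin R_def reduced_kernel_def)
  also have "\<dots> = (\<Sum>w\<in>R. \<Sum>v\<in>R. Poly_Mapping.lookup x w * cnj (Poly_Mapping.lookup x v) * Kr w v)"
    by (intro sum.cong refl sum.mono_neutral_right) (auto simp: fin R_def reduced_kernel_def)
  also have "\<dots> = (\<Sum>w\<in>R. \<Sum>v\<in>R. Poly_Mapping.lookup x w * cnj (Poly_Mapping.lookup x v) * Kf w v)"
    by (intro sum.cong refl) (auto simp: R_def reduced_kernel_def)
  also have "\<dots> \<in> \<real>\<^sub>\<ge>\<^sub>0"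
    by (rule fock_kernel_pos[OF fin(2), of "Max (length ` R)"]) (simp add: fin)
  finally show ?thesis .
qed

lemma Kr_not_reduced: "\<not> reduced w \<Longrightarrow> sform Kr (Poly_Mapping.single w c) y = 0"
  by (auto simp: sform_def reduced_kernel_def)

lemma Kr_not_reduced': "\<not> reduced w \<Longrightarrow> sform Kr y (Poly_Mapping.single w c) = 0"
  by (auto simp: sform_def reduced_kernel_def)

lemma sform_shifted:
  assumes w: "reduced w" "\<not> starts i w" and v: "reduced v" "\<not> starts i v"
  shows "sform Kr (shifted mm i w k) (shifted mm i v l) = mm i (k - l) * Kr w v"
proof -
  have 1: "Kr ((i, k) # w) v = 0" "Kr w ((i, l) # v) = 0" for k l
    using w v by (cases v; cases w; auto simp: reduced_kernel_def starts_def split: prod.splits)+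
  have 2: "Kr ((i, k) # w) ((i, l) # v) = (mm i (k - l) - mm i k * cnj (mm i l)) * Kr w v" if "k \<noteq> 0" "l \<noteq> 0" for k l
    using w v that by (simp add: reduced_kernel_def reduced_Cons)
  show ?thesis
    by (auto simp: shifted_def sform_add sform_add' sform_single 1 2 algebra_simps mm_0 mm_minus)
qed

lemma sform_fiber:
  assumes w: "reduced w" "\<not> starts i w" and v: "reduced v" "\<not> starts i v"
  shows "sform Kr (fiber mm i w f) (fiber mm i v g) = zmean (mm i) (f * lstar g) * Kr w v"
proof (induction f rule: poly_mapping_induct_single)
  case (single k c)
  show ?case
    by (induction g rule: poly_mapping_induct_single)
      (simp_all add: fiber_single sform_scale sform_scale' sform_shifted[OF assms] lstar_single mult_single zmean_single
         fiber_add sform_add' lstar_add distrib_left distrib_right zmean_add)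
qed (simp add: fiber_add sform_add distrib_right zmean_add)

text \<open>
  On fibers the form is integration of \<open>f\<close> times the conjugate of \<open>g\<close>, and multiplication by
  a function has multiplication by its conjugate as adjoint.
\<close>

lemma rep_adjoint: "sform Kr (rep mm i f x) y = sform Kr x (rep mm i (lstar f) y)"
proof (rule sform_adjoint[OF clinear_rep clinear_rep])
  fix w v
  show "sform Kr (rep mm i f (Poly_Mapping.single w 1)) (Poly_Mapping.single v 1) =
     sform Kr (Poly_Mapping.single w 1) (rep mm i (lstar f) (Poly_Mapping.single v 1))"
  proof (cases "reduced w \<and> reduced v")
    case True
    then obtain w' g v' h where
      "reduced w'" "\<not> starts i w'" "Poly_Mapping.single w 1 = fiber mm i w' g"
      "reduced v'" "\<not> starts i v'" "Poly_Mapping.single v 1 = fiber mm i v' h"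
      using reduced_cases[of w i mm] reduced_cases[of v i mm] by metis
    then show ?thesis
      by (simp add: rep_fiber sform_fiber lstar_mult lstar_lstar mult_ac)
  next
    case False
    then show ?thesis
      by (cases "reduced w"; cases "reduced v")
        (simp_all add: rep_single Kr_not_reduced Kr_not_reduced' rep_basis_def sform_scale sform_scale')
  qed
qed

lemma rep_adjointable: "(rep mm i f, rep mm i (lstar f)) \<in> adjointable Kr"
  by (simp add: adjointable_def clinear_rep rep_adjoint)

text \<open>
  The component of \<open>f \<otimes> w\<close> along \<open>w\<close> itself is the mean of \<open>f\<close>.
\<close>

lemma fiber_centered_keys:
  assumes "zmean (mm i) f = 0" "reduced w" "\<not> starts i w" "v \<in> Poly_Mapping.keys (fiber mm i w f)"
  shows "reduced v \<and> starts i v"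
proof -
  have "fiber mm i w f = cscale (zmean (mm i) f) (Poly_Mapping.single w 1) +
      lext (\<lambda>k. if k = 0 then 0 else Poly_Mapping.single ((i, k) # w) 1) f"
    by (induction f rule: poly_mapping_induct_single)
      (auto simp: fiber_single shifted_def zmean_single lext_single mm_0 cscale_single cscale_0' cscale_add
         fiber_add zmean_add lext_add cscale_add' single_add add_ac)
  then have "v \<in> Poly_Mapping.keys (lext (\<lambda>k. if k = 0 then 0 else Poly_Mapping.single ((i, k) # w) 1) f)"
    using assms by (simp add: cscale_0)
  then obtain k where "v \<in> Poly_Mapping.keys (if k = 0 then 0 else Poly_Mapping.single ((i, k) # w) (1 :: complex))"
    by (drule_tac subsetD[OF keys_lext]) (elim UN_E)
  then have "k \<noteq> 0" "v = (i, k) # w" by (auto split: if_splits)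
  then show ?thesis using assms by (auto simp: reduced_Cons starts_def)
qed

lemma rep_centered_keys:
  assumes f: "zmean (mm i) f = 0" and x: "\<And>w. w \<in> Poly_Mapping.keys x \<Longrightarrow> reduced w \<and> \<not> starts i w"
    and v: "v \<in> Poly_Mapping.keys (rep mm i f x)"
  shows "reduced v \<and> starts i v"
proof -
  obtain w where w: "w \<in> Poly_Mapping.keys x" "v \<in> Poly_Mapping.keys (rep_basis mm i f w)"
    using v keys_lext[of "rep_basis mm i f" x] unfolding rep_def by blast
  with x[OF w(1)] show ?thesis
    using fiber_centered_keys[OF f, of w v] by (simp add: rep_basis_def)
qed

end

section \<open>Free unitaries with prescribed distributions\<close>

lemma rep_1': "rep m i 1 = (\<lambda>x. x)"
  and rep_plus': "rep m i (f + g) = (\<lambda>x. rep m i f x + rep m i g x)"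
  and rep_cscale': "rep m i (cscale c f) = (\<lambda>x. cscale c (rep m i f x))"
  by (rule ext; simp add: rep_1 rep_plus rep_cscale)+

context circle_pair
begin

context
  fixes enc :: "letter list opair \<Rightarrow> 'b"
  assumes enc: "inj enc"
begin

abbreviation "Alg \<equiv> op_algebra Kr enc"
abbreviation "state \<equiv> op_state Kr enc []"

definition pr :: "bool \<Rightarrow> laurent \<Rightarrow> 'b" where
  "pr i f = enc (rep mm i f, rep mm i (lstar f))"

lemma dec: "inv_into UNIV enc (enc p) = p" using enc by simp

lemma Alg_space: "star_prob_space Alg state"
  by (rule star_prob_space_op_algebra[OF enc Kr_herm sform_Kr_pos])
    (simp add: reduced_kernel_def reduced_Nil)

lemma pr_carrier: "pr i f \<in> carrier Alg"
  by (simp add: op_algebra_def pr_def rep_adjointable)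

lemma pr_mult: "pr i f \<otimes>\<^bsub>Alg\<^esub> pr i g = pr i (f * g)"
  by (simp add: op_algebra_def pr_def dec comp_def rep_rep lstar_mult mult.commute)

lemma lstar_1: "lstar 1 = 1"
  using lstar_single[of 0 1] by simp

lemma pr_one: "pr i 1 = \<one>\<^bsub>Alg\<^esub>"
  by (simp add: op_algebra_def pr_def rep_1' lstar_1 id_def)

lemma pr_add: "pr i f \<oplus>\<^bsub>Alg\<^esub> pr i g = pr i (f + g)"
  by (simp add: op_algebra_def pr_def dec lstar_add rep_plus')

lemma pr_smult: "c \<odot>\<^bsub>Alg\<^esub> pr i f = pr i (cscale c f)"
  by (simp add: op_algebra_def pr_def dec lstar_scale rep_cscale')

lemma pr_star: "star Alg (pr i f) = pr i (lstar f)"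
  by (simp add: op_algebra_def pr_def dec lstar_lstar)

lemma pr_generated: "star_generated Alg {pr i f} \<subseteq> range (pr i)"
proof -
  have "star_subalgebra Alg (range (pr i))"
    unfolding star_subalgebra_def
    using pr_carrier pr_one[symmetric, of i] by (auto simp: pr_mult pr_add pr_smult pr_star)
  then show ?thesis unfolding star_generated_def by blast
qed

lemma pr_pow: "pr i f [^]\<^bsub>Alg\<^esub> (n :: nat) = pr i (f ^ n)"
proof (induction n)
  case 0
  show ?case by (simp add: pr_one)
next
  case (Suc n)
  then show ?case by (simp add: pr_mult mult.commute)
qed

lemma state_pr: "state (pr i f) = zmean (mm i) f"
proof -
  have V: "Vac = fiber mm i [] 1"
    using fiber_single[of mm i "[]" 0 1] by (simp add: shifted_def cscale_1)
  have n: "reduced []" "\<not> starts i []" by (simp_all add: reduced_Nil starts_def)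
  show ?thesis
    unfolding op_state_def pr_def dec fst_conv V rep_fiber[OF n] sform_fiber[OF n n]
    by (simp add: lstar_1 reduced_kernel_def reduced_Nil)
qed

text \<open>
  Applied to the vacuum from right to left, each centered factor maps into the span of the
  reduced words that start in its own index. The resulting vector has no vacuum component, and the
  vacuum is orthogonal to all nonempty words.
\<close>

lemma pr_free:
  "free_subalgebras Alg state UNIV (\<lambda>b. star_generated Alg {pr b t})"
  unfolding free_subalgebras_def
proof (intro allI impI, elim conjE)
  fix w :: "(bool \<times> 'b) list"
  assume "w \<noteq> []" and w: "\<forall>(i, a)\<in>set w. i \<in> UNIV \<and> a \<in> star_generated Alg {pr i t} \<and> state a = 0"
    and alt: "successively (\<lambda>p q. fst p \<noteq> fst q) w"
  have ex: "\<exists>f. a = pr i f \<and> zmean (mm i) f = 0" if "(i, a) \<in> set w" for i a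
  proof -
    have "a \<in> range (pr i)" "state a = 0" using w that pr_generated[of i t] by fastforce+
    then show ?thesis using state_pr[of i] by auto
  qed
  have one: "fst (inv_into UNIV enc \<one>\<^bsub>Alg\<^esub>) x = x" for x
    by (simp add: op_algebra_def dec)
  have mult: "fst (inv_into UNIV enc (a \<otimes>\<^bsub>Alg\<^esub> b)) x = fst (inv_into UNIV enc a) (fst (inv_into UNIV enc b) x)" for a b x
    by (simp add: op_algebra_def dec)
  have "\<forall>x\<in>Poly_Mapping.keys (fst (inv_into UNIV enc (foldr (\<otimes>\<^bsub>Alg\<^esub>) (map snd v) \<one>\<^bsub>Alg\<^esub>)) Vac).
      reduced x \<and> starts (fst (hd v)) x" (is "?P v")
    if "set v \<subseteq> set w" "successively (\<lambda>p q. fst p \<noteq> fst q) v" "v \<noteq> []" for v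
    using that
  proof (induction v)
    case (Cons p v)
    obtain i a where p: "p = (i, a)" by force
    obtain f where f: "a = pr i f" "zmean (mm i) f = 0" using ex[of i a] Cons.prems p by auto
    let ?x = "fst (inv_into UNIV enc (foldr (\<otimes>\<^bsub>Alg\<^esub>) (map snd v) \<one>\<^bsub>Alg\<^esub>)) Vac"
    have x: "reduced y \<and> \<not> starts i y" if y: "y \<in> Poly_Mapping.keys ?x" for y
    proof (cases "v = []")
      case True
      then show ?thesis using y by (simp add: one reduced_Nil starts_def)
    next
      case False
      then have "reduced y \<and> starts (fst (hd v)) y" using Cons y by (auto simp: successively_Cons)
      moreover have "fst (hd v) \<noteq> i" using Cons.prems False p by (auto simp: successively_Cons)
      ultimately show ?thesis by (auto simp: starts_def)
    qed
    show ?case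
      using rep_centered_keys[OF f(2) x] by (auto simp: p f(1) mult) (simp_all add: pr_def dec)
  qed simp
  from this[of w] \<open>w \<noteq> []\<close> alt
  have k: "x \<in> Poly_Mapping.keys (fst (inv_into UNIV enc (foldr (\<otimes>\<^bsub>Alg\<^esub>) (map snd w) \<one>\<^bsub>Alg\<^esub>)) Vac) \<Longrightarrow>
      x \<noteq> []" for x
    by (auto simp: starts_def)
  have K0: "Kr x [] = 0" if "x \<noteq> []" for x using that by (cases x) (auto simp: reduced_kernel_def)
  show "state (foldr (\<otimes>\<^bsub>Alg\<^esub>) (map snd w) \<one>\<^bsub>Alg\<^esub>) = 0"
    unfolding op_state_def sform_def by (intro sum.neutral ballI) (simp add: K0[OF k])
qed

lemma pr_distr: "has_circle_distr Alg state (pr i (Poly_Mapping.single 1 1)) (M i)"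
  unfolding has_circle_distr_def
proof (intro conjI allI circle_prob)
  fix m n :: nat
  have pow: "Poly_Mapping.single k 1 ^ n = (Poly_Mapping.single (int n * k) 1 :: laurent)" for k n
    by (induction n) (simp_all add: mult_single algebra_simps)
  have "state (pr i (Poly_Mapping.single 1 1) [^]\<^bsub>Alg\<^esub> m \<otimes>\<^bsub>Alg\<^esub> star Alg (pr i (Poly_Mapping.single 1 1)) [^]\<^bsub>Alg\<^esub> n)
     = mm i (int m - int n)"
    by (simp add: pr_star pr_pow pr_mult lstar_single pow mult_single state_pr zmean_single)
  also have "\<dots> = (LINT t|M i. t ^ m * cnj t ^ n)"
    unfolding mm_def zmom_def
  proof (rule Bochner_Integration.integral_cong[OF refl])
    fix t assume "t \<in> space (M i)"
    then have t: "t \<in> circle" by (simp add: circle_prob_space[OF circle_prob])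
    then have "t \<noteq> 0" by auto
    then have "t powi (int m - int n) = t ^ m * (t powi (- int n))"
      by (simp add: power_int_diff power_int_minus divide_inverse)
    also have "t powi (- int n) = cnj t ^ n"
      using cnj_power_int_circle[OF t, of "int n"] by simp
    finally show "t powi (int m - int n) = t ^ m * cnj t ^ n" .
  qed
  finally show "state (pr i (Poly_Mapping.single 1 1) [^]\<^bsub>Alg\<^esub> m \<otimes>\<^bsub>Alg\<^esub> star Alg (pr i (Poly_Mapping.single 1 1)) [^]\<^bsub>Alg\<^esub> n)
     = (LINT t|M i. t ^ m * cnj t ^ n)" .
qed

lemma pr_unitary: "unitary_elem Alg (pr i (Poly_Mapping.single 1 1))"
  unfolding unitary_elem_def
  by (simp add: pr_carrier pr_star pr_mult lstar_single mult_single pr_one)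

end
end

theorem free_unitaries_exist:
  assumes "circle_prob \<mu>" "circle_prob \<nu>"
  shows "\<exists>(A :: ((nat \<Rightarrow> complex) \<Rightarrow> (nat \<Rightarrow> complex)) star_algebra) \<phi> u v.
     star_prob_space A \<phi> \<and> unitary_elem A u \<and> unitary_elem A v \<and> free_elems A \<phi> u v \<and>
     has_circle_distr A \<phi> u \<mu> \<and> has_circle_distr A \<phi> v \<nu>"
proof -
  interpret circle_pair "\<lambda>b. if b then \<mu> else \<nu>"
    by standard (use assms in auto)
  obtain enc :: "letter list opair \<Rightarrow> ((nat \<Rightarrow> complex) \<Rightarrow> (nat \<Rightarrow> complex))" where enc: "inj enc"
    using ex_encoding by blast
  let ?t = "Poly_Mapping.single 1 1 :: laurent"
  have "free_elems (Alg enc) (state enc) (pr enc True ?t) (pr enc False ?t)"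
    using pr_free[OF enc, of ?t] unfolding free_elems_def
    by (rule back_subst[of "\<lambda>B. free_subalgebras (Alg enc) (state enc) UNIV B"])
      (rule ext, rename_tac b, case_tac b, simp_all)
  then show ?thesis
    using Alg_space[OF enc] pr_unitary[OF enc] pr_distr[OF enc, of True] pr_distr[OF enc, of False]
    by (intro exI[of _ "Alg enc"] exI[of _ "state enc"] exI[of _ "pr enc True ?t"] exI[of _ "pr enc False ?t"]) auto
qed

section \<open>Moments and weak convergence\<close>

definition mom :: "complex measure \<Rightarrow> nat \<Rightarrow> complex" where
  "mom \<mu> k = (LINT t|\<mu>. t ^ k)"

definition circle_measure :: "complex measure \<Rightarrow> bool" where
  "circle_measure \<mu> \<longleftrightarrow> finite_measure \<mu> \<and> sets \<mu> = sets circle_borel"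

lemma circle_measure_integrable:
  fixes f :: "complex \<Rightarrow> 'b::{banach, second_countable_topology}"
  shows "circle_measure \<mu> \<Longrightarrow> continuous_on circle f \<Longrightarrow> integrable \<mu> f"
  by (auto simp: circle_measure_def intro: circle_finite_measure_integrable)

lemma circle_prob_measure: "circle_prob \<mu> \<Longrightarrow> circle_measure \<mu>"
  by (auto simp: circle_prob_def circle_measure_def prob_space_def)

lemma circle_measure_space: "circle_measure \<mu> \<Longrightarrow> space \<mu> = circle"
  using sets_eq_imp_space_eq[of \<mu> circle_borel] by (auto simp: circle_measure_def space_restrict_space)

text \<open>
  Trigonometric polynomials as functions of \<open>t\<close> and \<open>cnj t\<close>, which also makes sense off the
  circle.
\<close>

inductive trig :: "(complex \<Rightarrow> complex) \<Rightarrow> bool" where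
  monom: "trig (\<lambda>t. t ^ j * cnj t ^ k)"
| scale: "trig f \<Longrightarrow> trig (\<lambda>t. c * f t)"
| add: "trig f \<Longrightarrow> trig g \<Longrightarrow> trig (\<lambda>t. f t + g t)"

lemma trig_continuous: "trig f \<Longrightarrow> continuous_on A f"
  by (induction rule: trig.induct) (auto intro!: continuous_intros)

lemma trig_mult:
  assumes "trig f" "trig g"
  shows "trig (\<lambda>t. f t * g t)"
  using assms(1)
proof induction
  case (monom j k)
  from assms(2) show ?case
  proof induction
    case (monom j' k')
    show ?case using trig.monom[of "j + j'" "k + k'"] by (simp add: power_add mult_ac)
  next
    case (scale f c) then show ?case using trig.scale[of _ c] by (simp add: mult_ac)
  next
    case (add f g) then show ?case by (simp add: distrib_left trig.add)
  qed
qed (auto intro: trig.intros simp: distrib_right mult.assoc)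

lemma trig_const: "trig (\<lambda>t. c)"
  using trig.scale[OF trig.monom[of 0 0], of c] by simp

lemma trig_real_polynomial:
  assumes "real_polynomial_function g"
  shows "trig (\<lambda>t. complex_of_real (g t))"
  using assms
proof (induction rule: real_polynomial_function.induct, goal_cases)
  case (1 f)
  interpret bounded_linear f by fact
  have "complex_of_real (f t) = (of_real (f 1) / 2 - \<i> * of_real (f \<i>) / 2) * (t ^ 1 * cnj t ^ 0) +
     (of_real (f 1) / 2 + \<i> * of_real (f \<i>) / 2) * (t ^ 0 * cnj t ^ 1)" for t
  proof -
    have "f t = f (Re t *\<^sub>R 1 + Im t *\<^sub>R \<i>)"
      by (rule arg_cong[of _ _ f]) (simp add: complex_eq_iff)
    also have "\<dots> = Re t * f 1 + Im t * f \<i>"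
      by (simp only: add scale) simp
    finally show ?thesis by (simp add: complex_eq_iff)
  qed
  then have eq: "(\<lambda>t. complex_of_real (f t)) = (\<lambda>t. (of_real (f 1) / 2 - \<i> * of_real (f \<i>) / 2) * (t ^ 1 * cnj t ^ 0) +
     (of_real (f 1) / 2 + \<i> * of_real (f \<i>) / 2) * (t ^ 0 * cnj t ^ 1))" by (rule ext)
  show ?case by (subst eq) (intro trig.add trig.scale trig.monom)
qed (auto intro: trig_const trig.add trig_mult)

lemma circle_monom:
  assumes "t \<in> circle"
  shows "t ^ j * cnj t ^ k = (if k \<le> j then t ^ (j - k) else cnj (t ^ (k - j)))"
proof -
  have 1: "t * cnj t = 1" using assms by (simp add: complex_norm_square[symmetric])
  show ?thesis
  proof (cases "k \<le> j")
    case True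
    then have "t ^ j * cnj t ^ k = t ^ (j - k) * (t * cnj t) ^ k"
      by (simp add: power_mult_distrib power_add[symmetric] mult.assoc[symmetric])
    then show ?thesis using True by (simp add: 1)
  next
    case False
    then have "t ^ j * cnj t ^ k = cnj t ^ (k - j) * (t * cnj t) ^ j"
      by (simp add: power_mult_distrib power_add[symmetric] mult.assoc[symmetric] mult.left_commute)
    then show ?thesis using False by (simp add: 1)
  qed
qed

lemma mom_monom:
  assumes "circle_measure \<mu>"
  shows "(LINT t|\<mu>. t ^ j * cnj t ^ k) = (if k \<le> j then mom \<mu> (j - k) else cnj (mom \<mu> (k - j)))"
proof -
  have "(LINT t|\<mu>. t ^ j * cnj t ^ k) = (LINT t|\<mu>. (if k \<le> j then t ^ (j - k) else cnj (t ^ (k - j))))"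
    by (rule Bochner_Integration.integral_cong[OF refl], rule circle_monom) (simp add: circle_measure_space[OF assms])
  then show ?thesis by (simp add: mom_def del: complex_cnj_power)
qed

lemma weak_conv_trig:
  assumes M: "\<forall>\<^sub>F n in sequentially. circle_measure (M n)" and L: "circle_measure L"
    and mom: "\<And>k. (\<lambda>n. mom (M n) k) \<longlonglongrightarrow> mom L k" and f: "trig f"
  shows "(\<lambda>n. LINT t|M n. f t) \<longlonglongrightarrow> (LINT t|L. f t)"
  using f
proof induction
  case (monom j k)
  have "(\<lambda>n. if k \<le> j then mom (M n) (j - k) else cnj (mom (M n) (k - j))) \<longlonglongrightarrow>
     (if k \<le> j then mom L (j - k) else cnj (mom L (k - j)))"
    using mom by (auto intro: tendsto_cnj)
  then show ?case
    unfolding mom_monom[OF L]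
    by (rule Lim_transform_eventually) (use M in eventually_elim, simp add: mom_monom)
next
  case (add f g)
  have "(\<lambda>n. (LINT t|M n. f t) + (LINT t|M n. g t)) \<longlonglongrightarrow> (LINT t|L. f t) + (LINT t|L. g t)"
    using add by (intro tendsto_add)
  also have "(LINT t|L. f t) + (LINT t|L. g t) = (LINT t|L. f t + g t)"
    using add.hyps by (intro Bochner_Integration.integral_add[symmetric] circle_measure_integrable L trig_continuous)
  finally show ?case
    by (rule Lim_transform_eventually)
      (use M in eventually_elim, use add.hyps in \<open>intro Bochner_Integration.integral_add[symmetric] circle_measure_integrable trig_continuous\<close>)
qed (auto intro: tendsto_mult_left)

text \<open>
  A continuous function is uniformly close to a trigonometric polynomial (Stone-Weierstrass),
  and the error is controlled since the masses, being moments of order \<open>0\<close>, stay bounded.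
\<close>

theorem weak_conv_of_moments:
  assumes M: "\<forall>\<^sub>F n in sequentially. circle_measure (M n)" and L: "circle_measure L"
    and mom: "\<And>k. (\<lambda>n. mom (M n) k) \<longlonglongrightarrow> mom L k"
  shows "weak_conv_circle M L"
  unfolding weak_conv_circle_def
proof (intro allI impI)
  fix f :: "complex \<Rightarrow> real" assume f: "continuous_on circle f"
  have mass: "(\<lambda>n. LINT t|M n. 1 :: real) \<longlonglongrightarrow> (LINT t|L. 1)"
  proof -
    have "mom N 0 = of_real (LINT t|N. 1 :: real)" for N
      by (simp add: mom_def scaleR_conv_of_real)
    then show ?thesis using mom[of 0] by (simp only: tendsto_of_real_iff)
  qed
  define C where "C = (LINT t|L. 1 :: real) + 1"
  have C: "C > 0" unfolding C_def by (intro add_nonneg_pos Bochner_Integration.integral_nonneg) auto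
  have massM: "\<forall>\<^sub>F n in sequentially. (LINT t|M n. 1) < C"
    using order_tendstoD(2)[OF mass, of C] by (simp add: C_def)
  show "(\<lambda>n. LINT t|M n. f t) \<longlonglongrightarrow> (LINT t|L. f t)"
  proof (rule tendstoI)
    fix e :: real assume e: "e > 0"
    define d where "d = e / (3 * C)"
    have d: "d > 0" using e C by (simp add: d_def)
    obtain g where g: "real_polynomial_function g" and fg: "\<And>t. t \<in> circle \<Longrightarrow> \<bar>f t - g t\<bar> < d"
      using Stone_Weierstrass_real_polynomial_function[OF compact_sphere f d] by blast
    have cg: "continuous_on circle g"
      by (rule differentiable_imp_continuous_on[OF differentiable_on_real_polynomial_function[OF g]])
    have "(\<lambda>n. LINT t|M n. complex_of_real (g t)) \<longlonglongrightarrow> (LINT t|L. complex_of_real (g t))"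
      by (rule weak_conv_trig[OF M L mom trig_real_polynomial[OF g]])
    then have "(\<lambda>n. LINT t|M n. g t) \<longlonglongrightarrow> (LINT t|L. g t)"
      by (simp only: integral_complex_of_real tendsto_of_real_iff)
    then have ev: "\<forall>\<^sub>F n in sequentially. dist (LINT t|M n. g t) (LINT t|L. g t) < e / 3"
      using e by (intro tendstoD) auto
    have diff: "\<bar>(LINT t|N. f t) - (LINT t|N. g t)\<bar> \<le> d * (LINT t|N. 1)" if N: "circle_measure N" for N
    proof -
      have "\<bar>(LINT t|N. f t) - (LINT t|N. g t)\<bar> = \<bar>LINT t|N. f t - g t\<bar>"
        by (simp add: Bochner_Integration.integral_diff circle_measure_integrable[OF N] f cg)
      also have "\<dots> \<le> (LINT t|N. \<bar>f t - g t\<bar>)" by (rule integral_abs_bound)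
      also have "\<dots> \<le> (LINT t|N. d * 1)"
        using fg by (intro Bochner_Integration.integral_mono circle_measure_integrable[OF N] continuous_intros f cg)
          (auto simp: circle_measure_space[OF N] less_imp_le)
      finally show ?thesis by (simp add: mult.commute)
    qed
    show "\<forall>\<^sub>F n in sequentially. dist (LINT t|M n. f t) (LINT t|L. f t) < e"
      using ev massM M
    proof eventually_elim
      case (elim n)
      have dC: "d * C = e / 3" using C by (simp add: d_def)
      have "(LINT t|L. 1) < C" by (simp add: C_def)
      then have "d * (LINT t|M n. 1) < e / 3" "d * (LINT t|L. 1) < e / 3"
        using elim(2) d unfolding dC[symmetric] by (intro mult_strict_left_mono; simp)+
      then show ?case
        using diff[OF elim(3)] diff[OF L] elim(1) unfolding dist_real_def by linarith
    qed
  qed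
qed

lemma weak_conv_integral_complex:
  fixes f :: "complex \<Rightarrow> complex"
  assumes M: "\<forall>\<^sub>F n in sequentially. circle_measure (M n)" and L: "circle_measure L"
    and w: "weak_conv_circle M L" and f: "continuous_on circle f"
  shows "(\<lambda>n. LINT t|M n. f t) \<longlonglongrightarrow> (LINT t|L. f t)"
proof -
  have 1: "(LINT t|N. f t) = Complex (LINT t|N. Re (f t)) (LINT t|N. Im (f t))" if "circle_measure N" for N
    using circle_measure_integrable[OF that f] by (simp add: complex_eq_iff)
  have "(\<lambda>n. LINT t|M n. Re (f t)) \<longlonglongrightarrow> (LINT t|L. Re (f t))"
    "(\<lambda>n. LINT t|M n. Im (f t)) \<longlonglongrightarrow> (LINT t|L. Im (f t))"
    using w f unfolding weak_conv_circle_def by (auto intro: continuous_intros)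
  then have "(\<lambda>n. Complex (LINT t|M n. Re (f t)) (LINT t|M n. Im (f t))) \<longlonglongrightarrow> (LINT t|L. f t)"
    unfolding 1[OF L] by (rule tendsto_Complex)
  then show ?thesis
    by (rule Lim_transform_eventually) (use M in eventually_elim, simp add: 1)
qed

theorem weak_conv_iff_moments:
  assumes M: "\<forall>\<^sub>F n in sequentially. circle_measure (M n)" and L: "circle_measure L"
  shows "weak_conv_circle M L \<longleftrightarrow> (\<forall>k. (\<lambda>n. mom (M n) k) \<longlonglongrightarrow> mom L k)"
proof -
  have "continuous_on circle (\<lambda>t. t ^ k :: complex)" for k by (intro continuous_intros)
  then show ?thesis
    using weak_conv_of_moments[OF M L] weak_conv_integral_complex[OF M L] unfolding mom_def by blast
qed

text \<open>
  Equal moments give equal integrals of continuous functions, and the indicator of a closed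
  set is a decreasing limit of functions of the distance to it.
\<close>

theorem circle_prob_eqI:
  assumes \<mu>: "circle_prob \<mu>" and \<nu>: "circle_prob \<nu>" and mom: "\<And>k. mom \<mu> k = mom \<nu> k"
  shows "\<mu> = \<nu>"
proof -
  have "weak_conv_circle (\<lambda>_. \<mu>) \<nu>"
    using assms by (intro weak_conv_of_moments always_eventually) (auto intro: circle_prob_measure)
  then have int: "(LINT t|\<mu>. f t) = (LINT t|\<nu>. f t)" if "continuous_on circle f" for f :: "complex \<Rightarrow> real"
    using that by (auto simp: weak_conv_circle_def LIMSEQ_const_iff)
  define E where "E = {C. closed C \<and> C \<subseteq> circle}"
  have sets: "sets circle_borel = sigma_sets circle E"
  proof -
    have 1: "sets (borel :: complex measure) = sigma_sets UNIV (Collect closed)"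
      by (simp add: borel_eq_closed)
    have "sets circle_borel = (\<lambda>A. circle \<inter> A) ` sigma_sets UNIV (Collect closed)"
      by (simp only: sets_restrict_space 1)
    also have "\<dots> = sigma_sets circle ((\<lambda>A. circle \<inter> A) ` Collect closed)"
      by (rule sigma_sets_Int) (auto intro: sigma_sets.Basic)
    also have "((\<lambda>A. circle \<inter> A) ` Collect closed) = E"
      by (auto simp: E_def image_iff intro!: closed_Int)
    finally show ?thesis .
  qed
  have meas: "measure \<mu> C = measure \<nu> C" if C: "C \<in> E" for C
  proof (cases "C = {}")
    case False
    define f where "f n t = max 0 (1 - real n * infdist t C)" for n t
    have cf: "continuous_on circle (f n)" for n
      unfolding f_def by (intro continuous_intros)
    have lim: "(\<lambda>n. f n t) \<longlonglongrightarrow> indicator C t" for t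
    proof (cases "t \<in> C")
      case True
      then have "f n t = 1" for n by (simp add: f_def)
      then show ?thesis using True by simp
    next
      case F: False
      have "infdist t C > 0"
        using C F False infdist_pos_not_in_closed by (auto simp: E_def)
      then obtain N where N: "1 < real N * infdist t C" using reals_Archimedean3 by blast
      have "\<forall>\<^sub>F n in sequentially. f n t = 0"
        using eventually_ge_at_top[of N]
      proof eventually_elim
        case (elim n)
        then have "real N * infdist t C \<le> real n * infdist t C"
          by (intro mult_right_mono) (auto simp: infdist_nonneg)
        then show ?case using N by (simp add: f_def)
      qed
      then show ?thesis using F by (simp add: tendsto_eventually)
    qed
    have lim_meas: "(\<lambda>n. LINT t|N. f n t) \<longlonglongrightarrow> measure N C" if N: "circle_prob N" for N
    proof -
      interpret prob_space N using N by (simp add: circle_prob_def)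
      have CN: "C \<in> sets N" using C N sets by (auto simp: circle_prob_def)
      have "(\<lambda>n. LINT t|N. f n t) \<longlonglongrightarrow> (LINT t|N. indicator C t)"
      proof (rule integral_dominated_convergence[where w = "\<lambda>_. 1"])
        show "indicator C \<in> borel_measurable N" using CN by simp
        show "f n \<in> borel_measurable N" for n
          using N cf by (intro circle_measurable) (auto simp: circle_prob_def)
        show "AE x in N. norm (f n x) \<le> 1" for n
          by (auto simp: f_def infdist_nonneg)
      qed (auto simp: lim)
      then show ?thesis using CN by simp
    qed
    have "(\<lambda>n. LINT t|\<nu>. f n t) \<longlonglongrightarrow> measure \<mu> C"
      using lim_meas[OF \<mu>] int[OF cf] by simp
    then show ?thesis using lim_meas[OF \<nu>] LIMSEQ_unique by blast
  qed simp
  interpret m: prob_space \<mu> using \<mu> by (simp add: circle_prob_def)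
  interpret n: prob_space \<nu> using \<nu> by (simp add: circle_prob_def)
  show ?thesis
  proof (rule measure_eqI_generator_eq[where E = E and \<Omega> = circle and A = "\<lambda>_. circle"])
    show "Int_stable E" by (auto simp: Int_stable_def E_def)
    show "emeasure \<mu> C = emeasure \<nu> C" if "C \<in> E" for C
      using meas[OF that] by (simp add: m.emeasure_eq_measure n.emeasure_eq_measure)
  qed (use \<mu> \<nu> sets in \<open>auto simp: E_def circle_prob_def\<close>)
qed

lemma Arg_measurable: "Arg \<in> borel_measurable circle_borel"
proof -
  have "(\<lambda>t. if t \<in> \<real>\<^sub>\<le>\<^sub>0 then pi else Arg t) \<in> borel_measurable borel"
    by (rule borel_measurable_continuous_on_if) (auto intro: continuous_on_Arg borel_closed closed_nonpos_Reals_complex)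
  then have "(\<lambda>t. if t \<in> \<real>\<^sub>\<le>\<^sub>0 then pi else Arg t) \<in> borel_measurable circle_borel"
    by (rule measurable_restrict_space1)
  also have "?this \<longleftrightarrow> ?thesis"
  proof (rule measurable_cong)
    fix t :: complex assume "t \<in> space circle_borel"
    then have t: "t \<noteq> 0" by (auto simp: space_restrict_space)
    show "(if t \<in> \<real>\<^sub>\<le>\<^sub>0 then pi else Arg t) = Arg t"
      using t Arg_eq_pi[of t] by (auto simp: complex_nonpos_Reals_iff complex_eq_iff)
  qed
  finally show ?thesis .
qed

lemma cis_borel: "cis \<in> borel_measurable borel"
proof -
  have "continuous_on UNIV (\<lambda>x. cis x)" by (intro continuous_intros)
  then show ?thesis by (rule borel_measurable_continuous_onI)
qed

text \<open>
  Compactness. The argument transports the measures to the interval of length \<open>2 \<pi>\<close>, where they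
  are tight, and Helly's theorem yields a limit; the characteristic function at the integer \<open>k\<close> is the
  moment of order \<open>k\<close>.
\<close>

theorem moment_limit:
  assumes \<mu>: "\<And>n. circle_prob (\<mu> n)" and c: "\<And>k. (\<lambda>n. mom (\<mu> n) k) \<longlonglongrightarrow> c k"
  shows "\<exists>\<nu>. circle_prob \<nu> \<and> (\<forall>k. mom \<nu> k = c k)"
proof -
  have Arg_m: "Arg \<in> measurable (\<mu> n) borel" for n
    using Arg_measurable measurable_cong_sets[of "\<mu> n" circle_borel] \<mu>[of n] by (auto simp: circle_prob_def)
  define M where "M n = distr (\<mu> n) borel Arg" for n
  have ps: "prob_space (\<mu> n)" for n using \<mu> by (simp add: circle_prob_def)
  have rd: "real_distribution (M n)" for n
    unfolding M_def using prob_space.real_distribution_distr[OF ps Arg_m] .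
  have "measure (M n) {-4<..4} = 1" for n
  proof -
    interpret prob_space "\<mu> n" by (rule ps)
    have "pi < 4" by (rule pi_less_4)
    then have "Arg -` {-4<..4} \<inter> space (\<mu> n) = space (\<mu> n)"
      using Arg_bounded by (auto, smt, smt)
    then show ?thesis unfolding M_def by (subst measure_distr) (auto simp: Arg_m prob_space)
  qed
  then have "tight M"
    unfolding tight_def
    by (intro conjI allI impI rd) (rule exI[of _ "-4"], rule exI[of _ 4], simp)
  from tight_imp_convergent_subsubsequence[OF this strict_mono_id] obtain r M'
    where r: "strict_mono r" and M': "real_distribution M'" and w: "weak_conv_m (M \<circ> r) M'"
    by (auto simp: comp_def)
  have cis_Arg: "cis (Arg t) = t" if t: "t \<in> circle" for t
  proof -
    have "t \<noteq> 0" using t by auto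
    from Arg_eq[OF this] t show ?thesis by (simp add: cis_conv_exp)
  qed
  have char_M: "char (M n) (real k) = mom (\<mu> n) k" for n k
  proof -
    have "char (M n) (real k) = (LINT t|\<mu> n. iexp (real k * Arg t))"
      unfolding char_def M_def by (subst integral_distr[OF Arg_m]) auto
    also have "\<dots> = mom (\<mu> n) k"
      unfolding mom_def
    proof (rule Bochner_Integration.integral_cong[OF refl])
      fix t assume "t \<in> space (\<mu> n)"
      then have "t \<in> circle" by (simp add: circle_prob_space[OF \<mu>])
      then have "t ^ k = cis (Arg t) ^ k" by (simp add: cis_Arg)
      also have "\<dots> = iexp (real k * Arg t)" by (simp only: cis_conv_exp[symmetric] Complex.DeMoivre)
      finally show "iexp (real k * Arg t) = t ^ k" ..
    qed
    finally show ?thesis .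
  qed
  interpret real_distribution M' by fact
  have cm: "cis \<in> measurable M' circle_borel"
    by (rule measurable_restrict_space2) (auto simp: cis_borel cong: measurable_cong_sets)
  define \<nu> where "\<nu> = distr M' circle_borel cis"
  have "circle_prob \<nu>"
    unfolding circle_prob_def \<nu>_def using prob_space_distr[OF cm] by simp
  moreover have "mom \<nu> k = c k" for k
  proof -
    have "(\<lambda>n. char (M (r n)) (real k)) \<longlonglongrightarrow> char M' (real k)"
      by (rule levy_continuity1[OF rd M']) (use w in \<open>simp add: comp_def\<close>)
    moreover have "(\<lambda>n. char (M (r n)) (real k)) \<longlonglongrightarrow> c k"
      unfolding char_M using LIMSEQ_subseq_LIMSEQ[OF c r] by (simp add: comp_def)
    ultimately have "char M' (real k) = c k" by (rule LIMSEQ_unique)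
    moreover have "mom \<nu> k = (LINT x|M'. cis x ^ k)"
      unfolding mom_def \<nu>_def by (subst integral_distr[OF cm]) (auto intro!: measurable_restrict_space1)
    moreover have "\<dots> = char M' (real k)"
      unfolding char_def by (simp only: cis_conv_exp[symmetric] Complex.DeMoivre)
    ultimately show ?thesis by simp
  qed
  ultimately show ?thesis by blast
qed

lemma circle_density:
  fixes p :: "real \<Rightarrow> real"
  assumes p: "continuous_on {0..2*pi} p" and pos: "\<And>x. x \<in> {0..2*pi} \<Longrightarrow> 0 \<le> p x"
    and int: "integral {0..2*pi} p = 2 * pi"
  shows "\<exists>\<mu>. circle_prob \<mu> \<and>
     (\<forall>k. mom \<mu> k = integral {0..2*pi} (\<lambda>x. of_real (p x) * cis x ^ k) / (2 * pi))"
proof -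
  define f where "f x = indicator {0..2*pi} x * (p x / (2 * pi))" for x
  have si: "set_integrable lborel {0..2*pi} g" if "continuous_on {0..2*pi} g" for g :: "real \<Rightarrow> 'b::euclidean_space"
    using that by (rule borel_integrable_atLeastAtMost')
  have f_meas: "f \<in> borel_measurable lborel"
  proof -
    have "continuous_on {0..2*pi} (\<lambda>x. p x / (2 * pi))"
      using p by (intro continuous_intros) auto
    then show ?thesis
      unfolding f_def using borel_measurable_continuous_on_indicator[of "{0..2*pi}" "\<lambda>x. p x / (2 * pi)"] by simp
  qed
  have f_pos: "0 \<le> f x" for x using pos by (auto simp: f_def indicator_def)
  have f_int: "integrable lborel f" "(LINT x|lborel. f x) = 1"
  proof -
    have 1: "f = (\<lambda>x. (indicator {0..2*pi} x *\<^sub>R p x) / (2 * pi))" by (auto simp: f_def)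
    show "integrable lborel f"
      unfolding 1 using si[OF p] by (simp add: set_integrable_def)
    have "(LINT x|lborel. f x) = (LINT x:{0..2*pi}|lborel. p x) / (2 * pi)"
      unfolding 1 set_lebesgue_integral_def by simp
    also have "\<dots> = 1" using set_borel_integral_eq_integral(2)[OF si[OF p]] int by simp
    finally show "(LINT x|lborel. f x) = 1" .
  qed
  define N where "N = density lborel (\<lambda>x. ennreal (f x))"
  have "emeasure N (space N) = 1"
    using nn_integral_eq_integral[OF f_int(1)] f_pos f_int(2) f_meas
    by (simp add: N_def emeasure_density)
  then interpret N: prob_space N by (rule prob_spaceI)
  have cm: "cis \<in> measurable N circle_borel"
    by (rule measurable_restrict_space2) (auto simp: N_def cis_borel)
  have "circle_prob (distr N circle_borel cis)"
    unfolding circle_prob_def using N.prob_space_distr[OF cm] by simp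
  moreover have "mom (distr N circle_borel cis) k = integral {0..2*pi} (\<lambda>x. of_real (p x) * cis x ^ k) / (2 * pi)" for k
  proof -
    have c: "continuous_on {0..2*pi} (\<lambda>x. of_real (p x) * cis x ^ k)"
      using p by (intro continuous_intros)
    have "mom (distr N circle_borel cis) k = (LINT x|N. cis x ^ k)"
      unfolding mom_def by (subst integral_distr[OF cm]) (auto intro!: measurable_restrict_space1)
    also have "\<dots> = (LINT x|lborel. f x *\<^sub>R (cis x ^ k))"
      unfolding N_def using f_pos f_meas
      by (intro integral_density) (auto intro!: borel_measurable_continuous_onI continuous_intros)
    also have "\<dots> = (LINT x:{0..2*pi}|lborel. of_real (p x) * cis x ^ k) / (2 * pi)"
      unfolding set_lebesgue_integral_def
      by (subst Bochner_Integration.integral_divide_zero[symmetric], rule Bochner_Integration.integral_cong)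
         (auto simp: f_def scaleR_conv_of_real indicator_def)
    also have "\<dots> = integral {0..2*pi} (\<lambda>x. of_real (p x) * cis x ^ k) / (2 * pi)"
      using set_borel_integral_eq_integral(2)[OF si[OF c]] by simp
    finally show ?thesis .
  qed
  ultimately show ?thesis by blast
qed

lemma integral_cis_int:
  "integral {0..2*pi} (\<lambda>x. cis (of_int l * x)) = (if l = 0 then 2 * pi else 0)"
proof (cases "l = 0")
  case False
  have "((\<lambda>x. cis (of_int l * x)) has_integral
     cis (of_int l * (2*pi)) / (\<i> * of_int l) - cis (of_int l * 0) / (\<i> * of_int l)) {0..2*pi}"
  proof (rule fundamental_theorem_of_calculus)
    fix x :: real
    have "((\<lambda>x. cis (of_int l * x)) has_vector_derivative (of_int l *\<^sub>R (\<i> * cis (of_int l * x)))) (at x within {0..2*pi})"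
      by (auto intro!: derivative_eq_intros simp: has_vector_derivative_def has_derivative_cis scaleR_conv_of_real)
    from has_vector_derivative_divide[OF this, of "\<i> * of_int l"]
    show "((\<lambda>x. cis (of_int l * x) / (\<i> * of_int l)) has_vector_derivative cis (of_int l * x)) (at x within {0..2*pi})"
      using False by (simp add: scaleR_conv_of_real field_simps)
  qed simp
  moreover have "cis (of_int l * (2*pi)) = 1"
    using cis_multiple_2pi[of "of_int l"] by (simp add: mult_ac)
  ultimately show ?thesis using False by (simp add: integral_unique)
qed (simp add: scaleR_conv_of_real)

section \<open>Distributions of unitaries\<close>

lemma integral_cis_mult:
  "integral {0..2*pi} (\<lambda>x. c * cis (of_int l * x)) = (if l = 0 then 2 * pi * (c :: complex) else 0)"
  unfolding integral_mult_right integral_cis_int by simp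

lemma integrable_on_cis: "(\<lambda>x. (c :: complex) * cis (of_int l * x)) integrable_on {0..2*pi}"
  by (intro integrable_continuous_real continuous_intros)

text \<open>
  The Fejer means of the Fourier series with coefficients \<open>m\<close> are nonnegative, by positivity of
  the form at the vectors \<open>c j = cis (- j x)\<close>. They are densities of measures with moments
  \<open>(1 - l / N) m l\<close>, to which compactness applies. The matrix \<open>D\<close> is the Toeplitz matrix of \<open>m\<close>,
  given through its upper triangle.
\<close>

theorem trigonometric_moment_problem:
  fixes D :: "nat \<Rightarrow> nat \<Rightarrow> complex" and m :: "nat \<Rightarrow> complex"
  assumes D: "\<And>j k. D j (j + k) = m k" and m0: "m 0 = 1"
    and pos: "\<And>N c. (\<Sum>j<N. \<Sum>k<N. cnj (c j) * c k * D j k) \<in> \<real>\<^sub>\<ge>\<^sub>0"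
  shows "\<exists>\<mu>. circle_prob \<mu> \<and> (\<forall>k. mom \<mu> k = m k)"
proof -
  have "\<exists>\<mu>. circle_prob \<mu> \<and> (\<forall>l. mom \<mu> l = of_nat (Suc n - l) / of_nat (Suc n) * m l)" for n
  proof -
    define N where "N = Suc n"
    define q where "q x = (\<Sum>j<N. \<Sum>k<N. D j k * cis (of_int (int j - int k) * x)) / of_nat N" for x
    have q_pos: "q x \<in> \<real>\<^sub>\<ge>\<^sub>0" for x
    proof -
      have "q x = (\<Sum>j<N. \<Sum>k<N. cnj (cis (- (real j * x))) * cis (- (real k * x)) * D j k) * of_real (1 / real N)"
        unfolding q_def by (simp add: cis_cnj cis_mult algebra_simps)
      also have "\<dots> \<in> \<real>\<^sub>\<ge>\<^sub>0"
        by (intro nonneg_Reals_mult_I pos) simp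
      finally show ?thesis .
    qed
    have qR: "of_real (Re (q x)) = q x" for x
      using q_pos[of x] by (auto simp: complex_nonneg_Reals_iff complex_eq_iff)
    have int_l: "integral {0..2*pi} (\<lambda>x. q x * cis x ^ l) = 2 * pi * (of_nat (N - l) / of_nat N * m l)" for l
    proof -
      have "(\<lambda>x. q x * cis x ^ l) =
         (\<lambda>x. \<Sum>j<N. \<Sum>k<N. (D j k / of_nat N) * cis (of_int (int j + int l - int k) * x))"
        unfolding q_def Complex.DeMoivre
        by (simp add: sum_distrib_left sum_distrib_right sum_divide_distrib cis_mult algebra_simps)
      then have "integral {0..2*pi} (\<lambda>x. q x * cis x ^ l) = integral {0..2*pi}
         (\<lambda>x. \<Sum>j<N. \<Sum>k<N. (D j k / of_nat N) * cis (of_int (int j + int l - int k) * x))"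
        by (simp only:)
      also have "\<dots> =
         (\<Sum>j<N. \<Sum>k<N. integral {0..2*pi} (\<lambda>x. (D j k / of_nat N) * cis (of_int (int j + int l - int k) * x)))"
        by (subst integral_sum, simp, intro integrable_sum integrable_on_cis finite_lessThan,
            intro sum.cong refl, rule integral_sum, simp, rule integrable_on_cis)
      also have "\<dots> = (\<Sum>j<N. \<Sum>k<N. if k = j + l then 2 * pi * (m l / of_nat N) else 0)"
        by (intro sum.cong refl, subst integral_cis_mult) (auto simp: D)
      also have "\<dots> = (\<Sum>j<N. if j < N - l then 2 * pi * (m l / of_nat N) else 0)"
        by (intro sum.cong refl) (auto simp: less_diff_conv)
      also have "\<dots> = (\<Sum>j\<in>{..<N - l}. 2 * pi * (m l / of_nat N))"
        by (rule sum.mono_neutral_cong_right) auto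
      finally show ?thesis by (simp add: mult_ac)
    qed
    have N0: "of_nat N \<noteq> (0 :: complex)" by (simp add: N_def del: of_nat_Suc)
    have qc: "continuous_on {0..2*pi} q"
      unfolding q_def using N0 by (intro continuous_intros) auto
    have "integral {0..2*pi} (\<lambda>x. Re (q x)) = Re (integral {0..2*pi} q)"
      using integral_linear[OF integrable_continuous_real[OF qc] bounded_linear_Re] by (simp add: comp_def)
    also have "\<dots> = 2 * pi"
      using int_l[of 0] m0 N0 by simp
    finally have "\<exists>\<mu>. circle_prob \<mu> \<and>
       (\<forall>k. mom \<mu> k = integral {0..2*pi} (\<lambda>x. of_real (Re (q x)) * cis x ^ k) / (2 * pi))"
      using q_pos qc by (intro circle_density) (auto intro!: continuous_intros simp: complex_nonneg_Reals_iff)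
    then show ?thesis unfolding qR int_l by (simp add: N_def)
  qed
  then obtain \<mu> where \<mu>: "\<And>n. circle_prob (\<mu> n)" "\<And>n l. mom (\<mu> n) l = of_nat (Suc n - l) / of_nat (Suc n) * m l"
    by metis
  have "(\<lambda>n. of_nat (Suc n - l) / of_nat (Suc n) * m l) \<longlonglongrightarrow> 1 * m l" for l
  proof (intro tendsto_mult tendsto_const)
    have "(\<lambda>n. complex_of_real (1 - real l * inverse (real (Suc n)))) \<longlonglongrightarrow> of_real (1 - real l * 0)"
      by (intro tendsto_intros LIMSEQ_inverse_real_of_nat)
    moreover have "\<forall>\<^sub>F n in sequentially. complex_of_real (1 - real l * inverse (real (Suc n))) =
        of_nat (Suc n - l) / of_nat (Suc n)"
      using eventually_ge_at_top[of l]
    proof eventually_elim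
      case (elim n)
      have "of_nat (Suc n) \<noteq> (0 :: complex)" by (simp del: of_nat_Suc)
      then show ?case
        using elim by (simp add: of_nat_diff field_simps del: of_nat_Suc)
    qed
    ultimately show "(\<lambda>n. of_nat (Suc n - l) / of_nat (Suc n)) \<longlonglongrightarrow> (1 :: complex)"
      using Lim_transform_eventually by fastforce
  qed
  then have "(\<lambda>n. mom (\<mu> n) l) \<longlonglongrightarrow> m l" for l by (simp only: \<mu>(2) mult_1)
  then show ?thesis by (rule moment_limit[OF \<mu>(1)])
qed

context star_prob_space
begin

lemma smult_add_right: "x \<in> carrier A \<Longrightarrow> y \<in> carrier A \<Longrightarrow> c \<odot> (x \<oplus> y) = c \<odot> x \<oplus> c \<odot> y"
  by (rule smult_r_distr) (simp_all add: ring_of_type_algebra_def)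

lemma star_one: "star A \<one> = \<one>"
proof -
  have "star A \<one> = star A \<one> \<otimes> star A (star A \<one>)"
    by (simp add: star_mult[symmetric] star_closed star_star)
  also have "\<dots> = \<one>" by (metis star_mult star_star star_closed one_closed r_one)
  finally show ?thesis .
qed

lemma state_zero: "\<phi> \<zero> = 0"
  using state_add[of \<zero> \<zero>] by simp

text \<open>
  The value of \<open>\<phi>\<close> at \<open>star A y \<otimes> y\<close> is real for \<open>y = x \<oplus> c \<odot> \<one>\<close>; comparing \<open>c = 1\<close> with
  \<open>c = \<i>\<close> gives both components.
\<close>

lemma state_star:
  assumes x: "x \<in> carrier A"
  shows "\<phi> (star A x) = cnj (\<phi> x)"
proof -
  have "Im (c * \<phi> (star A x) + cnj c * \<phi> x) = 0" for c
  proof -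
    let ?y = "x \<oplus> c \<odot> \<one>"
    have y: "?y \<in> carrier A" using x by auto
    have "star A ?y \<otimes> ?y = (star A x \<otimes> x \<oplus> c \<odot> star A x) \<oplus> (cnj c \<odot> x \<oplus> (cnj c * c) \<odot> \<one>)"
      using x by (simp add: star_add star_smult star_one star_closed l_distr r_distr smult_mult_left smult_mult_right smult_smult smult_add_right)
        (simp add: a_ac star_closed mult.commute)
    then have "\<phi> (star A ?y \<otimes> ?y) = \<phi> (star A x \<otimes> x) + c * \<phi> (star A x) + (cnj c * \<phi> x + cnj c * c)"
      using x by (simp add: state_add state_smult state_one star_closed)
    then show ?thesis
      using state_pos[OF y] state_pos[OF x] by (auto simp: complex_nonneg_Reals_iff)
  qed
  from this[of 1] this[of \<i>] show ?thesis by (auto simp: complex_eq_iff)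
qed

lemma state_quadratic_pos:
  assumes x: "\<And>j :: nat. x j \<in> carrier A"
  shows "(\<Sum>j<N. \<Sum>k<N. cnj (c j) * c k * \<phi> (star A (x j) \<otimes> x k)) \<in> \<real>\<^sub>\<ge>\<^sub>0"
proof -
  have "\<exists>a\<in>carrier A. (\<forall>b\<in>carrier A. \<phi> (star A a \<otimes> b) = (\<Sum>j<N. cnj (c j) * \<phi> (star A (x j) \<otimes> b)) \<and>
     \<phi> (b \<otimes> a) = (\<Sum>j<N. c j * \<phi> (b \<otimes> x j)))"
  proof (induction N)
    case 0
    have "star A \<zero> = 0 \<odot> star A \<one>"
      using star_smult[of \<one> 0] smult_l_null[of \<one>] by (simp add: ring_of_type_algebra_def)
    then have "\<phi> (star A \<zero> \<otimes> b) = 0" if "b \<in> carrier A" for b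
      using that by (simp add: smult_mult_left star_closed state_smult)
    then show ?case by (intro bexI[of _ \<zero>]) (auto simp: state_zero)
  next
    case (Suc N)
    then obtain a where a: "a \<in> carrier A"
      "\<And>b. b \<in> carrier A \<Longrightarrow> \<phi> (star A a \<otimes> b) = (\<Sum>j<N. cnj (c j) * \<phi> (star A (x j) \<otimes> b))"
      "\<And>b. b \<in> carrier A \<Longrightarrow> \<phi> (b \<otimes> a) = (\<Sum>j<N. c j * \<phi> (b \<otimes> x j))" by blast
    show ?case
      by (rule bexI[of _ "a \<oplus> c N \<odot> x N"])
        (auto simp: a x star_add star_smult star_closed l_distr r_distr state_add smult_mult_left smult_mult_right state_smult)
  qed
  then obtain a where a: "a \<in> carrier A"
      "\<And>b. b \<in> carrier A \<Longrightarrow> \<phi> (star A a \<otimes> b) = (\<Sum>j<N. cnj (c j) * \<phi> (star A (x j) \<otimes> b))"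
      "\<And>b. b \<in> carrier A \<Longrightarrow> \<phi> (b \<otimes> a) = (\<Sum>j<N. c j * \<phi> (b \<otimes> x j))" by blast
  have "\<phi> (star A a \<otimes> a) = (\<Sum>j<N. \<Sum>k<N. cnj (c j) * c k * \<phi> (star A (x j) \<otimes> x k))"
    using a x by (simp add: star_closed sum_distrib_left mult.assoc) (subst sum.swap, simp add: mult.left_commute)
  then show ?thesis using state_pos[OF a(1)] by simp
qed

lemma star_pow: "x \<in> carrier A \<Longrightarrow> star A (x [^] (n :: nat)) = star A x [^] n"
proof (induction n)
  case (Suc n)
  then show ?case
    using star_closed[of x] nat_pow_Suc2[of "star A x" n] by (simp add: star_mult)
qed (simp add: star_one)

lemma unitary_pow_cancel:
  assumes w: "w \<in> carrier A" "w' \<in> carrier A" "w' \<otimes> w = \<one>"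
  shows "w' [^] (j :: nat) \<otimes> w [^] (j + k) = w [^] k"
proof (induction j)
  case 0 show ?case using w by simp
next
  case (Suc j)
  have "w' [^] Suc j \<otimes> w [^] (Suc j + k) = w' [^] j \<otimes> ((w' \<otimes> w) \<otimes> w [^] (j + k))"
    using w(1,2) nat_pow_Suc2[of w "j + k"] by (simp add: m_assoc del: nat_pow_Suc; simp add: m_assoc)
  then show ?case using Suc w by simp
qed

text \<open>
  The powers of a unitary are a positive definite sequence under the state, hence the moments of
  a measure.
\<close>

theorem unitary_has_distr:
  assumes u: "unitary_elem A w"
  shows "\<exists>\<rho>. has_circle_distr A \<phi> w \<rho>"
proof -
  have w: "w \<in> carrier A" "star A w \<otimes> w = \<one>" "w \<otimes> star A w = \<one>" using u by (auto simp: unitary_elem_def)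
  note sc = star_closed[OF w(1)]
  have "\<exists>\<mu>. circle_prob \<mu> \<and> (\<forall>k. mom \<mu> k = \<phi> (w [^] k))"
  proof (rule trigonometric_moment_problem)
    show "\<phi> (star A (w [^] j) \<otimes> w [^] (j + k)) = \<phi> (w [^] k)" for j k :: nat
      using unitary_pow_cancel[OF w(1) sc w(2)] by (simp add: star_pow w)
    show "\<phi> (w [^] (0::nat)) = 1" by (simp add: state_one)
    show "(\<Sum>j<N. \<Sum>k<N. cnj (c j) * c k * \<phi> (star A (w [^] j) \<otimes> w [^] k)) \<in> \<real>\<^sub>\<ge>\<^sub>0" for N :: nat and c
      by (rule state_quadratic_pos) (simp add: w)
  qed
  then obtain \<mu> where \<mu>: "circle_prob \<mu>" "\<And>k. mom \<mu> k = \<phi> (w [^] k)" by blast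
  have "\<phi> (w [^] m \<otimes> star A w [^] n) = (LINT t|\<mu>. t ^ m * cnj t ^ n)" for m n :: nat
  proof -
    have comm: "w [^] m \<otimes> star A w [^] n = star A w [^] n \<otimes> w [^] m"
    proof -
      have "w \<otimes> star A w [^] n = star A w [^] n \<otimes> w" for n :: nat
      proof (induction n)
        case (Suc n)
        have "w \<otimes> star A w [^] Suc n = (w \<otimes> star A w [^] n) \<otimes> star A w"
          using w(1) sc by (simp add: m_assoc)
        also have "\<dots> = star A w [^] n \<otimes> (w \<otimes> star A w)"
          using w(1) sc by (simp add: Suc m_assoc)
        also have "\<dots> = star A w [^] Suc n \<otimes> w"
          using w sc by (simp add: m_assoc)
        finally show ?case .
      qed (simp add: w)
      note 1 = this
      show ?thesis
      proof (induction m)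
        case (Suc m)
        have "w [^] Suc m \<otimes> star A w [^] n = w [^] m \<otimes> (star A w [^] n \<otimes> w)"
          using w(1) sc by (simp add: m_assoc 1)
        also have "\<dots> = star A w [^] n \<otimes> w [^] Suc m"
          using w(1) sc by (simp add: m_assoc[symmetric] Suc)
        finally show ?case .
      qed (use w(1) sc in simp)
    qed
    have "\<phi> (star A w [^] n \<otimes> w [^] m) = (if n \<le> m then \<phi> (w [^] (m - n)) else cnj (\<phi> (w [^] (n - m))))"
    proof (cases "n \<le> m")
      case True
      then show ?thesis using unitary_pow_cancel[OF w(1) sc w(2), of n "m - n"] by simp
    next
      case False
      have "\<phi> (star A w [^] n \<otimes> w [^] m) = \<phi> (star A (star A (w [^] m) \<otimes> w [^] n))"
        using w(1) sc by (simp add: star_mult star_star star_closed star_pow)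
      also have "\<dots> = cnj (\<phi> (star A w [^] m \<otimes> w [^] n))"
        using w(1) sc by (simp add: state_star star_pow)
      finally show ?thesis using False unitary_pow_cancel[OF w(1) sc w(2), of m "n - m"] by simp
    qed
    then show ?thesis
      unfolding comm mom_monom[OF circle_prob_measure[OF \<mu>(1)]] by (simp add: \<mu>(2))
  qed
  then show ?thesis using \<mu>(1) unfolding has_circle_distr_def by blast
qed

lemma unitary_mult: "unitary_elem A u \<Longrightarrow> unitary_elem A v \<Longrightarrow> unitary_elem A (u \<otimes> v)"
  unfolding unitary_elem_def
proof (elim conjE, intro conjI)
  assume u: "u \<in> carrier A" "star A u \<otimes> u = \<one>" "u \<otimes> star A u = \<one>"
    and v: "v \<in> carrier A" "star A v \<otimes> v = \<one>" "v \<otimes> star A v = \<one>"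
  note s = star_closed[OF u(1)] star_closed[OF v(1)]
  show "u \<otimes> v \<in> carrier A" using u v by simp
  have "star A (u \<otimes> v) \<otimes> (u \<otimes> v) = star A v \<otimes> ((star A u \<otimes> u) \<otimes> v)"
    using u(1) v(1) s by (simp add: star_mult m_assoc)
  then show "star A (u \<otimes> v) \<otimes> (u \<otimes> v) = \<one>" using u v by simp
  have "(u \<otimes> v) \<otimes> star A (u \<otimes> v) = u \<otimes> ((v \<otimes> star A v) \<otimes> star A u)"
    using u(1) v(1) s by (simp add: star_mult m_assoc)
  then show "(u \<otimes> v) \<otimes> star A (u \<otimes> v) = \<one>" using u v s by simp
qed

end

section \<open>Coefficientwise limits\<close>

text \<open>
  Coefficientwise convergence. It replaces locally uniform convergence of the
  transforms near \<open>0\<close>.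
\<close>

definition ctends :: "(nat \<Rightarrow> complex fps) \<Rightarrow> complex fps \<Rightarrow> bool" where
  "ctends F G \<longleftrightarrow> (\<forall>k. (\<lambda>n. F n $ k) \<longlonglongrightarrow> G $ k)"

lemma ctends_const: "ctends (\<lambda>_. F) F"
  by (simp add: ctends_def)

lemma ctends_cong: "\<forall>\<^sub>F n in sequentially. F n = F' n \<Longrightarrow> ctends F G \<longleftrightarrow> ctends F' G"
  unfolding ctends_def by (intro iff_allI tendsto_cong) (auto elim: eventually_mono)

lemma ctends_mult: "ctends F G \<Longrightarrow> ctends F' G' \<Longrightarrow> ctends (\<lambda>n. F n * F' n) (G * G')"
  unfolding ctends_def fps_mult_nth by (auto intro!: tendsto_intros)

lemma ctends_power: "ctends F G \<Longrightarrow> ctends (\<lambda>n. F n ^ i) (G ^ i)"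
  by (induction i) (auto intro: ctends_const ctends_mult)

lemma ctends_compose:
  assumes "ctends F G" "ctends F' G'"
  shows "ctends (\<lambda>n. F n oo F' n) (G oo G')"
  using assms(1) ctends_power[OF assms(2)]
  unfolding ctends_def fps_compose_nth by (auto intro!: tendsto_intros)

text \<open>
  The coefficients of the compositional inverse are obtained recursively, with the linear
  coefficient as the only denominator.
\<close>

lemma ctends_inv:
  assumes F: "ctends F G" and 1: "G $ 1 \<noteq> 0"
  shows "ctends (\<lambda>n. fps_inv (F n)) (fps_inv G)"
proof -
  have "(\<lambda>n. compinv (F n) k) \<longlonglongrightarrow> compinv G k" for k
  proof (induction k rule: less_induct)
    case (less k)
    show ?case
    proof (cases k)
      case (Suc j)
      show ?thesis unfolding Suc compinv.simps
        using less.IH ctends_power[OF F] F 1 unfolding Suc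
        by (intro tendsto_intros) (auto simp: ctends_def)
    qed simp
  qed
  then show ?thesis by (simp add: ctends_def fps_inv_def)
qed

section \<open>The transforms as formal power series\<close>

definition psi_fps :: "complex measure \<Rightarrow> complex fps" where
  "psi_fps \<mu> = Abs_fps (\<lambda>k. if k = 0 then 0 else mom \<mu> k)"

definition geo_fps :: "complex fps" where
  "geo_fps = Abs_fps (\<lambda>k. if k = 0 then 0 else 1)"

text \<open>
  For \<open>w = z / (1 - z)\<close> the factor \<open>(1 + w) / w\<close> in the S-transform is \<open>1 / z\<close>, so that
  \<open>z \<Sigma>(z) = \<psi>\<^sup>-\<^sup>1 (z / (1 - z))\<close>.
\<close>

definition Sigma_fps :: "complex measure \<Rightarrow> complex fps" where
  "Sigma_fps \<mu> = fps_shift 1 (fps_inv (psi_fps \<mu>) oo geo_fps)"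

lemma psi_fps_0: "psi_fps \<mu> $ 0 = 0" and psi_fps_1: "psi_fps \<mu> $ Suc 0 = mom \<mu> 1"
  by (simp_all add: psi_fps_def)

lemma geo_fps_nth: "geo_fps $ 0 = 0" "geo_fps $ Suc 0 = 1"
  by (simp_all add: geo_fps_def)

lemma geo_fps_eq: "geo_fps = fps_X * (1 + geo_fps)"
  by (rule fps_ext) (auto simp: geo_fps_def fps_X_mult_nth)

lemma geo_fps_inverse: "1 + geo_fps = inverse (1 - fps_X)"
proof -
  have "(1 - fps_X) * (1 + geo_fps) = 1"
    using geo_fps_eq by (simp add: algebra_simps)
  then show ?thesis by (metis fps_inverse_unique)
qed

lemma circle_prob_nzD: "\<mu> \<in> circle_prob_nz \<Longrightarrow> circle_prob \<mu>" "\<mu> \<in> circle_prob_nz \<Longrightarrow> mom \<mu> 1 \<noteq> 0"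
  by (auto simp: circle_prob_nz_def mom_def)

lemma circle_prob_nzI: "circle_prob \<mu> \<Longrightarrow> mom \<mu> 1 \<noteq> 0 \<Longrightarrow> \<mu> \<in> circle_prob_nz"
  by (auto simp: circle_prob_nz_def mom_def)

lemma mom_0: "circle_prob \<mu> \<Longrightarrow> mom \<mu> 0 = 1"
  by (simp add: mom_def circle_prob_def prob_space.prob_space)

lemma psi_fps_inv:
  assumes "mom \<mu> 1 \<noteq> 0"
  shows "psi_fps \<mu> oo fps_inv (psi_fps \<mu>) = fps_X" "fps_inv (psi_fps \<mu>) oo psi_fps \<mu> = fps_X"
    "fps_inv (psi_fps \<mu>) $ 0 = 0"
  using assms fps_inv_right[of "psi_fps \<mu>"] fps_inv[of "psi_fps \<mu>"]
  by (simp_all add: psi_fps_0 psi_fps_1) (simp add: fps_inv_def)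

lemma X_Sigma_fps:
  assumes "mom \<mu> 1 \<noteq> 0"
  shows "fps_X * Sigma_fps \<mu> = fps_inv (psi_fps \<mu>) oo geo_fps"
proof -
  have "(fps_inv (psi_fps \<mu>) oo geo_fps) $ 0 = 0"
    using psi_fps_inv(3)[OF assms] by simp
  then show ?thesis
    unfolding Sigma_fps_def by (intro fps_ext) (auto simp: fps_X_mult_nth)
qed

lemma psi_fps_X_Sigma:
  assumes "mom \<mu> 1 \<noteq> 0"
  shows "psi_fps \<mu> oo (fps_X * Sigma_fps \<mu>) = geo_fps"
  unfolding X_Sigma_fps[OF assms]
  by (subst fps_compose_assoc) (simp_all add: psi_fps_inv[OF assms] geo_fps_nth fps_X_fps_compose_startby0)

lemma Sigma_fps_unique:
  assumes "mom \<mu> 1 \<noteq> 0" "psi_fps \<mu> oo (fps_X * S) = geo_fps"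
  shows "Sigma_fps \<mu> = S"
proof -
  have "fps_X * Sigma_fps \<mu> = fps_inv (psi_fps \<mu>) oo (psi_fps \<mu> oo (fps_X * S))"
    unfolding X_Sigma_fps[OF assms(1)] assms(2) ..
  also have "\<dots> = fps_X * S"
    by (subst fps_compose_assoc) (simp_all add: psi_fps_inv[OF assms(1)] psi_fps_0 fps_X_fps_compose_startby0)
  finally show ?thesis by simp
qed

lemma psi_fps_eq_Sigma:
  assumes "mom \<mu> 1 \<noteq> 0"
  shows "psi_fps \<mu> = fps_inv ((fps_X * Sigma_fps \<mu>) oo fps_inv geo_fps)"
proof -
  have g: "geo_fps oo fps_inv geo_fps = fps_X" "fps_inv geo_fps $ 0 = 0"
    using fps_inv_right[of geo_fps] by (simp_all add: geo_fps_nth) (simp add: fps_inv_def)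
  have "(fps_X * Sigma_fps \<mu>) oo fps_inv geo_fps = fps_inv (psi_fps \<mu>)"
    unfolding X_Sigma_fps[OF assms]
    by (subst fps_compose_assoc[symmetric]) (simp_all add: g geo_fps_nth)
  then show ?thesis
    using fps_inv_idempotent[of "psi_fps \<mu>"] assms by (simp add: psi_fps_0 psi_fps_1)
qed

lemma Sigma_fps_nth_0:
  assumes "mom \<mu> 1 \<noteq> 0"
  shows "mom \<mu> 1 * Sigma_fps \<mu> $ 0 = 1"
proof -
  have "(psi_fps \<mu> oo (fps_X * Sigma_fps \<mu>)) $ 1 = 1"
    unfolding psi_fps_X_Sigma[OF assms] by (simp add: geo_fps_nth)
  then show ?thesis by (simp add: fps_compose_nth psi_fps_0 psi_fps_1 fps_X_mult_nth)
qed

lemma circle_prob_nz_eqI: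
  assumes \<mu>: "\<mu> \<in> circle_prob_nz" and \<nu>: "\<nu> \<in> circle_prob_nz" and eq: "Sigma_fps \<mu> = Sigma_fps \<nu>"
  shows "\<mu> = \<nu>"
proof (rule circle_prob_eqI)
  fix k
  have "psi_fps \<mu> = psi_fps \<nu>"
    using psi_fps_eq_Sigma circle_prob_nzD(2)[OF \<mu>] circle_prob_nzD(2)[OF \<nu>] eq by metis
  then have "psi_fps \<mu> $ k = psi_fps \<nu> $ k" by simp
  then show "mom \<mu> k = mom \<nu> k"
    using mom_0[of \<mu>] mom_0[of \<nu>] circle_prob_nzD(1)[OF \<mu>] circle_prob_nzD(1)[OF \<nu>]
    by (cases "k = 0") (auto simp: psi_fps_def)
qed (use circle_prob_nzD \<mu> \<nu> in auto)

text \<open>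
  The moments and the coefficients of \<open>\<Sigma>\<close> determine each other through composition and
  compositional inversion, and both operations are continuous coefficientwise.
\<close>

theorem mom_tendsto_iff_Sigma:
  assumes \<mu>: "\<forall>\<^sub>F n in sequentially. \<mu> n \<in> circle_prob_nz" and \<nu>: "\<nu> \<in> circle_prob_nz"
  shows "(\<forall>k. (\<lambda>n. mom (\<mu> n) k) \<longlonglongrightarrow> mom \<nu> k) \<longleftrightarrow> ctends (\<lambda>n. Sigma_fps (\<mu> n)) (Sigma_fps \<nu>)"
proof
  assume "\<forall>k. (\<lambda>n. mom (\<mu> n) k) \<longlonglongrightarrow> mom \<nu> k"
  then have "ctends (\<lambda>n. psi_fps (\<mu> n)) (psi_fps \<nu>)"
    by (simp add: ctends_def psi_fps_def)
  then have "ctends (\<lambda>n. fps_inv (psi_fps (\<mu> n)) oo geo_fps) (fps_inv (psi_fps \<nu>) oo geo_fps)"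
    using circle_prob_nzD(2)[OF \<nu>] by (intro ctends_compose ctends_const ctends_inv) (simp_all add: psi_fps_1)
  then show "ctends (\<lambda>n. Sigma_fps (\<mu> n)) (Sigma_fps \<nu>)"
    by (simp add: ctends_def Sigma_fps_def)
next
  assume S: "ctends (\<lambda>n. Sigma_fps (\<mu> n)) (Sigma_fps \<nu>)"
  let ?f = "\<lambda>S. (fps_X * S) oo fps_inv geo_fps"
  have n1: "?f (Sigma_fps \<nu>) $ 1 \<noteq> 0"
  proof -
    have "Sigma_fps \<nu> $ 0 \<noteq> 0" using Sigma_fps_nth_0[OF circle_prob_nzD(2)[OF \<nu>]] by auto
    then show ?thesis
      by (simp add: fps_compose_nth fps_X_mult_nth fps_inv_def geo_fps_nth)
  qed
  have "ctends (\<lambda>n. fps_inv (?f (Sigma_fps (\<mu> n)))) (fps_inv (?f (Sigma_fps \<nu>)))"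
    by (intro ctends_inv ctends_compose ctends_mult ctends_const S n1)
  also have "?this \<longleftrightarrow> ctends (\<lambda>n. psi_fps (\<mu> n)) (psi_fps \<nu>)"
    unfolding psi_fps_eq_Sigma[OF circle_prob_nzD(2)[OF \<nu>]]
    by (rule ctends_cong) (use \<mu> in eventually_elim, simp only: psi_fps_eq_Sigma[OF circle_prob_nzD(2)])
  finally have psi: "(\<lambda>n. psi_fps (\<mu> n) $ k) \<longlonglongrightarrow> psi_fps \<nu> $ k" for k by (simp add: ctends_def)
  show "\<forall>k. (\<lambda>n. mom (\<mu> n) k) \<longlonglongrightarrow> mom \<nu> k"
  proof
    fix k
    show "(\<lambda>n. mom (\<mu> n) k) \<longlonglongrightarrow> mom \<nu> k"
    proof (cases "k = 0")
      case True
      have "(\<lambda>_. 1) \<longlonglongrightarrow> mom \<nu> k" using True mom_0[OF circle_prob_nzD(1)[OF \<nu>]] by simp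
      then show ?thesis
        by (rule Lim_transform_eventually) (use \<mu> in eventually_elim, simp add: True mom_0 circle_prob_nzD)
    next
      case False
      then show ?thesis using psi[of k] by (simp add: psi_fps_def)
    qed
  qed
qed

section \<open>Multiplicativity of the Sigma-transform\<close>

lemma fps_compose_1_add: "(1 + F) oo G = 1 + (F oo G)"
  by (simp add: fps_compose_add_distrib)

lemma Sigma_fps_free_product:
  fixes A :: "('a, 'm) star_algebra_scheme"
  assumes sp: "star_prob_space A \<phi>" and u: "unitary_elem A u" and v: "unitary_elem A v"
    and free: "free_elems A \<phi> u v" and \<mu>: "has_circle_distr A \<phi> u \<mu>" and \<nu>: "has_circle_distr A \<phi> v \<nu>"
    and \<rho>: "has_circle_distr A \<phi> (u \<otimes>\<^bsub>A\<^esub> v) \<rho>"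
    and \<mu>1: "mom \<mu> 1 \<noteq> 0" and \<nu>1: "mom \<nu> 1 \<noteq> 0"
  shows "\<rho> \<in> circle_prob_nz" "Sigma_fps \<rho> = Sigma_fps \<mu> * Sigma_fps \<nu>"
proof -
  interpret star_prob_space A \<phi> by fact
  have uc: "u \<in> carrier A" "v \<in> carrier A" "u \<otimes>\<^bsub>A\<^esub> v \<in> carrier A" using u v by (auto simp: unitary_elem_def)
  have mom: "Abs_fps (\<lambda>k. \<phi> (w [^]\<^bsub>A\<^esub> k)) = 1 + psi_fps N" if N: "has_circle_distr A \<phi> w N" and w: "w \<in> carrier A" for w N
  proof (rule fps_ext)
    fix k
    have "\<phi> (w [^]\<^bsub>A\<^esub> k \<otimes>\<^bsub>A\<^esub> star A w [^]\<^bsub>A\<^esub> (0 :: nat)) = (LINT t|N. t ^ k * cnj t ^ 0)"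
      using N unfolding has_circle_distr_def by blast
    then have "\<phi> (w [^]\<^bsub>A\<^esub> k) = mom N k" using w by (simp add: mom_def)
    then show "Abs_fps (\<lambda>k. \<phi> (w [^]\<^bsub>A\<^esub> k)) $ k = (1 + psi_fps N) $ k"
      using mom_0[of N] N by (auto simp: psi_fps_def has_circle_distr_def)
  qed
  define a b where "a = fps_inv (psi_fps \<mu>)" and "b = fps_inv (psi_fps \<nu>)"
  define c where "c = fps_shift 1 (a * b * (1 + fps_X))"
  have ab0: "a $ 0 = 0" "b $ 0 = 0" using psi_fps_inv(3) \<mu>1 \<nu>1 by (auto simp: a_def b_def)
  have c: "fps_X * c = a * b * (1 + fps_X)"
    unfolding c_def by (rule fps_ext) (auto simp: fps_X_mult_nth ab0)
  have ca: "Abs_fps (\<lambda>k. \<phi> (u [^]\<^bsub>A\<^esub> k)) oo a = 1 + fps_X"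
    unfolding mom[OF \<mu> uc(1)] fps_compose_1_add a_def psi_fps_inv(1)[OF \<mu>1] ..
  have cb: "Abs_fps (\<lambda>k. \<phi> (v [^]\<^bsub>A\<^esub> k)) oo b = 1 + fps_X"
    unfolding mom[OF \<nu> uc(2)] fps_compose_1_add b_def psi_fps_inv(1)[OF \<nu>1] ..
  from moment_series_mult[OF uc(1,2) free ab0(1) ca ab0(2) cb c]
  have c0: "c $ 0 = 0" and cc: "psi_fps \<rho> oo c = fps_X"
    unfolding mom[OF \<rho> uc(3)] fps_compose_1_add by simp_all
  have "(psi_fps \<rho> oo c) $ 1 = 1" unfolding cc by simp
  then have \<rho>1: "mom \<rho> 1 \<noteq> 0"
    by (auto simp: fps_compose_nth psi_fps_0 psi_fps_1)
  then show "\<rho> \<in> circle_prob_nz"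
    using \<rho> by (intro circle_prob_nzI) (auto simp: has_circle_distr_def)
  have "c = fps_inv (psi_fps \<rho>) oo (psi_fps \<rho> oo c)"
    by (subst fps_compose_assoc) (simp_all add: c0 psi_fps_0 psi_fps_inv[OF \<rho>1] fps_X_fps_compose_startby0)
  then have c_eq: "c = fps_inv (psi_fps \<rho>)" by (simp add: cc)
  have "geo_fps * (fps_X * Sigma_fps \<rho>) = (fps_X * c) oo geo_fps"
    unfolding X_Sigma_fps[OF \<rho>1] c_eq
    by (subst fps_compose_mult_distrib) (simp_all add: geo_fps_nth fps_X_fps_compose_startby0)
  also have "\<dots> = (fps_X * Sigma_fps \<mu>) * (fps_X * Sigma_fps \<nu>) * (1 + geo_fps)"
    unfolding c X_Sigma_fps[OF \<mu>1] X_Sigma_fps[OF \<nu>1] a_def b_def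
    by (simp add: fps_compose_mult_distrib geo_fps_nth fps_compose_1_add fps_X_fps_compose_startby0)
  also have "\<dots> = (fps_X * (1 + geo_fps)) * (fps_X * (Sigma_fps \<mu> * Sigma_fps \<nu>))"
    by (simp only: mult_ac)
  also have "\<dots> = geo_fps * (fps_X * (Sigma_fps \<mu> * Sigma_fps \<nu>))"
    by (simp only: geo_fps_eq[symmetric])
  finally have "geo_fps * (fps_X * Sigma_fps \<rho>) = geo_fps * (fps_X * (Sigma_fps \<mu> * Sigma_fps \<nu>))" .
  moreover have "geo_fps \<noteq> 0"
    using geo_fps_nth(2) by auto
  ultimately show "Sigma_fps \<rho> = Sigma_fps \<mu> * Sigma_fps \<nu>" by simp
qed

text \<open>
  Existence combines a free pair with the distribution of its product. The measure is unique, since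
  multiplicativity determines its Sigma-series and the Sigma-series determines a measure.
\<close>

theorem free_mult_conv:
  assumes \<mu>: "\<mu> \<in> circle_prob_nz" and \<nu>: "\<nu> \<in> circle_prob_nz"
  shows "\<mu> \<boxtimes> \<nu> \<in> circle_prob_nz" "Sigma_fps (\<mu> \<boxtimes> \<nu>) = Sigma_fps \<mu> * Sigma_fps \<nu>"
proof -
  let ?P = "\<lambda>\<rho>. \<exists>(A :: ((nat \<Rightarrow> complex) \<Rightarrow> (nat \<Rightarrow> complex)) star_algebra) \<phi> u v.
       star_prob_space A \<phi> \<and> unitary_elem A u \<and> unitary_elem A v \<and> free_elems A \<phi> u v \<and>
       has_circle_distr A \<phi> u \<mu> \<and> has_circle_distr A \<phi> v \<nu> \<and>
       has_circle_distr A \<phi> (u \<otimes>\<^bsub>A\<^esub> v) \<rho>"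
  have *: "\<rho> \<in> circle_prob_nz \<and> Sigma_fps \<rho> = Sigma_fps \<mu> * Sigma_fps \<nu>" if "?P \<rho>" for \<rho>
  proof -
    from that obtain A :: "((nat \<Rightarrow> complex) \<Rightarrow> (nat \<Rightarrow> complex)) star_algebra" and \<phi> u v where
      A: "star_prob_space A \<phi>" "unitary_elem A u" "unitary_elem A v" "free_elems A \<phi> u v"
       "has_circle_distr A \<phi> u \<mu>" "has_circle_distr A \<phi> v \<nu>" "has_circle_distr A \<phi> (u \<otimes>\<^bsub>A\<^esub> v) \<rho>"
      by (elim exE conjE)
    from Sigma_fps_free_product[OF A circle_prob_nzD(2)[OF \<mu>] circle_prob_nzD(2)[OF \<nu>]]
    show ?thesis by (rule conjI)
  qed
  obtain A :: "((nat \<Rightarrow> complex) \<Rightarrow> (nat \<Rightarrow> complex)) star_algebra" and \<phi> u v where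
    A: "star_prob_space A \<phi>" "unitary_elem A u" "unitary_elem A v" "free_elems A \<phi> u v"
     "has_circle_distr A \<phi> u \<mu>" "has_circle_distr A \<phi> v \<nu>"
    using free_unitaries_exist[OF circle_prob_nzD(1)[OF \<mu>] circle_prob_nzD(1)[OF \<nu>]] by blast
  interpret star_prob_space A \<phi> by fact
  obtain \<rho> where "has_circle_distr A \<phi> (u \<otimes>\<^bsub>A\<^esub> v) \<rho>"
    using unitary_has_distr[OF unitary_mult[OF A(2,3)]] by (elim exE)
  then have \<rho>: "?P \<rho>"
    using A by (intro exI[of _ A] exI[of _ \<phi>] exI[of _ u] exI[of _ v] conjI)
  have "?P (\<mu> \<boxtimes> \<nu>)"
    unfolding free_mult_conv_def
  proof (rule theI[of ?P, OF \<rho>])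
    fix x assume "?P x"
    from *[OF this] *[OF \<rho>] show "x = \<rho>" by (intro circle_prob_nz_eqI) auto
  qed
  from *[OF this] show "\<mu> \<boxtimes> \<nu> \<in> circle_prob_nz" "Sigma_fps (\<mu> \<boxtimes> \<nu>) = Sigma_fps \<mu> * Sigma_fps \<nu>" by auto
qed

lemma rotate_Sigma:
  assumes 1: "mom \<mu> 1 \<noteq> 0" and c: "c \<noteq> 0" and mom: "\<And>k. mom \<nu> k = c ^ k * mom \<mu> k"
  shows "Sigma_fps \<nu> = fps_const (1 / c) * Sigma_fps \<mu>"
proof (rule Sigma_fps_unique)
  show "mom \<nu> 1 \<noteq> 0" using 1 c by (simp add: mom)
  have "psi_fps \<nu> = psi_fps \<mu> oo (fps_const c * fps_X)"
    by (rule fps_ext) (simp add: fps_compose_linear psi_fps_def mom)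
  then have "psi_fps \<nu> oo (fps_X * (fps_const (1 / c) * Sigma_fps \<mu>)) =
     psi_fps \<mu> oo ((fps_const c * fps_X) oo (fps_X * (fps_const (1 / c) * Sigma_fps \<mu>)))"
    by (simp add: fps_compose_assoc)
  also have "(fps_const c * fps_X) oo (fps_X * (fps_const (1 / c) * Sigma_fps \<mu>)) = fps_X * Sigma_fps \<mu>"
    using c by (simp add: fps_compose_mult_distrib fps_X_fps_compose_startby0 mult.left_commute mult.assoc[symmetric])
  finally show "psi_fps \<nu> oo (fps_X * (fps_const (1 / c) * Sigma_fps \<mu>)) = geo_fps"
    by (simp add: psi_fps_X_Sigma[OF 1])
qed

lemma return_Sigma:
  assumes l: "l \<in> circle"
  shows "return circle_borel l \<in> circle_prob_nz" "Sigma_fps (return circle_borel l) = fps_const (1 / l)"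
proof -
  have l0: "l \<noteq> 0" using l by auto
  have sp: "l \<in> space circle_borel" using l by (simp add: space_restrict_space)
  have m: "(\<lambda>t. t ^ k :: complex) \<in> borel_measurable circle_borel" for k
    by (rule measurable_restrict_space1) simp
  have mom: "mom (return circle_borel l) k = l ^ k" for k
    unfolding mom_def by (rule integral_return[OF sp m])
  show nz: "return circle_borel l \<in> circle_prob_nz"
    using l0 by (intro circle_prob_nzI) (auto simp: circle_prob_def mom prob_space_return[OF sp])
  show "Sigma_fps (return circle_borel l) = fps_const (1 / l)"
  proof (rule Sigma_fps_unique)
    have "psi_fps (return circle_borel l) oo (fps_const (1 / l) * fps_X) = geo_fps"
      using l0 by (intro fps_ext) (simp add: fps_compose_linear psi_fps_def geo_fps_def mom power_divide)
    then show "psi_fps (return circle_borel l) oo (fps_X * fps_const (1 / l)) = geo_fps"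
      by (simp add: mult.commute)
  qed (simp add: mom l0)
qed

section \<open>Coefficientwise estimates\<close>

text \<open>
  Coefficientwise order of magnitude, restricted to the first \<open>N\<close> coefficients: the estimates below
  are proved for one coefficient after the other.
\<close>

definition cO_upto :: "nat \<Rightarrow> 'm filter \<Rightarrow> ('m \<Rightarrow> complex fps) \<Rightarrow> ('m \<Rightarrow> complex) \<Rightarrow> bool" where
  "cO_upto N F f g \<longleftrightarrow> (\<forall>k<N. (\<lambda>m. f m $ k) \<in> O[F](g))"

definition cO :: "'m filter \<Rightarrow> ('m \<Rightarrow> complex fps) \<Rightarrow> ('m \<Rightarrow> complex) \<Rightarrow> bool" where
  "cO F f g \<longleftrightarrow> (\<forall>k. (\<lambda>m. f m $ k) \<in> O[F](g))"

lemma cO_iff_upto: "cO F f g \<longleftrightarrow> (\<forall>N. cO_upto N F f g)"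
  by (auto simp: cO_def cO_upto_def)

lemma cO_upto_add: "cO_upto N F f g \<Longrightarrow> cO_upto N F f' g \<Longrightarrow> cO_upto N F (\<lambda>m. f m + f' m) g"
  unfolding cO_upto_def by (auto intro: sum_in_bigo)

lemma cO_upto_diff: "cO_upto N F f g \<Longrightarrow> cO_upto N F f' g \<Longrightarrow> cO_upto N F (\<lambda>m. f m - f' m) g"
  unfolding cO_upto_def by (auto intro: sum_in_bigo)

lemma cO_upto_mult:
  assumes "cO_upto N F f g" "cO_upto N F f' g'"
  shows "cO_upto N F (\<lambda>m. f m * f' m) (\<lambda>m. g m * g' m)"
  using assms unfolding cO_upto_def fps_mult_nth by (auto intro!: big_sum_in_bigo landau_o.big_mult)

lemma cO_upto_const: "cO_upto N F (\<lambda>_. f) (\<lambda>_. 1)"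
  by (simp add: cO_upto_def)

lemma cO_upto_X: "cO_upto N F f g \<Longrightarrow> cO_upto (Suc N) F (\<lambda>m. fps_X * f m) g"
  by (auto simp: cO_upto_def fps_X_mult_nth less_Suc_eq_0_disj)

lemma cO_upto_mono: "cO_upto N F f g \<Longrightarrow> g \<in> O[F](g') \<Longrightarrow> cO_upto N F f g'"
  by (auto simp: cO_upto_def intro: landau_o.big_trans)

lemma cO_upto_le: "cO_upto N F f g \<Longrightarrow> M \<le> N \<Longrightarrow> cO_upto M F f g"
  by (auto simp: cO_upto_def)

lemma cO_upto_power: "cO_upto N F f (\<lambda>_. 1) \<Longrightarrow> cO_upto N F (\<lambda>m. f m ^ i) (\<lambda>_. 1)"
  using cO_upto_mult[of N F f "\<lambda>_. 1" _ "\<lambda>_. 1"]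
  by (induction i) (auto intro: cO_upto_const[of N F 1])

lemma cO_upto_compose:
  assumes f: "cO_upto N F f g" and f': "cO_upto N F f' (\<lambda>_. 1)"
  shows "cO_upto N F (\<lambda>m. f m oo f' m) g"
  unfolding cO_upto_def fps_compose_nth
proof (intro allI impI big_sum_in_bigo)
  fix k i assume "k < N" "i \<in> {0..k}"
  then have "(\<lambda>m. f m $ i * (f' m ^ i) $ k) \<in> O[F](\<lambda>m. g m * 1)"
    using f cO_upto_power[OF f', of i] by (intro landau_o.big_mult) (auto simp: cO_upto_def)
  then show "(\<lambda>m. f m $ i * f' m ^ i $ k) \<in> O[F](g)" by simp
qed

lemma solve_linear: "x = d - (c + x * y) \<Longrightarrow> (1 + y) * x = d - (c :: complex)"
proof -
  assume "x = d - (c + x * y)"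
  then have "x + x * y = d - (c + x * y) + x * y" by (rule arg_cong)
  also have "\<dots> = d - c" by simp
  finally show ?thesis by (simp only: distrib_right mult_1_left mult.commute[of y x])
qed

text \<open>
  With \<open>s = S - 1\<close> the functional equation becomes \<open>s = X s + (1 - X) h\<close> up to terms that are
  quadratic in \<open>s\<close> and \<open>h\<close>. A coefficient of \<open>s\<close> enters its own equation only with a factor \<open>o(1)\<close>,
  so all coefficients of \<open>s\<close> are \<open>O(\<delta>)\<close> inductively; then \<open>s - h\<close> is \<open>O(\<delta>\<^sup>2)\<close>, and the logarithmic
  derivative \<open>L\<close> of \<open>S = 1 + s\<close> agrees with the derivative of \<open>h\<close> to the same order.
\<close>

lemma Sigma_linearization:
  fixes S h L :: "'m \<Rightarrow> complex fps" and \<delta> :: "'m \<Rightarrow> real"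
  assumes \<delta>: "(\<delta> \<longlongrightarrow> 0) F" and h: "cO F h (\<lambda>m. of_real (\<delta> m))"
    and eq: "\<And>m. (1 - fps_X * S m) * (S m - 1) = S m * (h m oo (fps_X * S m)) * (1 - fps_X)"
    and L: "\<And>m. L m * S m = fps_deriv (S m)"
  shows "cO F (\<lambda>m. L m - fps_deriv (h m)) (\<lambda>m. of_real (\<delta> m) * of_real (\<delta> m))"
proof -
  define d where "d m = complex_of_real (\<delta> m)" for m
  define s where "s m = S m - 1" for m
  define q where "q m = (1 - fps_X) * (h m oo (fps_X * S m))" for m
  have d0: "(d \<longlongrightarrow> 0) F" unfolding d_def using tendsto_of_real[OF \<delta>] by simp
  then have d1: "d \<in> O[F](\<lambda>_. 1)"
    by (intro bigoI_tendsto[where c = 0]) auto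
  have S: "S m = 1 + s m" for m by (simp add: s_def)
  have eq': "s m = fps_X * (S m * s m) + q m + s m * q m" for m
    using eq[of m] unfolding q_def s_def by (simp add: algebra_simps)
  have hd: "cO_upto N F h d" for N using h by (simp add: cO_iff_upto d_def[abs_def])
  have S1: "cO_upto N F S (\<lambda>_. 1)" if "cO_upto N F s d" for N
    unfolding S using cO_upto_add[OF cO_upto_const[of N F 1] cO_upto_mono[OF that d1]] by simp
  have qd: "cO_upto (Suc N) F q d" if "cO_upto N F s d" for N
    unfolding q_def
    using cO_upto_mult[OF cO_upto_const[of "Suc N" F "1 - fps_X"] cO_upto_compose[OF hd cO_upto_X[OF S1[OF that]]]]
    by simp
  \<comment> \<open>A coefficient of size 1 + o(1) can be divided out.\<close>
  have divide: "f \<in> O[F](g)" if r: "r \<in> O[F](d)" and fg: "(\<lambda>m. (1 + r m) * f m) \<in> O[F](g)" for f g r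
  proof -
    have "r \<in> o[F](\<lambda>_. 1)"
    proof (rule landau_o.big_small_trans[OF r])
      show "d \<in> o[F](\<lambda>_. 1)" by (rule smalloI_tendsto) (use d0 in auto)
    qed
    then have "\<forall>\<^sub>F m in F. norm (r m) \<le> (1/2) * norm (1 :: complex)"
      by (rule landau_o.smallD) simp
    then have "\<forall>\<^sub>F m in F. norm (f m) \<le> 2 * norm ((1 + r m) * f m)"
    proof eventually_elim
      case (elim m)
      have "1 - norm (r m) \<le> norm (1 + r m)"
        using norm_triangle_ineq2[of 1 "- r m"] by simp
      then have "1 / 2 \<le> norm (1 + r m)" using elim by simp
      then have "1 / 2 * norm (f m) \<le> norm (1 + r m) * norm (f m)" by (intro mult_right_mono) auto
      then show ?case by (simp add: norm_mult)
    qed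
    then have "f \<in> O[F](\<lambda>m. (1 + r m) * f m)" by (rule bigoI)
    then show ?thesis using fg by (rule landau_o.big_trans)
  qed
  have sd: "cO_upto N F s d" for N
  proof (induction N)
    case 0 show ?case by (simp add: cO_upto_def)
  next
    case (Suc N)
    have "(\<lambda>m. (1 + - (q m $ 0)) * s m $ N) \<in> O[F](d)"
    proof -
      have "(1 + - (q m $ 0)) * s m $ N =
          (fps_X * (S m * s m)) $ N + q m $ N + (\<Sum>i<N. s m $ i * q m $ (N - i))" for m
      proof -
        have "(s m * q m) $ N = (\<Sum>i<N. s m $ i * q m $ (N - i)) + s m $ N * q m $ 0"
        proof -
          have "{0..N} = insert N {..<N}" by auto
          then show ?thesis by (simp add: fps_mult_nth add.commute)
        qed
        then show ?thesis using arg_cong[OF eq'[of m], of "\<lambda>f. f $ N"] by (simp add: algebra_simps)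
      qed
      moreover have "(\<lambda>m. (fps_X * (S m * s m)) $ N) \<in> O[F](d)"
        using cO_upto_X[OF cO_upto_mult[OF S1[OF Suc] Suc]] by (simp add: cO_upto_def)
      moreover have "(\<lambda>m. q m $ N) \<in> O[F](d)"
        using qd[OF Suc] by (simp add: cO_upto_def)
      moreover have "(\<lambda>m. \<Sum>i<N. s m $ i * q m $ (N - i)) \<in> O[F](d)"
      proof (rule big_sum_in_bigo)
        fix i assume i: "i \<in> {..<N}"
        have "(\<lambda>m. s m $ i * q m $ (N - i)) \<in> O[F](\<lambda>m. d m * 1)"
        proof (intro landau_o.big_mult)
          show "(\<lambda>m. s m $ i) \<in> O[F](d)" using Suc i by (simp add: cO_upto_def)
          show "(\<lambda>m. q m $ (N - i)) \<in> O[F](\<lambda>m. 1)"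
            using qd[OF Suc] by (intro landau_o.big_trans[OF _ d1]) (simp add: cO_upto_def)
        qed
        then show "(\<lambda>m. s m $ i * q m $ (N - i)) \<in> O[F](d)" by simp
      qed
      ultimately show ?thesis by (simp only:) (intro sum_in_bigo)
    qed
    moreover have "(\<lambda>m. - (q m $ 0)) \<in> O[F](d)"
      using qd[OF Suc] by (simp add: cO_upto_def)
    ultimately have "(\<lambda>m. s m $ N) \<in> O[F](d)" by (rule divide[rotated])
    then show ?case using Suc by (auto simp: cO_upto_def less_Suc_eq)
  qed
  note S1 = S1[OF sd] and qd = qd[OF sd]
  have qd: "cO_upto N F q d" for N using qd[of N] by (rule cO_upto_le) simp
  have pow: "cO_upto N F (\<lambda>m. S m ^ i - 1) d" for N i
  proof (induction i)
    case (Suc i)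
    have eq: "S m ^ Suc i - 1 = S m * (S m ^ i - 1) + s m" for m by (simp add: s_def algebra_simps)
    have m: "cO_upto N F (\<lambda>m. S m * (S m ^ i - 1)) d" using cO_upto_mult[OF S1 Suc] by simp
    show ?case unfolding eq by (intro cO_upto_add m sd)
  qed (simp add: cO_upto_def)
  have hF: "cO_upto N F (\<lambda>m. (h m oo (fps_X * S m)) - h m) (\<lambda>m. d m * d m)" for N
    unfolding cO_upto_def
  proof (intro allI impI)
    fix k
    have "((h m oo (fps_X * S m)) - h m) $ k = (\<Sum>i=0..k. h m $ i * (fps_X ^ i * (S m ^ i - 1)) $ k)" for m
    proof -
      have "h m $ k = (h m oo fps_X) $ k" by simp
      then have "((h m oo (fps_X * S m)) - h m) $ k = (\<Sum>i=0..k. h m $ i * ((fps_X * S m) ^ i - fps_X ^ i) $ k)"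
        by (simp only: fps_sub_nth fps_compose_nth right_diff_distrib sum_subtractf)
      then show ?thesis by (simp only: power_mult_distrib right_diff_distrib mult_1_right)
    qed
    moreover have "(\<lambda>m. \<Sum>i=0..k. h m $ i * (fps_X ^ i * (S m ^ i - 1)) $ k) \<in> O[F](\<lambda>m. d m * d m)"
    proof (intro big_sum_in_bigo landau_o.big_mult)
      fix i
      show "(\<lambda>m. h m $ i) \<in> O[F](d)" using hd[of "Suc i"] by (simp add: cO_upto_def)
      show "(\<lambda>m. (fps_X ^ i * (S m ^ i - 1)) $ k) \<in> O[F](d)"
        using cO_upto_mult[OF cO_upto_const[of "Suc k" F "fps_X ^ i"] pow[of "Suc k" i]] by (simp add: cO_upto_def)
    qed
    ultimately show "(\<lambda>m. ((h m oo (fps_X * S m)) - h m) $ k) \<in> O[F](\<lambda>m. d m * d m)" by (simp only:)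
  qed
  have sh: "cO_upto N F (\<lambda>m. s m - h m) (\<lambda>m. d m * d m)" for N
  proof -
    have "s m - h m = (1 + geo_fps) * (fps_X * (s m * s m) + (1 - fps_X) * ((h m oo (fps_X * S m)) - h m) + s m * q m)" for m
    proof -
      have "(1 - fps_X) * (s m - h m) = fps_X * (s m * s m) + (1 - fps_X) * ((h m oo (fps_X * S m)) - h m) + s m * q m"
        using eq'[of m] unfolding q_def[of m] S[of m] by (simp add: algebra_simps)
      moreover have "(1 + geo_fps) * (1 - fps_X) = 1"
        using geo_fps_eq by (simp add: algebra_simps)
      ultimately show ?thesis by (metis mult.assoc mult_1)
    qed
    moreover have "cO_upto N F (\<lambda>m. (1 + geo_fps) * (fps_X * (s m * s m) + (1 - fps_X) * ((h m oo (fps_X * S m)) - h m) + s m * q m))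
      (\<lambda>m. 1 * (d m * d m))"
    proof (rule cO_upto_mult[OF cO_upto_const], intro cO_upto_add)
      show "cO_upto N F (\<lambda>m. fps_X * (s m * s m)) (\<lambda>m. d m * d m)"
        using cO_upto_X[OF cO_upto_mult[OF sd[of N] sd]] by (rule cO_upto_le) simp
      show "cO_upto N F (\<lambda>m. (1 - fps_X) * ((h m oo (fps_X * S m)) - h m)) (\<lambda>m. d m * d m)"
        using cO_upto_mult[OF cO_upto_const[of N F "1 - fps_X"] hF[of N]] by simp
      show "cO_upto N F (\<lambda>m. s m * q m) (\<lambda>m. d m * d m)" by (intro cO_upto_mult sd qd)
    qed
    ultimately show ?thesis by (simp only: mult_1)
  qed
  have deriv: "cO_upto N F (\<lambda>m. fps_deriv (f m)) g" if "\<And>N. cO_upto N F f g" for f g N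
    using that[of "Suc N"] unfolding cO_upto_def by (auto intro!: landau_o.big.cmult_in_iff[THEN iffD2])
  have L': "L m = fps_deriv (s m) - s m * L m" for m
    using L[of m] unfolding S by (simp add: algebra_simps)
  have Ld: "cO_upto N F L d" for N
  proof (induction N)
    case 0 show ?case by (simp add: cO_upto_def)
  next
    case (Suc N)
    have "(\<lambda>m. (1 + s m $ 0) * L m $ N) \<in> O[F](d)"
    proof -
      have "(1 + s m $ 0) * L m $ N = fps_deriv (s m) $ N - (\<Sum>i<N. L m $ i * s m $ (N - i))" for m
      proof -
        have 1: "(L m * s m) $ N = (\<Sum>i<N. L m $ i * s m $ (N - i)) + L m $ N * s m $ 0"
        proof -
          have "{0..N} = insert N {..<N}" by auto
          then show ?thesis by (simp add: fps_mult_nth add.commute)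
        qed
        have "L m $ N = fps_deriv (s m) $ N - (L m * s m) $ N"
          using arg_cong[OF L'[of m], of "\<lambda>f. f $ N"] by (simp only: fps_sub_nth mult.commute[of "s m"])
        from this[unfolded 1] show ?thesis by (rule solve_linear)
      qed
      moreover have "(\<lambda>m. fps_deriv (s m) $ N) \<in> O[F](d)"
        using deriv[OF sd, of "Suc N"] by (simp add: cO_upto_def del: fps_deriv_nth)
      moreover have "(\<lambda>m. \<Sum>i<N. L m $ i * s m $ (N - i)) \<in> O[F](d)"
      proof (rule big_sum_in_bigo)
        fix i assume i: "i \<in> {..<N}"
        have "(\<lambda>m. L m $ i * s m $ (N - i)) \<in> O[F](\<lambda>m. d m * 1)"
        proof (intro landau_o.big_mult)
          show "(\<lambda>m. L m $ i) \<in> O[F](d)" using Suc i by (simp add: cO_upto_def)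
          show "(\<lambda>m. s m $ (N - i)) \<in> O[F](\<lambda>m. 1)"
            using sd[of "Suc N"] by (intro landau_o.big_trans[OF _ d1]) (simp add: cO_upto_def)
        qed
        then show "(\<lambda>m. L m $ i * s m $ (N - i)) \<in> O[F](d)" by simp
      qed
      ultimately show ?thesis by (simp only:) (intro sum_in_bigo)
    qed
    moreover have "(\<lambda>m. s m $ 0) \<in> O[F](d)" using sd[of 1] by (simp add: cO_upto_def)
    ultimately have "(\<lambda>m. L m $ N) \<in> O[F](d)" by (rule divide[rotated])
    then show ?case using Suc by (auto simp: cO_upto_def less_Suc_eq)
  qed
  have eqL: "L m - fps_deriv (h m) = fps_deriv (s m - h m) - s m * L m" for m
    by (subst L') simp
  have "cO_upto N F (\<lambda>m. fps_deriv (s m - h m) - s m * L m) (\<lambda>m. d m * d m)" for N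
    by (intro cO_upto_diff deriv sh cO_upto_mult sd Ld)
  then show ?thesis unfolding cO_iff_upto eqL d_def[symmetric] by blast
qed

text \<open>
  Substituting \<open>G = X S\<close> into \<open>P\<close> gives \<open>G / (1 - G) - G h(G) / (1 - G)\<^sup>2 = X / (1 - X)\<close>.
  The claim follows by clearing the denominators and cancelling one factor \<open>X\<close>.
\<close>

lemma Sigma_equation:
  assumes psi: "P = geo_fps - fps_X * h * (1 + geo_fps) ^ 2"
    and eq: "P oo (fps_X * S) = geo_fps"
  shows "(1 - fps_X * S) * (S - 1) = S * (h oo (fps_X * S)) * (1 - fps_X)"
proof -
  define G where "G = fps_X * S"
  define p where "p = 1 + (geo_fps oo G)"
  define r where "r = 1 + geo_fps"
  have G0: "G $ 0 = 0" by (simp add: G_def)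
  have 1: "p - 1 - G * (h oo G) * p ^ 2 = r - 1"
    using eq unfolding psi G_def[symmetric] p_def r_def
    by (simp add: fps_compose_sub_distrib fps_compose_mult_distrib[OF G0] fps_compose_add_distrib power2_eq_square G0)
  have r: "r * (1 - fps_X) = 1"
    unfolding r_def using geo_fps_eq by (simp add: algebra_simps)
  have "(r * (1 - fps_X)) oo G = p * (1 - G)"
    unfolding r_def p_def
    by (simp add: fps_compose_sub_distrib fps_compose_mult_distrib[OF G0] fps_compose_add_distrib G0)
  then have p: "p * (1 - G) = 1" by (simp add: r)
  have "p * (1 - G) * (1 - G) * (1 - fps_X) - (1 - G) ^ 2 * (1 - fps_X) - G * (h oo G) * (p * (1 - G)) ^ 2 * (1 - fps_X) =
     (1 - G) ^ 2 * (r * (1 - fps_X)) - (1 - G) ^ 2 * (1 - fps_X)"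
    using arg_cong[OF 1, of "\<lambda>x. x * (1 - G) ^ 2 * (1 - fps_X)"] by (simp add: algebra_simps power2_eq_square)
  then have "(1 - G) * (1 - fps_X) - G * (h oo G) * (1 - fps_X) = (1 - G) ^ 2"
    unfolding p r by (simp add: algebra_simps)
  then have "fps_X * ((1 - G) * (S - 1)) = fps_X * (S * (h oo G) * (1 - fps_X))"
    unfolding G_def by (simp add: algebra_simps power2_eq_square)
  then show ?thesis unfolding G_def by simp
qed

section \<open>Centering\<close>

lemma sin_linear_bound:
  assumes "\<bar>x\<bar> \<le> pi"
  shows "\<bar>sin x - x\<bar> \<le> pi * (1 - cos x)"
proof -
  have *: "x - sin x \<le> pi * (1 - cos x)" if x: "0 \<le> x" "x \<le> pi" for x
  proof (cases "x \<le> pi / 2")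
    case True
    have "pi * (1 - cos 0) - 0 + sin 0 \<le> pi * (1 - cos x) - x + sin x"
    proof (rule DERIV_nonneg_imp_nondecreasing[OF x(1)])
      fix y assume y: "0 \<le> y" "y \<le> x"
      have sc: "0 \<le> sin y" "0 \<le> cos y" using y True by (auto intro!: sin_ge_zero cos_ge_zero)
      have "1 \<le> (sin y + cos y)\<^sup>2"
        using sc by (simp add: power2_sum)
      then have "1 \<le> sin y + cos y" using sc by (intro power2_le_imp_le[of 1]) auto
      moreover have "sin y \<le> pi * sin y" using sc pi_gt3 mult_right_mono[of 1 pi "sin y"] by simp
      ultimately have "0 \<le> pi * sin y - 1 + cos y" by linarith
      moreover have "((\<lambda>x. pi * (1 - cos x) - x + sin x) has_real_derivative pi * sin y - 1 + cos y) (at y)"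
        by (auto intro!: derivative_eq_intros)
      ultimately show "\<exists>d. ((\<lambda>x. pi * (1 - cos x) - x + sin x) has_real_derivative d) (at y) \<and> 0 \<le> d" by blast
    qed
    then show ?thesis by simp
  next
    case False
    have "cos x \<le> 0" using False x cos_monotone_0_pi_le[of "pi/2" x] by simp
    then have "pi * 1 \<le> pi * (1 - cos x)" by (intro mult_left_mono) auto
    moreover have "0 \<le> sin x" using x by (intro sin_ge_zero)
    ultimately show ?thesis using x by linarith
  qed
  have sx: "sin y \<le> y" if "0 \<le> y" for y :: real using that by (rule sin_x_le_x)
  show ?thesis
  proof (cases "0 \<le> x")
    case True
    then show ?thesis using *[of x] sx[of x] assms by simp
  next
    case False
    then show ?thesis using *[of "-x"] sx[of "-x"] assms by simp
  qed
qed

lemma cos_far: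
  assumes \<tau>: "0 < \<tau>" "\<tau> < pi" and a: "\<bar>a\<bar> \<le> \<tau> / 2" and x: "\<tau> \<le> \<bar>x\<bar>" "\<bar>x\<bar> \<le> pi"
  shows "cos (x - a) \<le> cos (\<tau> / 2)"
proof -
  have *: "cos y \<le> cos (\<tau> / 2)" if y: "\<tau> / 2 \<le> y" "y \<le> pi + \<tau> / 2" for y
  proof (cases "y \<le> pi")
    case True
    then show ?thesis using y \<tau> by (intro cos_monotone_0_pi_le) auto
  next
    case False
    have "cos y = cos (2 * pi - y)" by simp
    also have "\<dots> \<le> cos (\<tau> / 2)" using y \<tau> False by (intro cos_monotone_0_pi_le) auto
    finally show ?thesis .
  qed
  show ?thesis
  proof (cases "0 \<le> x")
    case True
    then show ?thesis using x a by (intro *) auto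
  next
    case False
    then have "cos (- (x - a)) \<le> cos (\<tau> / 2)" using x a by (intro *) auto
    then show ?thesis by (simp only: cos_minus)
  qed
qed

lemma circle_Arg:
  assumes "t \<in> circle"
  shows "t = cis (Arg t)" "\<bar>Arg t\<bar> \<le> pi"
proof -
  have "t \<noteq> 0" using assms by auto
  from Arg_eq[OF this] assms show "t = cis (Arg t)" by (simp add: cis_conv_exp)
  show "\<bar>Arg t\<bar> \<le> pi" using Arg_bounded[of t] by auto
qed

text \<open>
  The argument of the centering constant.
\<close>

definition angle :: "real \<Rightarrow> complex measure \<Rightarrow> real" where
  "angle \<tau> \<nu> = (LINT t|\<nu>. (if \<bar>Arg t\<bar> < \<tau> then Arg t else 0))"

text \<open>
  The mass that a centered measure contributes to \<open>sigma_row\<close>; it measures the distance to the unit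
  mass at \<open>1\<close>.
\<close>

definition spread :: "complex measure \<Rightarrow> real" where
  "spread \<nu> = (LINT t|\<nu>. 1 - Re t)"

definition imbalance :: "complex measure \<Rightarrow> real" where
  "imbalance \<nu> = (LINT t|\<nu>. Im t)"

lemma Arg_measurable_circle: "sets \<nu> = sets circle_borel \<Longrightarrow> Arg \<in> borel_measurable \<nu>"
  using Arg_measurable measurable_cong_sets[of \<nu> circle_borel] by blast

context
  fixes \<nu> :: "complex measure"
  assumes \<nu>: "circle_prob \<nu>"
begin

lemma ps: "prob_space \<nu>" and sp: "space \<nu> = circle" and Arg_m [measurable]: "Arg \<in> borel_measurable \<nu>"
  using \<nu> circle_prob_space[OF \<nu>] Arg_measurable_circle by (auto simp: circle_prob_def)

lemma integrable_bounded_circle: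
  fixes f :: "complex \<Rightarrow> 'b::{banach, second_countable_topology}"
  assumes "f \<in> borel_measurable \<nu>" "\<And>t. t \<in> circle \<Longrightarrow> norm (f t) \<le> K"
  shows "integrable \<nu> f"
proof -
  interpret prob_space \<nu> by (rule ps)
  show ?thesis using assms by (intro integrable_const_bound[of _ K]) (auto simp: sp)
qed

lemma truncated_measurable:
  assumes "f \<in> borel_measurable \<nu>" "g \<in> borel_measurable \<nu>"
  shows "(\<lambda>t. if \<bar>Arg t\<bar> < \<tau> then f t else g t :: real) \<in> borel_measurable \<nu>"
proof (rule measurable_If[OF assms])
  show "{x \<in> space \<nu>. \<bar>Arg x\<bar> < \<tau>} \<in> sets \<nu>" by measurable
qed

lemma integrable_truncated_Arg:
  assumes "0 < \<tau>"
  shows "integrable \<nu> (\<lambda>t. if \<bar>Arg t\<bar> < \<tau> then Arg t else 0)"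
proof (rule integrable_bounded_circle)
  show "(\<lambda>t. if \<bar>Arg t\<bar> < \<tau> then Arg t else 0) \<in> borel_measurable \<nu>"
    by (intro truncated_measurable) measurable
  show "norm (if \<bar>Arg t\<bar> < \<tau> then Arg t else 0) \<le> pi" if "t \<in> circle" for t
    using circle_Arg(2)[OF that] by auto
qed

lemma integrable_one_minus_cos: "integrable \<nu> (\<lambda>t. 1 - cos (Arg t - a))"
proof (rule integrable_bounded_circle)
  show "(\<lambda>t. 1 - cos (Arg t - a)) \<in> borel_measurable \<nu>" by measurable
  show "norm (1 - cos (Arg t - a)) \<le> 2" for t
    using cos_ge_minus_one[of "Arg t - a"] by simp
qed

lemma centering_eq: "centering \<tau> \<nu> = cis (angle \<tau> \<nu>)"
proof -
  have "(LINT t:{t. \<bar>Arg t\<bar> < \<tau>}|\<nu>. \<i> * of_real (Arg t)) =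
     (LINT t|\<nu>. \<i> * of_real (if \<bar>Arg t\<bar> < \<tau> then Arg t else 0))"
    unfolding set_lebesgue_integral_def by (intro Bochner_Integration.integral_cong) auto
  also have "\<dots> = \<i> * of_real (angle \<tau> \<nu>)"
    unfolding angle_def by simp
  finally show ?thesis by (simp add: centering_def cis_conv_exp)
qed

lemma centering_circle: "centering \<tau> \<nu> \<in> circle"
  by (simp add: centering_eq)

lemma rotation_measurable: "(\<lambda>t. t / centering \<tau> \<nu>) \<in> measurable \<nu> circle_borel"
proof -
  have "(\<lambda>t. t / centering \<tau> \<nu>) \<in> measurable circle_borel circle_borel"
  proof (rule measurable_restrict_space2)
    show "(\<lambda>t. t / centering \<tau> \<nu>) \<in> measurable circle_borel borel"
      using centering_circle[of \<tau>] by (intro borel_measurable_continuous_on_restrict continuous_intros) auto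
    show "(\<lambda>t. t / centering \<tau> \<nu>) \<in> space circle_borel \<rightarrow> circle"
      using centering_circle[of \<tau>] by (auto simp: space_restrict_space norm_divide)
  qed
  then show ?thesis using \<nu> measurable_cong_sets[of \<nu> circle_borel] by (auto simp: circle_prob_def)
qed

lemma circle_prob_centered: "circle_prob (centered \<tau> \<nu>)"
  unfolding circle_prob_def centered_def
  using prob_space.prob_space_distr[OF ps rotation_measurable[of \<tau>]] by simp

lemma integral_centered:
  fixes f :: "complex \<Rightarrow> 'b::{banach, second_countable_topology}"
  assumes "continuous_on circle f"
  shows "(LINT t|centered \<tau> \<nu>. f t) = (LINT t|\<nu>. f (t / centering \<tau> \<nu>))"
  unfolding centered_def
  by (rule integral_distr[OF rotation_measurable]) (rule borel_measurable_continuous_on_restrict[OF assms])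

lemma mom_centered: "mom \<nu> k = centering \<tau> \<nu> ^ k * mom (centered \<tau> \<nu>) k"
proof -
  have "centering \<tau> \<nu> \<noteq> 0" using centering_circle[of \<tau>] by auto
  then have "mom \<nu> k = (LINT t|\<nu>. centering \<tau> \<nu> ^ k * (t / centering \<tau> \<nu>) ^ k)"
    unfolding mom_def by (simp add: power_divide)
  also have "\<dots> = centering \<tau> \<nu> ^ k * mom (centered \<tau> \<nu>) k"
    unfolding mom_def by (subst integral_centered) (auto intro!: continuous_intros)
  finally show ?thesis .
qed

lemma cis_angle: "t \<in> circle \<Longrightarrow> t / centering \<tau> \<nu> = cis (Arg t - angle \<tau> \<nu>)"
  by (subst circle_Arg(1)) (simp_all add: centering_eq cis_divide)

lemma spread_centered: "spread (centered \<tau> \<nu>) = (LINT t|\<nu>. 1 - cos (Arg t - angle \<tau> \<nu>))"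
proof -
  have "spread (centered \<tau> \<nu>) = (LINT t|\<nu>. 1 - Re (t / centering \<tau> \<nu>))"
    unfolding spread_def by (subst integral_centered) (auto intro!: continuous_intros)
  then show ?thesis
    using Bochner_Integration.integral_cong[of \<nu> \<nu> "\<lambda>t. 1 - Re (t / centering \<tau> \<nu>)" "\<lambda>t. 1 - cos (Arg t - angle \<tau> \<nu>)"]
    by (simp add: sp cis_angle)
qed

lemma imbalance_centered: "imbalance (centered \<tau> \<nu>) = (LINT t|\<nu>. sin (Arg t - angle \<tau> \<nu>))"
proof -
  have "imbalance (centered \<tau> \<nu>) = (LINT t|\<nu>. Im (t / centering \<tau> \<nu>))"
    unfolding imbalance_def by (subst integral_centered) (auto intro!: continuous_intros)
  then show ?thesis
    using Bochner_Integration.integral_cong[of \<nu> \<nu> "\<lambda>t. Im (t / centering \<tau> \<nu>)" "\<lambda>t. sin (Arg t - angle \<tau> \<nu>)"]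
    by (simp add: sp cis_angle)
qed

text \<open>
  The effect of centering: the mean of the sine, of first order in general, is dominated by the
  mean of \<open>1 - cos\<close>. By the choice of \<open>a = angle \<tau> \<nu>\<close> the truncated angle minus \<open>a\<close> has mean zero and
  may be subtracted from \<open>sin (Arg t - a)\<close>. For \<open>\<bar>Arg t\<bar> < \<tau>\<close> the difference is bounded by
  \<open>sin_linear_bound\<close>; otherwise \<open>1 - cos (Arg t - a)\<close> is bounded below by \<open>cos_far\<close>.
\<close>

lemma imbalance_bound:
  assumes \<tau>: "0 < \<tau>" "\<tau> < pi" and a: "\<bar>angle \<tau> \<nu>\<bar> \<le> \<tau> / 2" "\<bar>angle \<tau> \<nu>\<bar> \<le> pi - \<tau>"
  shows "\<bar>imbalance (centered \<tau> \<nu>)\<bar> \<le> (pi + (1 + pi) / (1 - cos (\<tau> / 2))) * spread (centered \<tau> \<nu>)"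
proof -
  interpret prob_space \<nu> by (rule ps)
  define a where "a = angle \<tau> \<nu>"
  define C where "C = pi + (1 + pi) / (1 - cos (\<tau> / 2))"
  \<comment> \<open>The truncated angle minus its mean.\<close>
  define g where "g t = (if \<bar>Arg t\<bar> < \<tau> then Arg t - a else - a)" for t
  have c: "cos (\<tau> / 2) < 1" using \<tau> cos_monotone_0_pi[of 0 "\<tau>/2"] by simp
  have gm: "g \<in> borel_measurable \<nu>" unfolding g_def by (intro truncated_measurable) measurable
  have ig: "integrable \<nu> g"
  proof (rule integrable_bounded_circle[OF gm, of "pi + \<bar>a\<bar>"])
    fix t :: complex assume "t \<in> circle"
    from circle_Arg(2)[OF this] show "norm (g t) \<le> pi + \<bar>a\<bar>" by (auto simp: g_def)
  qed
  have isn: "integrable \<nu> (\<lambda>t. sin (Arg t - a))" "integrable \<nu> (\<lambda>t. 1 - cos (Arg t - a))"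
  proof -
    show "integrable \<nu> (\<lambda>t. sin (Arg t - a))"
    proof (rule integrable_bounded_circle)
      show "(\<lambda>t. sin (Arg t - a)) \<in> borel_measurable \<nu>" by measurable
      show "norm (sin (Arg t - a)) \<le> 1" for t by simp
    qed
    show "integrable \<nu> (\<lambda>t. 1 - cos (Arg t - a))"
      by (rule integrable_one_minus_cos)
  qed
  note ii = integrable_truncated_Arg[OF \<tau>(1)]
  have "(LINT t|\<nu>. g t) = 0"
  proof -
    have "g = (\<lambda>t. (if \<bar>Arg t\<bar> < \<tau> then Arg t else 0) - a)" by (auto simp: g_def)
    then show ?thesis using ii by (simp add: prob_space a_def angle_def)
  qed
  then have "imbalance (centered \<tau> \<nu>) = (LINT t|\<nu>. sin (Arg t - a) - g t)"
    using isn ig by (simp add: imbalance_centered a_def)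
  also have "\<bar>\<dots>\<bar> \<le> (LINT t|\<nu>. \<bar>sin (Arg t - a) - g t\<bar>)" by (rule integral_abs_bound)
  also have "\<dots> \<le> (LINT t|\<nu>. C * (1 - cos (Arg t - a)))"
  proof (rule Bochner_Integration.integral_mono)
    fix t assume "t \<in> space \<nu>"
    then have t: "\<bar>Arg t\<bar> \<le> pi" using circle_Arg(2) by (simp add: sp)
    have C1: "pi \<le> C" using c by (simp add: C_def)
    have p: "0 \<le> 1 - cos (Arg t - a)" by simp
    show "\<bar>sin (Arg t - a) - g t\<bar> \<le> C * (1 - cos (Arg t - a))"
    proof (cases "\<bar>Arg t\<bar> < \<tau>")
      case True
      then have "\<bar>sin (Arg t - a) - (Arg t - a)\<bar> \<le> pi * (1 - cos (Arg t - a))"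
        using a by (intro sin_linear_bound) (auto simp: a_def)
      also have "\<dots> \<le> C * (1 - cos (Arg t - a))" by (rule mult_right_mono[OF C1 p])
      finally show ?thesis using True by (simp add: g_def)
    next
      case False
      have far: "1 - cos (\<tau> / 2) \<le> 1 - cos (Arg t - a)"
        using cos_far[OF \<tau> _ _ t, of a] a False by (simp add: a_def)
      have "\<bar>a\<bar> \<le> pi" using a \<tau> by (simp add: a_def)
      moreover have "\<bar>sin (Arg t - a)\<bar> \<le> 1" by (rule abs_sin_le_one)
      moreover have "g t = - a" using False by (simp add: g_def)
      ultimately have "\<bar>sin (Arg t - a) - g t\<bar> \<le> 1 + pi" by linarith
      also have "\<dots> = (1 + pi) / (1 - cos (\<tau> / 2)) * (1 - cos (\<tau> / 2))" using c by simp
      also have "\<dots> \<le> C * (1 - cos (Arg t - a))"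
        using far c by (intro mult_mono) (auto simp: C_def)
      finally show ?thesis .
    qed
  qed (use isn ig in auto)
  also have "\<dots> = C * spread (centered \<tau> \<nu>)" by (simp add: spread_centered a_def)
  finally show ?thesis unfolding C_def .
qed

lemma angle_spread_small:
  assumes \<tau>: "0 < \<tau>" "\<tau> < pi" and \<epsilon>: "0 < \<epsilon>" and m: "measure \<nu> {t \<in> circle. \<bar>Arg t\<bar> \<ge> \<epsilon>} \<le> \<epsilon>"
  shows "\<bar>angle \<tau> \<nu>\<bar> \<le> 5 * \<epsilon>" "spread (centered \<tau> \<nu>) \<le> 8 * \<epsilon>"
proof -
  interpret prob_space \<nu> by (rule ps)
  let ?T = "{t \<in> space \<nu>. \<bar>Arg t\<bar> \<ge> \<epsilon>}"
  have T: "?T \<in> sets \<nu>" by measurable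
  have mT: "measure \<nu> ?T \<le> \<epsilon>" using m by (simp add: sp)
  have iI: "integrable \<nu> (indicator ?T :: complex \<Rightarrow> real)"
    by (rule integrable_real_indicator[OF T]) (simp add: emeasure_eq_measure)
  have iT: "integrable \<nu> (\<lambda>t. c + K * indicator ?T t :: real)" for K c
    by (intro Bochner_Integration.integrable_add Bochner_Integration.integrable_mult_right iI) simp
  have IT: "(LINT t|\<nu>. c + K * indicator ?T t) = c + K * measure \<nu> ?T" for K c :: real
    by (subst Bochner_Integration.integral_add) (use T iI in \<open>simp_all add: prob_space\<close>)
  note ii = integrable_truncated_Arg[OF \<tau>(1)]
  have "\<bar>angle \<tau> \<nu>\<bar> \<le> (LINT t|\<nu>. \<bar>if \<bar>Arg t\<bar> < \<tau> then Arg t else 0\<bar>)"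
    unfolding angle_def by (rule integral_abs_bound)
  also have "\<dots> \<le> (LINT t|\<nu>. \<epsilon> + 4 * indicator ?T t)"
  proof (rule Bochner_Integration.integral_mono)
    fix t assume t: "t \<in> space \<nu>"
    have "\<bar>Arg t\<bar> \<le> 4" using circle_Arg(2)[of t] t pi_less_4 by (simp add: sp)
    then show "\<bar>if \<bar>Arg t\<bar> < \<tau> then Arg t else 0\<bar> \<le> \<epsilon> + 4 * indicator ?T t"
      using t \<epsilon> by (auto simp: indicator_def)
  qed (use ii iT in auto)
  also have "\<dots> \<le> 5 * \<epsilon>" unfolding IT using mT by simp
  finally show a: "\<bar>angle \<tau> \<nu>\<bar> \<le> 5 * \<epsilon>" .
  note ic = integrable_one_minus_cos
  have cb: "1 - cos x \<le> \<bar>x\<bar>" for x :: real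
  proof -
    have "\<bar>sin (x / 2)\<bar> \<le> \<bar>x / 2\<bar>" by (rule abs_sin_x_le_abs_x)
    moreover have "\<bar>sin (x / 2)\<bar> \<le> 1" by simp
    ultimately have "\<bar>sin (x / 2)\<bar> * \<bar>sin (x / 2)\<bar> \<le> \<bar>x / 2\<bar> * 1" by (intro mult_mono) auto
    moreover have "1 - cos x = 2 * (sin (x / 2))\<^sup>2" using cos_double_sin[of "x / 2"] by simp
    moreover have "\<bar>sin (x / 2)\<bar> * \<bar>sin (x / 2)\<bar> = (sin (x / 2))\<^sup>2" by (simp add: power2_eq_square)
    ultimately show ?thesis by simp
  qed
  have "spread (centered \<tau> \<nu>) \<le> (LINT t|\<nu>. 6 * \<epsilon> + 2 * indicator ?T t)"
    unfolding spread_centered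
  proof (rule Bochner_Integration.integral_mono)
    fix t assume t: "t \<in> space \<nu>"
    show "1 - cos (Arg t - angle \<tau> \<nu>) \<le> 6 * \<epsilon> + 2 * indicator ?T t"
    proof (cases "t \<in> ?T")
      case True
      have "1 - cos (Arg t - angle \<tau> \<nu>) \<le> 2" using cos_ge_minus_one[of "Arg t - angle \<tau> \<nu>"] by linarith
      moreover have "2 * indicator ?T t = (2 :: real)" using True by simp
      ultimately show ?thesis using \<epsilon> by linarith
    next
      case False
      then have "\<bar>Arg t\<bar> < \<epsilon>" using t by auto
      then show ?thesis using a cb[of "Arg t - angle \<tau> \<nu>"] False by simp
    qed
  qed (use ic iT in auto)
  also have "\<dots> \<le> 8 * \<epsilon>" unfolding IT using mT by simp
  finally show "spread (centered \<tau> \<nu>) \<le> 8 * \<epsilon>" .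
qed

end

section \<open>The analytic transforms as germs\<close>

lemma psi_sums:
  assumes \<mu>: "circle_measure \<mu>" and z: "norm z < 1"
  shows "(\<lambda>k. psi_fps \<mu> $ k * z ^ k) sums psi \<mu> z"
proof -
  interpret finite_measure \<mu> using \<mu> by (simp add: circle_measure_def)
  let ?f = "\<lambda>k t. if k = 0 then 0 else (t * z) ^ k :: complex"
  have sp: "space \<mu> = circle" by (rule circle_measure_space[OF \<mu>])
  have geo: "?f \<circ> id = ?f" by simp
  have nf: "norm (?f k t) \<le> norm z ^ k" if "t \<in> circle" for k t
    using that by (auto simp: norm_mult norm_power)
  have ik: "integrable \<mu> (?f k)" for k
    by (cases "k = 0") (auto intro!: circle_measure_integrable[OF \<mu>] continuous_intros)
  have "(\<lambda>k. \<integral>t. ?f k t \<partial>\<mu>) sums (\<integral>t. suminf (\<lambda>k. ?f k t) \<partial>\<mu>)"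
  proof (rule sums_integral)
    show "integrable \<mu> (?f k)" for k by (rule ik)
    have sg: "summable (\<lambda>k. norm z ^ k)" using z by (intro summable_geometric) simp
    show "AE t in \<mu>. summable (\<lambda>k. norm (?f k t))"
      by (intro AE_I2 summable_comparison_test'[OF sg, of 0]) (use nf in \<open>auto simp: sp\<close>)
    show "summable (\<lambda>k. LINT t|\<mu>. norm (?f k t))"
    proof (rule summable_comparison_test'[of "\<lambda>k. measure \<mu> (space \<mu>) * norm z ^ k" 0])
      show "summable (\<lambda>k. measure \<mu> (space \<mu>) * norm z ^ k)" using sg by (rule summable_mult)
      fix k :: nat
      have "(LINT t|\<mu>. norm (?f k t)) \<le> (LINT t|\<mu>. norm z ^ k)"
        by (intro Bochner_Integration.integral_mono integrable_norm ik) (use nf in \<open>auto simp: sp\<close>)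
      moreover have "0 \<le> (LINT t|\<mu>. norm (?f k t))" by (rule Bochner_Integration.integral_nonneg) simp
      ultimately show "norm (LINT t|\<mu>. norm (?f k t)) \<le> measure \<mu> (space \<mu>) * norm z ^ k" by simp
    qed
  qed
  also have "(\<integral>t. suminf (\<lambda>k. ?f k t) \<partial>\<mu>) = psi \<mu> z"
    unfolding psi_def
  proof (rule Bochner_Integration.integral_cong[OF refl])
    fix t assume "t \<in> space \<mu>"
    then have n: "norm (t * z) < 1" using z by (simp add: sp norm_mult)
    then have "(\<lambda>k. (t * z) ^ k) sums (1 / (1 - t * z))" by (rule geometric_sums)
    moreover have "(\<lambda>k :: nat. if k = 0 then 1 else 0) sums (1 :: complex)"
      using sums_single[of 0 "\<lambda>_. 1 :: complex"] by (simp only:)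
    ultimately have "(\<lambda>k. (t * z) ^ k - (if k = 0 then 1 else 0)) sums (1 / (1 - t * z) - 1)"
      by (rule sums_diff)
    also have "(\<lambda>k. (t * z) ^ k - (if k = 0 then 1 else 0)) = (\<lambda>k. ?f k t)" by auto
    also have "1 / (1 - t * z) - 1 = t * z / (1 - t * z)"
    proof -
      have "1 - t * z \<noteq> 0" using n by auto
      then show ?thesis by (simp add: field_simps)
    qed
    finally show "suminf (\<lambda>k. ?f k t) = t * z / (1 - t * z)" by (simp add: sums_iff)
  qed
  also have "(\<lambda>k. \<integral>t. ?f k t \<partial>\<mu>) = (\<lambda>k. psi_fps \<mu> $ k * z ^ k)"
    by (auto simp: psi_fps_def mom_def power_mult_distrib)
  finally show ?thesis .
qed

lemma eventually_norm_less_1: "\<forall>\<^sub>F z in nhds (0 :: complex). norm z < 1"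
  using eventually_nhds_in_open[of "ball 0 1" "0 :: complex"] by simp

lemma psi_expansion: "circle_measure \<mu> \<Longrightarrow> psi \<mu> has_fps_expansion psi_fps \<mu>"
  by (intro has_fps_expansionI eventually_mono[OF eventually_norm_less_1] psi_sums)

lemma psi_0: "circle_measure \<mu> \<Longrightarrow> psi \<mu> 0 = 0"
  by (simp add: psi_def)

text \<open>
  Some local inverse exists by the inverse function theorem, and every germ that inverts \<open>\<psi>\<close>
  on the right has the compositional inverse as its expansion.
\<close>

lemma psi_inv_expansion:
  assumes \<mu>: "circle_measure \<mu>" and 1: "mom \<mu> 1 \<noteq> 0"
  shows "psi_inv \<mu> has_fps_expansion fps_inv (psi_fps \<mu>)"
proof -
  have ex: "\<exists>g. g analytic_on {0} \<and> g 0 = 0 \<and>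
     (\<forall>\<^sub>F w in nhds 0. psi \<mu> (g w) = w) \<and> (\<forall>\<^sub>F z in nhds 0. g (psi \<mu> z) = z)"
  proof -
    have "psi \<mu> analytic_on {0}"
      using psi_expansion[OF \<mu>] by (rule has_fps_expansion_imp_analytic_0)
    then obtain S where S: "open S" "0 \<in> S" "psi \<mu> holomorphic_on S"
      by (auto simp: analytic_at)
    have "deriv (psi \<mu>) 0 = psi_fps \<mu> $ 1"
      using fps_nth_fps_expansion[OF psi_expansion[OF \<mu>], of 1] by simp
    then have d: "deriv (psi \<mu>) 0 \<noteq> 0" using 1 by (simp add: psi_fps_1)
    obtain r where r: "r > 0" "ball 0 r \<subseteq> S" "open (psi \<mu> ` ball 0 r)" "inj_on (psi \<mu>) (ball 0 r)"
      using has_complex_derivative_locally_invertible[OF S(3) S(2,1) d] by blast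
    have hol: "psi \<mu> holomorphic_on ball 0 r" using S(3) r(2) holomorphic_on_subset by blast
    obtain g where g: "g holomorphic_on psi \<mu> ` ball 0 r" "\<And>z. z \<in> ball 0 r \<Longrightarrow> g (psi \<mu> z) = z"
      using holomorphic_has_inverse[OF hol open_ball r(4)] by metis
    have 0: "0 \<in> psi \<mu> ` ball 0 r" using r(1) psi_0[OF \<mu>] by (intro image_eqI[of _ _ 0]) auto
    have "g analytic_on {0}" using g(1) r(3) 0 by (auto simp: analytic_at)
    moreover have "g 0 = 0" using g(2)[of 0] r(1) psi_0[OF \<mu>] by simp
    moreover have "\<forall>\<^sub>F w in nhds 0. psi \<mu> (g w) = w"
      using eventually_nhds_in_open[OF r(3) 0] by eventually_elim (use g(2) in auto)
    moreover have "\<forall>\<^sub>F z in nhds 0. g (psi \<mu> z) = z"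
      using eventually_nhds_in_open[OF open_ball, of 0 0 r] r(1) g(2) by (auto elim!: eventually_mono)
    ultimately show ?thesis by blast
  qed
  from someI_ex[OF this] have g: "psi_inv \<mu> analytic_on {0}" "psi_inv \<mu> 0 = 0"
     "\<forall>\<^sub>F w in nhds 0. psi \<mu> (psi_inv \<mu> w) = w"
    unfolding psi_inv_def[symmetric] by auto
  define G where "G = fps_expansion (psi_inv \<mu>) 0"
  have G: "psi_inv \<mu> has_fps_expansion G"
    unfolding G_def by (rule analytic_at_imp_has_fps_expansion_0[OF g(1)])
  have G0: "G $ 0 = 0" using has_fps_expansion_imp_0_eq_fps_nth_0[OF G] g(2) by simp
  have "(psi \<mu> \<circ> psi_inv \<mu>) has_fps_expansion (psi_fps \<mu> oo G)"
    by (rule has_fps_expansion_compose[OF psi_expansion[OF \<mu>] G G0])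
  also have "?this \<longleftrightarrow> (\<lambda>w. w) has_fps_expansion (psi_fps \<mu> oo G)"
    by (rule has_fps_expansion_cong) (use g(3) in \<open>auto elim: eventually_mono\<close>)
  finally have "psi_fps \<mu> oo G = fps_X"
    using has_fps_expansion_fps_X fps_expansion_unique_complex by blast
  then have "fps_inv (psi_fps \<mu>) oo (psi_fps \<mu> oo G) = fps_inv (psi_fps \<mu>)" by simp
  moreover have "fps_inv (psi_fps \<mu>) oo (psi_fps \<mu> oo G) = G"
    by (subst fps_compose_assoc) (simp_all add: G0 psi_fps_0 psi_fps_inv[OF 1])
  ultimately show ?thesis using G by simp
qed

text \<open>
  Multiplication by \<open>z\<close> removes the junk value of the Sigma-transform at \<open>0\<close>; what remains is the
  composition of the local inverse with \<open>z / (1 - z)\<close>, and germs are determined by their expansions.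
\<close>

lemma Sigma_transform_germ:
  assumes \<mu>: "circle_measure \<mu>" and 1: "mom \<mu> 1 \<noteq> 0" and h: "h has_fps_expansion H"
  shows "(\<forall>\<^sub>F z in at 0. Sigma_transform \<mu> z = h z) \<longleftrightarrow> Sigma_fps \<mu> = H"
proof -
  define K where "K z = psi_inv \<mu> (z / (1 - z))" for z
  have "(\<lambda>z :: complex. z * inverse (1 - z)) has_fps_expansion fps_X * inverse (1 - fps_X)"
    by (intro has_fps_expansion_mult has_fps_expansion_inverse has_fps_expansion_diff
        has_fps_expansion_1 has_fps_expansion_fps_X) simp
  then have geo: "(\<lambda>z :: complex. z / (1 - z)) has_fps_expansion geo_fps"
    by (simp only: geo_fps_eq[unfolded geo_fps_inverse] divide_inverse)
  have "(psi_inv \<mu> \<circ> (\<lambda>z. z / (1 - z))) has_fps_expansion (fps_inv (psi_fps \<mu>) oo geo_fps)"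
    by (rule has_fps_expansion_compose[OF psi_inv_expansion[OF \<mu> 1] geo]) (simp add: geo_fps_nth)
  then have K: "K has_fps_expansion fps_X * Sigma_fps \<mu>"
    by (simp add: K_def[abs_def] comp_def X_Sigma_fps[OF 1])
  have hX: "(\<lambda>z. z * h z) has_fps_expansion fps_X * H"
    by (intro fps_expansion_intros h)
  have S: "\<forall>\<^sub>F z in nhds 0. z \<noteq> 0 \<longrightarrow> z * Sigma_transform \<mu> z = K z"
    using eventually_norm_less_1
  proof eventually_elim
    case (elim z)
    then have "1 - z \<noteq> 0" by auto
    then show ?case by (auto simp: Sigma_transform_def S_transform_def K_def field_simps)
  qed
  have K0: "K 0 = 0" using has_fps_expansion_imp_0_eq_fps_nth_0[OF K] by simp
  have "(\<forall>\<^sub>F z in at 0. Sigma_transform \<mu> z = h z) \<longleftrightarrow> (\<forall>\<^sub>F z in nhds 0. K z = z * h z)"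
    unfolding eventually_at_filter
  proof
    assume "\<forall>\<^sub>F z in nhds 0. z \<noteq> 0 \<longrightarrow> z \<in> UNIV \<longrightarrow> Sigma_transform \<mu> z = h z"
    then show "\<forall>\<^sub>F z in nhds 0. K z = z * h z"
      using S by eventually_elim (metis K0 UNIV_I mult_zero_left)
  next
    assume "\<forall>\<^sub>F z in nhds 0. K z = z * h z"
    then show "\<forall>\<^sub>F z in nhds 0. z \<noteq> 0 \<longrightarrow> z \<in> UNIV \<longrightarrow> Sigma_transform \<mu> z = h z"
      using S by eventually_elim auto
  qed
  also have "\<dots> \<longleftrightarrow> fps_X * Sigma_fps \<mu> = fps_X * H"
  proof
    assume "\<forall>\<^sub>F z in nhds 0. K z = z * h z"
    then have "K has_fps_expansion fps_X * H \<longleftrightarrow> (\<lambda>z. z * h z) has_fps_expansion fps_X * H"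
      by (intro has_fps_expansion_cong) auto
    then show "fps_X * Sigma_fps \<mu> = fps_X * H" using K hX fps_expansion_unique_complex by blast
  next
    assume "fps_X * Sigma_fps \<mu> = fps_X * H"
    then have "\<forall>\<^sub>F z in nhds 0. eval_fps (fps_X * H) z = K z" "\<forall>\<^sub>F z in nhds 0. eval_fps (fps_X * H) z = z * h z"
      using K hX by (auto simp: has_fps_expansion_def)
    then show "\<forall>\<^sub>F z in nhds 0. K z = z * h z" by eventually_elim simp
  qed
  also have "\<dots> \<longleftrightarrow> Sigma_fps \<mu> = H" by simp
  finally show ?thesis .
qed

text \<open>
  From \<open>(1 + w) / (1 - w) = 1 + 2 w / (1 - w)\<close>.
\<close>

definition u_fps :: "real \<Rightarrow> complex measure \<Rightarrow> complex fps" where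
  "u_fps \<gamma> \<sigma> = fps_const (- \<i> * of_real \<gamma> + mom \<sigma> 0) + fps_const 2 * psi_fps \<sigma>"

lemma u_fun_eq:
  assumes \<sigma>: "circle_measure \<sigma>" and z: "norm z < 1"
  shows "u_fun \<gamma> \<sigma> z = - \<i> * of_real \<gamma> + mom \<sigma> 0 + 2 * psi \<sigma> z"
proof -
  have ne: "1 - t * z \<noteq> 0" if "t \<in> circle" for t
  proof -
    have "norm (t * z) < 1" using that z by (simp add: norm_mult)
    then show ?thesis by auto
  qed
  have i: "integrable \<sigma> (\<lambda>t. t * z / (1 - t * z))"
    by (intro circle_measure_integrable[OF \<sigma>] continuous_intros) (use ne in auto)
  have "(LINT t|\<sigma>. (1 + t * z) / (1 - t * z)) = (LINT t|\<sigma>. 1 + 2 * (t * z / (1 - t * z)))"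
    using ne circle_measure_space[OF \<sigma>] by (intro Bochner_Integration.integral_cong) (auto simp: field_simps)
  also have "\<dots> = (LINT t|\<sigma>. 1) + (LINT t|\<sigma>. 2 * (t * z / (1 - t * z)))"
    by (intro Bochner_Integration.integral_add Bochner_Integration.integrable_mult_right i circle_measure_integrable[OF \<sigma>]) simp
  also have "\<dots> = mom \<sigma> 0 + 2 * psi \<sigma> z"
    unfolding psi_def mom_def by (simp only: Bochner_Integration.integral_mult_right_zero power_0)
  finally show ?thesis by (simp add: u_fun_def)
qed

lemma u_expansion: "circle_measure \<sigma> \<Longrightarrow> u_fun \<gamma> \<sigma> has_fps_expansion u_fps \<gamma> \<sigma>"
proof -
  assume \<sigma>: "circle_measure \<sigma>"
  have "(\<lambda>z. - \<i> * of_real \<gamma> + mom \<sigma> 0 + 2 * psi \<sigma> z) has_fps_expansion u_fps \<gamma> \<sigma>"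
    unfolding u_fps_def by (intro fps_expansion_intros psi_expansion \<sigma>)
  also have "?this \<longleftrightarrow> ?thesis"
    by (rule has_fps_expansion_cong) (use eventually_norm_less_1 in \<open>eventually_elim, simp add: u_fun_eq[OF \<sigma>]\<close>, simp)
  finally show ?thesis .
qed

text \<open>
  The constant term is split off because only series without constant term can be substituted
  into the exponential series.
\<close>

definition exp_fps :: "complex fps \<Rightarrow> complex fps" where
  "exp_fps U = fps_const (exp (U $ 0)) * (fps_exp 1 oo (U - fps_const (U $ 0)))"

lemma exp_fps_expansion:
  assumes "u has_fps_expansion U"
  shows "(\<lambda>z. exp (u z)) has_fps_expansion exp_fps U"
proof -
  have "(exp \<circ> (\<lambda>z. u z - U $ 0)) has_fps_expansion (fps_exp 1 oo (U - fps_const (U $ 0)))"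
    by (intro has_fps_expansion_compose has_fps_expansion_exp1 fps_expansion_intros assms) simp
  then have "(\<lambda>z. exp (U $ 0) * exp (u z - U $ 0)) has_fps_expansion exp_fps U"
    unfolding exp_fps_def comp_def by (rule has_fps_expansion_cmult_left)
  then show ?thesis by (simp add: exp_diff)
qed

lemma exp_fps_nth_0: "exp_fps U $ 0 = exp (U $ 0)"
  by (simp add: exp_fps_def)

lemma exp_fps_deriv: "fps_deriv (exp_fps U) = fps_deriv U * exp_fps U"
  unfolding exp_fps_def by (simp add: fps_compose_deriv)

lemma u_fun_Re_nonneg:
  assumes \<sigma>: "circle_measure \<sigma>" and z: "norm z < 1"
  shows "0 \<le> Re (u_fun \<gamma> \<sigma> z)"
proof -
  have ne: "1 - t * z \<noteq> 0" if "t \<in> circle" for t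
  proof -
    have "norm (t * z) < 1" using that z by (simp add: norm_mult)
    then show ?thesis by auto
  qed
  have "integrable \<sigma> (\<lambda>t. (1 + t * z) / (1 - t * z))"
    by (intro circle_measure_integrable[OF \<sigma>] continuous_intros) (use ne in auto)
  then have "Re (u_fun \<gamma> \<sigma> z) = (LINT t|\<sigma>. Re ((1 + t * z) / (1 - t * z)))"
    by (simp add: u_fun_def)
  also have "\<dots> \<ge> 0"
  proof (rule Bochner_Integration.integral_nonneg)
    fix t assume "t \<in> space \<sigma>"
    then have t: "norm (t * z) \<le> 1" using z by (simp add: circle_measure_space[OF \<sigma>] norm_mult)
    have "Re ((1 + w) / (1 - w)) \<ge> 0" if "norm w \<le> 1" for w :: complex
    proof -
      have "(norm w)\<^sup>2 \<le> 1" using that by (simp add: abs_square_le_1)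
      then have "(Re w)\<^sup>2 + (Im w)\<^sup>2 \<le> 1" by (simp add: cmod_power2)
      then have "0 \<le> (1 + Re w) * (1 - Re w) - Im w * Im w" by (simp add: power2_eq_square algebra_simps)
      then show ?thesis by (simp add: Re_divide)
    qed
    from this[OF t] show "0 \<le> Re ((1 + t * z) / (1 - t * z))" .
  qed
  finally show ?thesis .
qed

lemma u_fun_holomorphic: "circle_measure \<sigma> \<Longrightarrow> u_fun \<gamma> \<sigma> holomorphic_on ball 0 1"
proof -
  assume \<sigma>: "circle_measure \<sigma>"
  have "psi \<sigma> holomorphic_on ball 0 1"
    by (rule power_series_holomorphic[where a = "\<lambda>k. psi_fps \<sigma> $ k"]) (use psi_sums[OF \<sigma>] in simp)
  then have "(\<lambda>z. - \<i> * of_real \<gamma> + mom \<sigma> 0 + 2 * psi \<sigma> z) holomorphic_on ball 0 1"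
    by (intro holomorphic_intros)
  then show ?thesis
    by (rule holomorphic_transform) (simp add: u_fun_eq[OF \<sigma>])
qed

section \<open>Herglotz measures and the existence of the limit laws\<close>

lemma holomorphic_disc_expansion:
  fixes f :: "complex \<Rightarrow> complex" and F :: "complex fps"
  assumes f: "f holomorphic_on ball 0 1" and F: "f has_fps_expansion F" and w: "norm w < 1"
  shows "(\<lambda>n. F $ n * w ^ n) sums f w"
  using holomorphic_power_series[OF f, of w] w by (simp add: fps_nth_fps_expansion[OF F])

text \<open>
  Fourier coefficients of a power series on a circle of radius \<open>r\<close>, traversed clockwise so that
  the coefficients match moments of a density in \<open>cis x\<close>.
\<close>

lemma integral_disc_circle:
  fixes f :: "complex \<Rightarrow> complex" and F :: "complex fps"
  assumes f: "f holomorphic_on ball 0 1" and F: "f has_fps_expansion F" and r: "0 < r" "r < 1"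
  shows "integral {0..2*pi} (\<lambda>x. f (of_real r * cis (- x)) * cis (of_int l * x)) =
     (if 0 \<le> l then 2 * pi * (F $ nat l * of_real r ^ nat l) else 0)"
proof -
  define g where "g n x = F $ n * (of_real r * cis (- x)) ^ n" for n x
  have gb: "norm (g n x) \<le> norm (F $ n * of_real r ^ n)" for n x
    by (simp add: g_def norm_mult norm_power)
  have sm: "summable (\<lambda>n. norm (F $ n * of_real r ^ n))"
  proof (rule powser_insidea[of _ "of_real ((r + 1) / 2)"])
    have "norm (of_real ((r + 1) / 2) :: complex) < 1" using r by (simp only: norm_of_real) auto
    from holomorphic_disc_expansion[OF f F this] show "summable (\<lambda>n. F $ n * of_real ((r + 1) / 2) ^ n)"
      by (rule sums_summable)
    show "norm (of_real r :: complex) < norm (of_real ((r + 1) / 2) :: complex)" using r by (simp only: norm_of_real) auto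
  qed
  have gs: "suminf (\<lambda>n. g n x) = f (of_real r * cis (- x))" for x
    using holomorphic_disc_expansion[OF f F, of "of_real r * cis (- x)"] r
    by (auto simp: g_def norm_mult sums_iff)
  have "uniform_limit {0..2*pi} (\<lambda>N x. sum (\<lambda>n. g n x) {..<N}) (\<lambda>x. suminf (\<lambda>n. g n x)) sequentially"
    by (rule Weierstrass_m_test[OF gb sm])
  then have ul: "uniform_limit {0..2*pi} (\<lambda>N x. sum (\<lambda>n. g n x) {..<N}) (\<lambda>x. f (of_real r * cis (- x))) sequentially"
    by (simp only: gs)
  have "uniform_limit {0..2*pi} (\<lambda>N x. sum (\<lambda>n. g n x) {..<N} * cis (of_int l * x)) (\<lambda>x. f (of_real r * cis (- x)) * cis (of_int l * x)) sequentially"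
  proof (rule uniform_lim_mult[OF ul uniform_limit_const])
    have "continuous_on (ball 0 1) f" using f by (rule holomorphic_on_imp_continuous_on)
    then have "continuous_on {0..2*pi} (\<lambda>x. f (of_real r * cis (- x)))"
      by (rule continuous_on_compose2) (use r in \<open>auto intro!: continuous_intros simp: norm_mult\<close>)
    then show "bounded ((\<lambda>x. f (of_real r * cis (- x))) ` {0..2*pi})"
      by (intro compact_imp_bounded compact_continuous_image) auto
    show "bounded ((\<lambda>x. cis (of_int l * x)) ` {0..2*pi})"
      by (auto simp: bounded_iff intro!: exI[of _ 1])
  qed
  then obtain I J where I: "\<And>N. ((\<lambda>x. sum (\<lambda>n. g n x) {..<N} * cis (of_int l * x)) has_integral I N) {0..2*pi}"
    and J: "((\<lambda>x. f (of_real r * cis (- x)) * cis (of_int l * x)) has_integral J) {0..2*pi}"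
    and IJ: "I \<longlonglongrightarrow> J"
    by (rule uniform_limit_integral) (auto intro!: continuous_intros simp: g_def)
  let ?v = "if 0 \<le> l then 2 * pi * (F $ nat l * of_real r ^ nat l) else 0"
  have IN: "I N = ?v" if N: "N > nat l" for N
  proof -
    have eq: "(\<lambda>x. sum (\<lambda>n. g n x) {..<N} * cis (of_int l * x)) = (\<lambda>x. \<Sum>n<N. (F $ n * of_real r ^ n) * cis (of_int (l - int n) * x))"
      by (simp add: g_def power_mult_distrib Complex.DeMoivre sum_distrib_left sum_distrib_right cis_mult mult.assoc algebra_simps)
    have "I N = integral {0..2*pi} (\<lambda>x. \<Sum>n<N. (F $ n * of_real r ^ n) * cis (of_int (l - int n) * x))"
      using I[of N] unfolding eq by (simp add: integral_unique)
    also have "\<dots> = (\<Sum>n<N. integral {0..2*pi} (\<lambda>x. (F $ n * of_real r ^ n) * cis (of_int (l - int n) * x)))"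
      by (rule integral_sum, simp, rule integrable_on_cis)
    also have "\<dots> = (\<Sum>n<N. if l = int n then 2 * pi * (F $ n * of_real r ^ n) else 0)"
      by (simp only: integral_cis_mult) simp
    also have "\<dots> = ?v"
    proof (cases "0 \<le> l")
      case True
      then have "(\<Sum>n<N. if l = int n then 2 * pi * (F $ n * of_real r ^ n) else 0) =
         (\<Sum>n<N. if n = nat l then 2 * pi * (F $ n * of_real r ^ n) else 0)"
        by (intro sum.cong) auto
      then show ?thesis using N True by simp
    next
      case False
      then show ?thesis by (auto intro!: sum.neutral)
    qed
    finally show ?thesis .
  qed
  have "I \<longlonglongrightarrow> ?v"
    by (rule tendsto_eventually, rule eventually_mono[OF eventually_gt_at_top[of "nat l"]]) (rule IN)
  then have "J = ?v" using IJ LIMSEQ_unique by blast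
  then show ?thesis using J by (simp add: integral_unique)
qed

text \<open>
  The function \<open>(1 + f) / (1 - f)\<close> has nonnegative real part and value \<open>1\<close> at the origin. On the circle of radius
  \<open>r\<close> its real part is therefore a probability density, with moments the coefficients of
  \<open>f / (1 - f)\<close> times powers of \<open>r\<close>; compactness allows \<open>r\<close> to tend to \<open>1\<close>.
\<close>

theorem herglotz_measure:
  fixes f :: "complex \<Rightarrow> complex" and F :: "complex fps"
  assumes f: "f holomorphic_on ball 0 1" and f1: "\<And>w. norm w < 1 \<Longrightarrow> norm (f w) < 1"
    and F: "f has_fps_expansion F" and F0: "F $ 0 = 0"
  shows "\<exists>\<mu>. circle_prob \<mu> \<and> psi_fps \<mu> = geo_fps oo F"
proof -
  define H where "H z = 1 + 2 * (f z * inverse (1 - f z))" for z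
  have ne: "1 - f w \<noteq> 0" if "norm w < 1" for w using f1[OF that] by auto
  have Hh: "H holomorphic_on ball 0 1"
    unfolding H_def by (intro holomorphic_intros f) (use ne in auto)
  define G where "G = geo_fps oo F"
  have G: "G = F * inverse (1 - F)"
    unfolding G_def by (subst geo_fps_eq)
       (simp add: geo_fps_inverse fps_compose_mult_distrib[OF F0] fps_inverse_compose[OF F0] fps_compose_sub_distrib F0)
  have HA: "H has_fps_expansion 1 + fps_const 2 * G"
    unfolding H_def G
    by (intro has_fps_expansion_add has_fps_expansion_1 has_fps_expansion_cmult_left has_fps_expansion_mult F
       has_fps_expansion_inverse has_fps_expansion_diff) (simp add: F0)
  have G0: "G $ 0 = 0" by (simp add: G F0)
  have Hpos: "0 \<le> Re (H w)" if w: "norm w < 1" for w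
  proof -
    have "(norm (f w))\<^sup>2 \<le> 1" using f1[OF w] by (simp add: abs_square_le_1)
    then have "(Re (f w))\<^sup>2 + (Im (f w))\<^sup>2 \<le> 1" by (simp add: cmod_power2)
    then have "0 \<le> (1 + Re (f w)) * (1 - Re (f w)) - Im (f w) * Im (f w)" by (simp add: power2_eq_square algebra_simps)
    moreover have "H w = (1 + f w) / (1 - f w)" using ne[OF w] by (simp add: H_def field_simps)
    ultimately show ?thesis by (simp add: Re_divide)
  qed
  have meas: "\<exists>\<mu>. circle_prob \<mu> \<and> (\<forall>k. mom \<mu> k = (if k = 0 then 1 else G $ k * of_real r ^ k))" if r: "0 < r" "r < 1" for r
  proof -
    define p where "p x = Re (H (of_real r * cis (- x)))" for x
    have "continuous_on (ball 0 1) H" using Hh by (rule holomorphic_on_imp_continuous_on)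
    then have Hc: "continuous_on {0..2*pi} (\<lambda>x. H (of_real r * cis (- x)))"
      by (rule continuous_on_compose2) (use r in \<open>auto intro!: continuous_intros simp: norm_mult\<close>)
    have int: "integral {0..2*pi} (\<lambda>x. of_real (p x) * cis x ^ k) = 2 * pi * (if k = 0 then 1 else G $ k * of_real r ^ k)" for k
    proof -
      let ?h = "\<lambda>l x. H (of_real r * cis (- x)) * cis (of_int l * x)"
      have i: "?h l integrable_on {0..2*pi}" for l
        by (intro integrable_continuous_real continuous_intros Hc)
      have eq: "of_real (p x) * cis x ^ k = (?h (int k) x + cnj (?h (- int k) x)) / 2" for x
        unfolding p_def Complex.DeMoivre
        by (simp add: cis_cnj Re_complex_div_eq_0 complex_add_cnj[symmetric] field_simps) (simp add: complex_eq_iff algebra_simps)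
      have "integral {0..2*pi} (\<lambda>x. of_real (p x) * cis x ^ k) =
         (integral {0..2*pi} (?h (int k)) + integral {0..2*pi} (\<lambda>x. cnj (?h (- int k) x))) / 2"
        unfolding eq using i[of "int k"] integrable_linear[OF i[of "- int k"] bounded_linear_cnj]
        by (simp only: Henstock_Kurzweil_Integration.integral_divide Henstock_Kurzweil_Integration.integral_add comp_def)
      also have "integral {0..2*pi} (\<lambda>x. cnj (?h (- int k) x)) = cnj (integral {0..2*pi} (?h (- int k)))"
        using integral_linear[OF i[of "- int k"] bounded_linear_cnj] by (simp only: comp_def)
      finally show ?thesis
        unfolding integral_disc_circle[OF Hh HA r] using G0 by auto
    qed
    have "integral {0..2*pi} (\<lambda>x. complex_of_real (p x)) = 2 * pi"
      using int[of 0] by simp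
    moreover have "integral {0..2*pi} (\<lambda>x. complex_of_real (p x)) = of_real (integral {0..2*pi} p)"
    proof -
      have "p integrable_on {0..2*pi}"
        unfolding p_def by (intro integrable_continuous_real continuous_intros Hc)
      from integral_linear[OF this bounded_linear_of_real] show ?thesis by (simp only: comp_def)
    qed
    ultimately have ip: "integral {0..2*pi} p = 2 * pi" by (metis of_real_eq_iff)
    have "\<exists>\<mu>. circle_prob \<mu> \<and>
      (\<forall>k. mom \<mu> k = integral {0..2*pi} (\<lambda>x. of_real (p x) * cis x ^ k) / (2 * pi))"
    proof (rule circle_density)
      show "continuous_on {0..2*pi} p" unfolding p_def by (intro continuous_intros Hc)
      show "0 \<le> p x" for x unfolding p_def using r by (intro Hpos) (simp add: norm_mult)
      show "integral {0..2*pi} p = 2 * pi" by (rule ip)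
    qed
    then show ?thesis unfolding int by simp
  qed
  have "\<exists>\<mu>. circle_prob \<mu> \<and> (\<forall>k. mom \<mu> k = (if k = 0 then 1 else G $ k * of_real (1 - inverse (real (Suc (Suc n)))) ^ k))" for n
    by (rule meas) (simp_all add: field_simps)
  then obtain \<mu> where \<mu>: "\<And>n. circle_prob (\<mu> n)"
    "\<And>n k. mom (\<mu> n) k = (if k = 0 then 1 else G $ k * of_real (1 - inverse (real (Suc (Suc n)))) ^ k)" by metis
  have "(\<lambda>n. mom (\<mu> n) k) \<longlonglongrightarrow> (if k = 0 then 1 else G $ k)" for k
  proof (cases "k = 0")
    case False
    have "(\<lambda>n. 1 - inverse (real (Suc (Suc n)))) \<longlonglongrightarrow> 1 - 0"
      using LIMSEQ_Suc[OF LIMSEQ_inverse_real_of_nat] by (intro tendsto_diff tendsto_const)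
    then have "(\<lambda>n. G $ k * of_real (1 - inverse (real (Suc (Suc n)))) ^ k) \<longlonglongrightarrow> G $ k * of_real (1 - 0) ^ k"
      by (intro tendsto_mult tendsto_const tendsto_power tendsto_of_real)
    then show ?thesis using False by (simp add: \<mu>(2))
  qed (simp add: \<mu>(2))
  from moment_limit[OF \<mu>(1) this] obtain \<nu> where "circle_prob \<nu>" "\<And>k. mom \<nu> k = (if k = 0 then 1 else G $ k)" by blast
  then have "circle_prob \<nu> \<and> psi_fps \<nu> = G"
    by (auto simp: psi_fps_def fps_eq_iff G0)
  then show ?thesis unfolding G_def by blast
qed

lemma fps_compose_cong_upto:
  fixes F G :: "complex fps"
  assumes "\<And>i. i \<le> k \<Longrightarrow> F $ i = G $ i"
  shows "(A oo F) $ k = (A oo G) $ k"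
proof -
  have "(F ^ i) $ j = (G ^ i) $ j" if "j \<le> k" for i j
    using that
  proof (induction i arbitrary: j)
    case (Suc i)
    then show ?case using assms by (simp add: fps_mult_nth)
  qed simp
  then show ?thesis by (simp add: fps_compose_nth)
qed

text \<open>
  The inverse function \<open>\<eta>\<close> of \<open>z exp (u z)\<close> should be \<open>\<psi> / (1 + \<psi>)\<close> of the measure. It is a fixed point
  of \<open>f \<mapsto> w exp (- u (f w))\<close>, and since \<open>u\<close> has nonnegative real part, the iterates map the disc into
  itself, so each is the \<open>\<psi> / (1 + \<psi>)\<close> of a measure. Their Taylor coefficients stabilize at those of
  \<open>\<eta>\<close>, and the measures have a limit by compactness.
\<close>

theorem nu_boxtimes:
  assumes \<sigma>: "circle_measure \<sigma>"
  shows "nu_boxtimes \<gamma> \<sigma> \<in> circle_prob_nz" "Sigma_fps (nu_boxtimes \<gamma> \<sigma>) = exp_fps (u_fps \<gamma> \<sigma>)"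
proof -
  define u where "u = u_fun \<gamma> \<sigma>"
  define U where "U = u_fps \<gamma> \<sigma>"
  define E where "E = exp_fps U"
  have u: "u has_fps_expansion U" unfolding u_def U_def by (rule u_expansion[OF \<sigma>])
  have uh: "u holomorphic_on ball 0 1" unfolding u_def by (rule u_fun_holomorphic[OF \<sigma>])
  have E: "(\<lambda>z. exp (u z)) has_fps_expansion E" unfolding E_def by (rule exp_fps_expansion[OF u])
  have E0: "E $ 0 \<noteq> 0" by (simp add: E_def exp_fps_nth_0)
  have Ei: "(\<lambda>z. exp (- u z)) has_fps_expansion inverse E"
    unfolding exp_minus by (intro has_fps_expansion_inverse E E0)
  \<comment> \<open>The expansion of the inverse function of \<open>z exp (u z)\<close>.\<close>
  define \<eta> where "\<eta> = fps_inv (fps_X * E)"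
  have XE: "(fps_X * E) $ 0 = 0" "(fps_X * E) $ 1 \<noteq> 0" using E0 by (simp_all add: fps_X_mult_nth)
  have \<eta>0: "\<eta> $ 0 = 0" by (simp add: \<eta>_def fps_inv_def)
  have \<eta>: "\<eta> = fps_X * (inverse E oo \<eta>)"
  proof -
    have "(fps_X * E) oo \<eta> = fps_X" unfolding \<eta>_def by (rule fps_inv_right[OF XE])
    then have "\<eta> * (E oo \<eta>) = fps_X" by (simp add: fps_compose_mult_distrib \<eta>0)
    then have "\<eta> * ((E oo \<eta>) * inverse (E oo \<eta>)) = fps_X * inverse (E oo \<eta>)" by (simp add: mult.assoc[symmetric])
    moreover have "(E oo \<eta>) * inverse (E oo \<eta>) = 1" using E0 by (intro inverse_mult_eq_1') simp
    ultimately show ?thesis by (simp add: fps_inverse_compose[OF \<eta>0 E0])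
  qed
  define f where "f = rec_nat (\<lambda>w. 0) (\<lambda>_ g w. w * exp (- u (g w)))"
  define Fn where "Fn = rec_nat 0 (\<lambda>_ G. fps_X * (inverse E oo G))"
  have f0: "f 0 = (\<lambda>w. 0)" and fS: "f (Suc n) = (\<lambda>w. w * exp (- u (f n w)))" for n
    by (simp_all add: f_def)
  have F0: "Fn 0 = 0" and FS: "Fn (Suc n) = fps_X * (inverse E oo Fn n)" for n
    by (simp_all add: Fn_def)
  have Fn0: "Fn n $ 0 = 0" for n by (cases n) (simp_all add: F0 FS)
  have fb: "norm (f n w) \<le> norm w" if w: "norm w < 1" for n w
  proof (induction n)
    case (Suc n)
    then have "norm (f n w) < 1" using w by linarith
    then have "0 \<le> Re (u (f n w))" unfolding u_def by (rule u_fun_Re_nonneg[OF \<sigma>])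
    then have "norm (exp (- u (f n w))) \<le> 1" by simp
    then show ?case using mult_left_mono[of _ 1 "norm w"] by (simp add: fS norm_mult)
  qed (simp add: f0)
  have fh: "f n holomorphic_on ball 0 1" for n
  proof (induction n)
    case (Suc n)
    have "(u \<circ> f n) holomorphic_on ball 0 1"
      using Suc uh fb[of _ n] by (intro holomorphic_on_compose_gen[of _ _ _ "ball 0 1"]) force+
    then have "(\<lambda>w. u (f n w)) holomorphic_on ball 0 1" by (simp add: comp_def)
    then show ?case unfolding fS by (intro holomorphic_intros)
  qed (simp add: f0)
  have fe: "f n has_fps_expansion Fn n" for n
  proof (induction n)
    case (Suc n)
    have "((\<lambda>z. exp (- u z)) \<circ> f n) has_fps_expansion (inverse E oo Fn n)"
      by (rule has_fps_expansion_compose[OF Ei Suc Fn0])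
    then show ?case unfolding fS FS comp_def by (intro has_fps_expansion_mult has_fps_expansion_fps_X)
  qed (simp add: f0 F0)
  have stab: "Fn n $ k = \<eta> $ k" if "k \<le> n" for n k
    using that
  proof (induction n arbitrary: k)
    case 0 then show ?case by (simp add: F0 \<eta>0)
  next
    case (Suc n)
    have "\<eta> $ k = (fps_X * (inverse E oo \<eta>)) $ k" using \<eta> by simp
    moreover have "(inverse E oo Fn n) $ (k - 1) = (inverse E oo \<eta>) $ (k - 1)" if "k \<noteq> 0"
      using Suc that by (intro fps_compose_cong_upto) auto
    ultimately show ?case by (auto simp: FS fps_X_mult_nth)
  qed
  have "\<exists>\<mu>. circle_prob \<mu> \<and> psi_fps \<mu> = geo_fps oo Fn n" for n
    by (rule herglotz_measure[OF fh _ fe Fn0]) (use fb le_less_trans in blast)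
  then obtain \<mu> where \<mu>: "\<And>n. circle_prob (\<mu> n)" "\<And>n. psi_fps (\<mu> n) = geo_fps oo Fn n" by metis
  have "(\<lambda>n. mom (\<mu> n) k) \<longlonglongrightarrow> (if k = 0 then 1 else (geo_fps oo \<eta>) $ k)" for k
  proof (rule tendsto_eventually, rule eventually_mono[OF eventually_ge_at_top[of k]])
    fix n assume n: "k \<le> n"
    have "psi_fps (\<mu> n) $ k = (geo_fps oo \<eta>) $ k"
      unfolding \<mu>(2) using stab n by (intro fps_compose_cong_upto) auto
    then show "mom (\<mu> n) k = (if k = 0 then 1 else (geo_fps oo \<eta>) $ k)"
      using mom_0[OF \<mu>(1)[of n]] by (auto simp: psi_fps_def)
  qed
  from moment_limit[OF \<mu>(1) this] obtain \<nu> where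
    \<nu>: "circle_prob \<nu>" "\<And>k. mom \<nu> k = (if k = 0 then 1 else (geo_fps oo \<eta>) $ k)" by blast
  then have psi: "psi_fps \<nu> = geo_fps oo \<eta>"
    by (auto simp: psi_fps_def fps_eq_iff geo_fps_nth)
  have "\<eta> $ 1 \<noteq> 0"
  proof -
    have "\<eta> $ 1 = (fps_X * (inverse E oo \<eta>)) $ 1" using \<eta> by simp
    then show ?thesis using E0 by (simp add: fps_X_mult_nth)
  qed
  then have 1: "mom \<nu> 1 \<noteq> 0"
    by (simp add: \<nu>(2) fps_compose_nth geo_fps_nth)
  have "\<eta> oo (fps_X * E) = fps_X" unfolding \<eta>_def by (rule fps_inv[OF XE])
  then have "psi_fps \<nu> oo (fps_X * E) = geo_fps"
    unfolding psi by (subst fps_compose_assoc[symmetric]) (simp_all add: \<eta>0)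
  then have S: "Sigma_fps \<nu> = E" by (rule Sigma_fps_unique[OF 1])
  have nz: "\<nu> \<in> circle_prob_nz" by (rule circle_prob_nzI[OF \<nu>(1) 1])
  have iff: "(\<forall>\<^sub>F z in at 0. Sigma_transform \<rho> z = exp (u_fun \<gamma> \<sigma> z)) \<longleftrightarrow> Sigma_fps \<rho> = E" if "\<rho> \<in> circle_prob_nz" for \<rho>
    using that Sigma_transform_germ[OF _ _ E] circle_prob_nzD circle_prob_measure unfolding u_def by blast
  have "nu_boxtimes \<gamma> \<sigma> = \<nu>"
    unfolding nu_boxtimes_def
  proof (rule the_equality)
    show "\<nu> \<in> circle_prob_nz \<and> (\<forall>\<^sub>F z in at 0. Sigma_transform \<nu> z = exp (u_fun \<gamma> \<sigma> z))"
      using iff[OF nz] nz S by simp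
    fix \<rho> assume "\<rho> \<in> circle_prob_nz \<and> (\<forall>\<^sub>F z in at 0. Sigma_transform \<rho> z = exp (u_fun \<gamma> \<sigma> z))"
    then show "\<rho> = \<nu>" using iff[of \<rho>] S nz by (intro circle_prob_nz_eqI) auto
  qed
  then show "nu_boxtimes \<gamma> \<sigma> \<in> circle_prob_nz" "Sigma_fps (nu_boxtimes \<gamma> \<sigma>) = exp_fps (u_fps \<gamma> \<sigma>)"
    using nz S by (simp_all add: E_def U_def)
qed

section \<open>Logarithmic derivatives\<close>

definition logder :: "complex fps \<Rightarrow> complex fps" where
  "logder F = fps_deriv F * inverse F"

lemma logder_mult_self: "F $ 0 \<noteq> 0 \<Longrightarrow> logder F * F = fps_deriv F"
  by (simp add: logder_def mult.assoc inverse_mult_eq_1)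

lemma logder_unique: "F $ 0 \<noteq> 0 \<Longrightarrow> L * F = fps_deriv F \<Longrightarrow> logder F = L"
  using logder_mult_self[of F] by (metis fps_nonzero_nth mult_right_cancel)

lemma logder_mult:
  assumes "F $ 0 \<noteq> 0" "G $ 0 \<noteq> 0"
  shows "logder (F * G) = logder F + logder G"
  by (rule logder_unique) (use assms in \<open>simp_all add: algebra_simps logder_mult_self[symmetric]\<close>)

lemma logder_const_mult: "c \<noteq> 0 \<Longrightarrow> F $ 0 \<noteq> 0 \<Longrightarrow> logder (fps_const c * F) = logder F"
  by (subst logder_mult) (auto simp: logder_def)

lemma logder_prod:
  assumes "finite A" "\<And>j. j \<in> A \<Longrightarrow> F j $ 0 \<noteq> 0"
  shows "(\<Prod>j\<in>A. F j) $ 0 = (\<Prod>j\<in>A. F j $ 0)" "logder (\<Prod>j\<in>A. F j) = (\<Sum>j\<in>A. logder (F j))"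
  using assms by (induction A rule: finite_induct) (auto simp: logder_mult logder_def[of 1])

text \<open>
  Comparing coefficients in \<open>F' = L F\<close> gives a recursion for the coefficients of \<open>F\<close> in terms of
  \<open>F $ 0\<close> and \<open>L\<close>, and another one for those of \<open>L\<close> in terms of \<open>F\<close>.
\<close>

theorem ctends_iff_logder:
  assumes F: "\<forall>\<^sub>F n in sequentially. F n $ 0 \<noteq> 0" and G: "G $ 0 \<noteq> 0"
  shows "ctends F G \<longleftrightarrow> (\<lambda>n. F n $ 0) \<longlonglongrightarrow> G $ 0 \<and> ctends (\<lambda>n. logder (F n)) (logder G)"
proof (intro iffI conjI)
  assume FG: "ctends F G"
  show F0: "(\<lambda>n. F n $ 0) \<longlonglongrightarrow> G $ 0" using FG by (simp add: ctends_def)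
  have rec: "logder H $ k = (fps_deriv H $ k - (\<Sum>i<k. logder H $ i * H $ (k - i))) / H $ 0" if H: "H $ 0 \<noteq> 0" for H k
  proof -
    have "{0..k} = insert k {..<k}" by auto
    then have "fps_deriv H $ k = logder H $ k * H $ 0 + (\<Sum>i<k. logder H $ i * H $ (k - i))"
      using arg_cong[OF logder_mult_self[OF H], of "\<lambda>f. f $ k"] by (simp add: fps_mult_nth del: fps_deriv_nth)
    then show ?thesis using H by (simp del: fps_deriv_nth)
  qed
  have "(\<lambda>n. logder (F n) $ k) \<longlonglongrightarrow> logder G $ k" for k
  proof (induction k rule: less_induct)
    case (less k)
    have "(\<lambda>n. (fps_deriv (F n) $ k - (\<Sum>i<k. logder (F n) $ i * F n $ (k - i))) / F n $ 0) \<longlonglongrightarrow> logder G $ k"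
      unfolding rec[OF G, of k] using less.IH FG G unfolding ctends_def fps_deriv_nth
      by (intro tendsto_intros) auto
    then show ?case
      by (rule Lim_transform_eventually) (rule eventually_mono[OF F], rule rec[symmetric])
  qed
  then show "ctends (\<lambda>n. logder (F n)) (logder G)" by (simp add: ctends_def)
next
  assume *: "(\<lambda>n. F n $ 0) \<longlonglongrightarrow> G $ 0 \<and> ctends (\<lambda>n. logder (F n)) (logder G)"
  have rec: "H $ Suc k = (\<Sum>i=0..k. logder H $ i * H $ (k - i)) / of_nat (Suc k)" if H: "H $ 0 \<noteq> 0" for H k
  proof -
    have "of_nat (Suc k) \<noteq> (0 :: complex)" by (simp del: of_nat_Suc)
    moreover have "(\<Sum>i=0..k. logder H $ i * H $ (k - i)) = fps_deriv H $ k"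
      by (simp only: fps_mult_nth[symmetric] logder_mult_self[OF H])
    ultimately show ?thesis by (simp del: of_nat_Suc)
  qed
  have "(\<lambda>n. F n $ k) \<longlonglongrightarrow> G $ k" for k
  proof (induction k rule: less_induct)
    case (less k)
    show ?case
    proof (cases k)
      case 0 then show ?thesis using * by simp
    next
      case (Suc j)
      have "of_nat (Suc j) \<noteq> (0 :: complex)" by (simp del: of_nat_Suc)
      then have "(\<lambda>n. (\<Sum>i=0..j. logder (F n) $ i * F n $ (j - i)) / of_nat (Suc j)) \<longlonglongrightarrow> G $ k"
        unfolding Suc rec[OF G, of j] using less.IH * unfolding ctends_def Suc
        by (intro tendsto_intros) auto
      then show ?thesis
        by (rule Lim_transform_eventually) (rule eventually_mono[OF F], unfold Suc, rule rec[symmetric])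
    qed
  qed
  then show "ctends F G" by (simp add: ctends_def)
qed

lemma logder_exp_fps: "logder (exp_fps U) = fps_deriv U"
  by (rule logder_unique) (simp_all add: exp_fps_nth_0 exp_fps_deriv)

section \<open>The row measures\<close>

definition tilt :: "complex measure \<Rightarrow> nat \<Rightarrow> complex" where
  "tilt \<mu> i = (LINT t|\<mu>. of_real (1 - Re t) * t ^ i)"

text \<open>
  The set function defining a row measure is the sum of the measures with densities
  \<open>1 - Re t\<close>. Linearity of the integral in the measure is verified by induction on integrable
  functions; the case of limits uses dominated convergence.
\<close>

lemma row_measure:
  fixes c :: "nat \<Rightarrow> complex measure" and m :: nat
  assumes c: "\<And>j. 1 \<le> j \<Longrightarrow> j \<le> m \<Longrightarrow> circle_prob (c j)"
  defines "S \<equiv> measure_of circle (sets circle_borel)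
     (\<lambda>A. \<Sum>j=1..m. \<integral>\<^sup>+t\<in>A. ennreal (1 - Re t) \<partial>c j)"
  shows "circle_measure S" "mom S i = (\<Sum>j=1..m. tilt (c j) i)"
proof -
  define D where "D j = density (c j) (\<lambda>t. ennreal (1 - Re t))" for j
  have rm: "(\<lambda>t. ennreal (1 - Re t)) \<in> borel_measurable circle_borel"
    by (intro measurable_compose[OF _ measurable_ennreal] borel_measurable_continuous_on_restrict continuous_intros)
  have cs: "sets (c j) = sets circle_borel" if "j \<in> {1..m}" for j using c that by (auto simp: circle_prob_def)
  have rm': "(\<lambda>t. ennreal (1 - Re t)) \<in> borel_measurable (c j)" if "j \<in> {1..m}" for j
    using rm measurable_cong_sets[OF cs[OF that] refl] by blast
  have Ds: "sets (D j) = sets circle_borel" if "j \<in> {1..m}" for j using cs[OF that] by (simp add: D_def)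
  have De: "emeasure (D j) A = (\<integral>\<^sup>+t\<in>A. ennreal (1 - Re t) \<partial>c j)" if "j \<in> {1..m}" "A \<in> sets circle_borel" for j A
    unfolding D_def using that cs rm' by (intro emeasure_density) auto
  have fin: "circle_measure (D j)" if j: "j \<in> {1..m}" for j
  proof -
    have cp: "circle_prob (c j)" using c j by simp
    interpret prob_space "c j" using cp by (simp add: circle_prob_def)
    have "emeasure (D j) (space (D j)) = (\<integral>\<^sup>+t. ennreal (1 - Re t) \<partial>c j)"
      unfolding D_def using rm'[OF j] by (simp add: emeasure_density cong: nn_integral_cong)
    also have "\<dots> \<le> (\<integral>\<^sup>+t. 2 \<partial>c j)"
    proof (rule nn_integral_mono)
      fix t assume "t \<in> space (c j)"
      then have "norm t = 1" by (simp add: circle_prob_space[OF cp])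
      then have "1 - Re t \<le> 2" using abs_Re_le_cmod[of t] by simp
      then show "ennreal (1 - Re t) \<le> 2" using ennreal_leI[of "1 - Re t" 2] by simp
    qed
    also have "\<dots> < \<infinity>" by (simp add: emeasure_space_1 ennreal_mult_less_top)
    finally show ?thesis using Ds[OF j] by (auto simp: circle_measure_def intro: finite_measureI)
  qed
  have S_sets: "sets S = sets circle_borel"
  proof -
    have cs: "space circle_borel = circle" by (simp add: space_restrict_space)
    have "sets S = sigma_sets (space circle_borel) (sets circle_borel)"
      unfolding S_def using sets.space_closed[of circle_borel] by (simp only: cs sets_measure_of)
    then show ?thesis by (simp only: sets.sigma_sets_eq)
  qed
  have S_em: "emeasure S A = (\<Sum>j=1..m. emeasure (D j) A)" if A: "A \<in> sets circle_borel" for A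
  proof -
    have "emeasure S A = (\<Sum>j=1..m. \<integral>\<^sup>+t\<in>A. ennreal (1 - Re t) \<partial>c j)"
    proof (rule emeasure_measure_of[OF S_def[THEN meta_eq_to_obj_eq]])
      show "sets circle_borel \<subseteq> Pow circle" using sets.space_closed[of circle_borel] by (simp add: space_restrict_space)
      show "A \<in> sets S" using A S_sets by simp
      show "positive (sets S) (\<lambda>A. \<Sum>j=1..m. \<integral>\<^sup>+t\<in>A. ennreal (1 - Re t) \<partial>c j)"
        by (simp add: positive_def)
      show "countably_additive (sets S) (\<lambda>A. \<Sum>j=1..m. \<integral>\<^sup>+t\<in>A. ennreal (1 - Re t) \<partial>c j)"
      proof (rule countably_additiveI)
        fix B :: "nat \<Rightarrow> complex set"
        assume B: "range B \<subseteq> sets S" "disjoint_family B" "\<Union> (range B) \<in> sets S"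
        have Bs: "B i \<in> sets circle_borel" "\<Union> (range B) \<in> sets circle_borel" for i using B S_sets by auto
        have "suminf (\<lambda>i. \<Sum>j=1..m. \<integral>\<^sup>+t\<in>B i. ennreal (1 - Re t) \<partial>c j) = suminf (\<lambda>i. \<Sum>j=1..m. emeasure (D j) (B i))"
          by (intro arg_cong[of _ _ suminf] ext sum.cong refl De[symmetric] Bs)
        also have "\<dots> = (\<Sum>j=1..m. suminf (\<lambda>i. emeasure (D j) (B i)))"
          by (rule suminf_sum) simp
        also have "\<dots> = (\<Sum>j=1..m. emeasure (D j) (\<Union> (range B)))"
          using B Ds Bs by (intro sum.cong refl suminf_emeasure) auto
        also have "\<dots> = (\<Sum>j=1..m. \<integral>\<^sup>+t\<in>\<Union> (range B). ennreal (1 - Re t) \<partial>c j)"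
          by (intro sum.cong refl De Bs)
        finally show "suminf (\<lambda>i. \<Sum>j=1..m. \<integral>\<^sup>+t\<in>B i. ennreal (1 - Re t) \<partial>c j) =
          (\<Sum>j=1..m. \<integral>\<^sup>+t\<in>\<Union> (range B). ennreal (1 - Re t) \<partial>c j)" .
      qed
    qed
    also have "\<dots> = (\<Sum>j=1..m. emeasure (D j) A)" by (intro sum.cong refl De[symmetric] A)
    finally show ?thesis .
  qed
  have Ssp: "space S = circle" using sets_eq_imp_space_eq[OF S_sets] by (simp add: space_restrict_space)
  have cb: "circle \<in> sets circle_borel" by (metis sets.top space_restrict_space Int_UNIV_right space_borel)
  show Sm: "circle_measure S"
    unfolding circle_measure_def
  proof (intro conjI S_sets finite_measureI)
    have "emeasure (D j) circle \<noteq> \<infinity>" if "j \<in> {1..m}" for j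
      using fin[OF that] by (auto simp: circle_measure_def finite_measure.emeasure_finite)
    then show "emeasure S (space S) \<noteq> \<infinity>" by (simp add: S_em cb Ssp)
  qed
  have intS: "(\<forall>j\<in>{1..m}. integrable (D j) f) \<and> (LINT t|S. f t) = (\<Sum>j=1..m. LINT t|D j. f t)"
    if "integrable S f" for f :: "complex \<Rightarrow> complex"
    using that
  proof (induction rule: integrable_induct)
    case (base A x)
    have A: "A \<in> sets circle_borel" using base S_sets by simp
    have Sfin: "emeasure (D j) A \<noteq> \<infinity>" if "j \<in> {1..m}" for j
      using fin[OF that] by (auto simp: circle_measure_def finite_measure.emeasure_finite)
    have Am: "A \<in> sets (D j)" "emeasure (D j) A < \<infinity>" if "j \<in> {1..m}" for j
      using A Ds[OF that] Sfin[OF that] by (simp_all add: less_top)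
    have "ennreal (measure S A) = ennreal (\<Sum>j=1..m. measure (D j) A)"
      using S_em[OF A] Sfin fin Sm
      by (simp add: circle_measure_def finite_measure.emeasure_eq_measure[symmetric] sum_ennreal[symmetric])
    then have "measure S A = (\<Sum>j=1..m. measure (D j) A)" by (simp add: sum_nonneg)
    then show ?case
      using Am base by (auto simp: scaleR_sum_left)
  next
    case (add f g)
    then show ?case by (auto simp: sum.distrib)
  next
    case (lim f s)
    have le: "(\<integral>\<^sup>+t. ennreal (norm (f t)) \<partial>D j) \<le> (\<integral>\<^sup>+t. ennreal (norm (f t)) \<partial>S)" if j: "j \<in> {1..m}" for j
    proof (rule nn_integral_mono_measure)
      show "sets (D j) = sets S" using Ds[OF j] S_sets by simp
      show "D j \<le> S"
      proof (rule le_measure[THEN iffD2])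
        show "sets (D j) = sets S" using Ds[OF j] S_sets by simp
        show "\<forall>A\<in>sets (D j). emeasure (D j) A \<le> emeasure S A"
          using Ds[OF j] j by (auto simp: S_em intro!: member_le_sum)
      qed
    qed
    have fm: "f \<in> borel_measurable (D j)" if "j \<in> {1..m}" for j
      using borel_measurable_integrable[OF lim.hyps(4)] measurable_cong_sets[of "D j" S] Ds[OF that] S_sets by blast
    have fi: "integrable (D j) f" if j: "j \<in> {1..m}" for j
    proof (rule integrableI_bounded[OF fm[OF j]])
      have "(\<integral>\<^sup>+t. ennreal (norm (f t)) \<partial>S) < \<infinity>" using lim.hyps(4) by (simp add: integrable_iff_bounded)
      then show "(\<integral>\<^sup>+t. ennreal (norm (f t)) \<partial>D j) < \<infinity>" using le[OF j] by (rule le_less_trans[rotated])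
    qed
    have conv: "(\<lambda>i. LINT t|N. s i t) \<longlonglongrightarrow> (LINT t|N. f t)" if "integrable N f" "\<And>i. integrable N (s i)" "space N = circle" for N
    proof (rule integral_dominated_convergence[where w = "\<lambda>t. 2 * norm (f t)"])
      show "f \<in> borel_measurable N" "\<And>i. s i \<in> borel_measurable N" "integrable N (\<lambda>t. 2 * norm (f t))" using that by auto
      show "AE x in N. (\<lambda>i. s i x) \<longlonglongrightarrow> f x" using lim.hyps(2) that(3) Ssp by auto
      show "\<And>i. AE x in N. norm (s i x) \<le> 2 * norm (f x)" using lim.hyps(3) that(3) Ssp by auto
    qed
    have "(\<lambda>i. LINT t|S. s i t) \<longlonglongrightarrow> (LINT t|S. f t)" by (rule conv[OF lim.hyps(4,1) Ssp])
    moreover have "(\<lambda>i. \<Sum>j=1..m. LINT t|D j. s i t) \<longlonglongrightarrow> (\<Sum>j=1..m. LINT t|D j. f t)"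
      using lim.IH fi fin circle_measure_space by (intro tendsto_sum conv) auto
    ultimately have "(LINT t|S. f t) = (\<Sum>j=1..m. LINT t|D j. f t)"
      using lim.IH by (auto intro: LIMSEQ_unique)
    then show ?case using fi by auto
  qed
  have "mom S i = (\<Sum>j=1..m. LINT t|D j. t ^ i)"
    unfolding mom_def
    by (rule conjunct2[OF intS], rule circle_measure_integrable[OF Sm]) (intro continuous_intros)
  also have "\<dots> = (\<Sum>j=1..m. tilt (c j) i)"
  proof (rule sum.cong[OF refl])
    fix j assume j: "j \<in> {1..m}"
    have cp: "circle_prob (c j)" using c j by simp
    have "(LINT t|D j. t ^ i) = (LINT t|c j. (1 - Re t) *\<^sub>R t ^ i)"
      unfolding D_def
    proof (rule integral_density)
      show "(\<lambda>t. t ^ i) \<in> borel_measurable (c j)" "(\<lambda>t. 1 - Re t) \<in> borel_measurable (c j)"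
        using cs[OF j] by (auto intro!: circle_measurable continuous_intros)
      show "AE t in c j. 0 \<le> 1 - Re t"
      proof (rule AE_I2)
        fix t assume "t \<in> space (c j)"
        then have "norm t = 1" by (simp add: circle_prob_space[OF cp])
        then show "0 \<le> 1 - Re t" using complex_Re_le_cmod[of t] by simp
      qed
    qed
    then show "(LINT t|D j. t ^ i) = tilt (c j) i" by (simp add: tilt_def scaleR_conv_of_real)
  qed
  finally show "mom S i = (\<Sum>j=1..m. tilt (c j) i)" .
qed

section \<open>Linearization at the unit mass\<close>

text \<open>
  The expansion of \<open>u\<close> for the measure \<open>(1 - Re t) d\<mu>\<close> and \<open>\<gamma> = \<integral> Im t d\<mu>\<close>. It is the first
  order approximation of the logarithm of the Sigma-transform near the unit mass at \<open>1\<close>.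
\<close>

definition tilt_fps :: "complex measure \<Rightarrow> complex fps" where
  "tilt_fps \<mu> = Abs_fps (\<lambda>i. if i = 0 then 1 - mom \<mu> 1 else 2 * tilt \<mu> i)"

context
  fixes \<mu> :: "complex measure"
  assumes \<mu>: "circle_prob \<mu>"
begin

lemma circle_int: "continuous_on circle f \<Longrightarrow> integrable \<mu> f"
  for f :: "complex \<Rightarrow> 'b::{banach, second_countable_topology}"
  by (rule circle_prob_integrable[OF \<mu>])

lemma one_minus_Re_nonneg: "t \<in> circle \<Longrightarrow> 0 \<le> 1 - Re t"
  using complex_Re_le_cmod[of t] by simp

lemma spread_nonneg: "0 \<le> spread \<mu>"
  unfolding spread_def
  by (rule Bochner_Integration.integral_nonneg) (use one_minus_Re_nonneg circle_prob_space[OF \<mu>] in auto)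

lemma tilt_0: "tilt \<mu> 0 = of_real (spread \<mu>)"
  unfolding tilt_def spread_def power_0 mult_1_right by (rule integral_complex_of_real)

lemma tilt_bound: "norm (tilt \<mu> i) \<le> spread \<mu>"
proof -
  have "norm (tilt \<mu> i) \<le> (LINT t|\<mu>. norm (of_real (1 - Re t) * t ^ i))"
    unfolding tilt_def by (rule integral_norm_bound)
  also have "\<dots> = spread \<mu>"
    unfolding spread_def
  proof (rule Bochner_Integration.integral_cong[OF refl])
    fix t assume "t \<in> space \<mu>"
    then have t: "t \<in> circle" by (simp add: circle_prob_space[OF \<mu>])
    then show "norm (of_real (1 - Re t) * t ^ i) = 1 - Re t"
      using one_minus_Re_nonneg[OF t] by (simp only: norm_mult norm_of_real norm_power) simp
  qed
  finally show ?thesis .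
qed

lemma one_minus_mom: "1 - mom \<mu> 1 = of_real (spread \<mu>) - \<i> * of_real (imbalance \<mu>)"
proof -
  interpret prob_space \<mu> using \<mu> by (simp add: circle_prob_def)
  have "Re (mom \<mu> 1) = (LINT t|\<mu>. Re t)" "Im (mom \<mu> 1) = imbalance \<mu>"
    unfolding mom_def imbalance_def using circle_int[of "\<lambda>t. t"] by (simp_all add: continuous_on_id)
  moreover have "spread \<mu> = 1 - (LINT t|\<mu>. Re t)"
    unfolding spread_def
    by (subst Bochner_Integration.integral_diff) (auto simp: prob_space intro!: circle_int continuous_intros)
  ultimately show ?thesis by (simp add: complex_eq_iff)
qed

lemma tilt_Suc: "2 * tilt \<mu> (Suc i) = 2 * mom \<mu> (Suc i) - mom \<mu> (Suc (Suc i)) - mom \<mu> i"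
proof -
  have "2 * tilt \<mu> (Suc i) = (LINT t|\<mu>. 2 * (of_real (1 - Re t) * t ^ Suc i))"
    unfolding tilt_def by simp
  also have "\<dots> = (LINT t|\<mu>. 2 * t ^ Suc i - t ^ Suc (Suc i) - t ^ i)"
  proof (rule Bochner_Integration.integral_cong[OF refl])
    fix t assume "t \<in> space \<mu>"
    then have t: "t * cnj t = 1" by (simp add: circle_prob_space[OF \<mu>] complex_norm_square[symmetric])
    have "2 * of_real (1 - Re t) = 2 - t - cnj t" by (simp add: complex_eq_iff)
    then have "2 * (of_real (1 - Re t) * t ^ Suc i) = (2 - t - cnj t) * t ^ Suc i" by (simp only: mult.assoc[symmetric])
    also have "\<dots> = 2 * t ^ Suc i - t ^ Suc (Suc i) - (t * cnj t) * t ^ i" by (simp add: algebra_simps)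
    finally show "2 * (of_real (1 - Re t) * t ^ Suc i) = 2 * t ^ Suc i - t ^ Suc (Suc i) - t ^ i" by (simp add: t)
  qed
  also have "\<dots> = 2 * mom \<mu> (Suc i) - mom \<mu> (Suc (Suc i)) - mom \<mu> i"
    unfolding mom_def
    by (subst Bochner_Integration.integral_diff, (intro circle_int continuous_intros)+)
       (subst Bochner_Integration.integral_diff, (intro circle_int continuous_intros)+, simp)
  finally show ?thesis .
qed

text \<open>
  Second differences of the moments are integrals of \<open>t\<^sup>k (2 - t - cnj t)\<close>, by \<open>tilt_Suc\<close>.
  So \<open>z / (1 - z) - \<psi>(z)\<close>, multiplied by \<open>(1 - z)\<^sup>2\<close>, is \<open>z\<close> times the tilted series.
\<close>

lemma psi_fps_tilt: "psi_fps \<mu> = geo_fps - fps_X * tilt_fps \<mu> * (1 + geo_fps) ^ 2"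
proof -
  define D where "D = geo_fps - psi_fps \<mu>"
  have Dn: "D $ k = 1 - mom \<mu> k" for k
    using mom_0[OF \<mu>] by (auto simp: D_def geo_fps_def psi_fps_def)
  have r: "(1 + geo_fps) * (1 - fps_X) = 1"
    using geo_fps_eq by (simp add: algebra_simps)
  have "D - fps_X * D - (fps_X * D - fps_X * (fps_X * D)) = fps_X * tilt_fps \<mu>"
  proof (rule fps_ext)
    fix k
    consider "k = 0" | "k = 1" | i where "k = Suc (Suc i)" by (metis One_nat_def not0_implies_Suc)
    then show "(D - fps_X * D - (fps_X * D - fps_X * (fps_X * D))) $ k = (fps_X * tilt_fps \<mu>) $ k"
      by cases (simp_all add: fps_X_mult_nth Dn tilt_fps_def mom_0[OF \<mu>] tilt_Suc)
  qed
  then have "(1 - fps_X) ^ 2 * D = fps_X * tilt_fps \<mu>"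
    by (simp add: power2_eq_square algebra_simps)
  then have "((1 + geo_fps) * (1 - fps_X)) ^ 2 * D = fps_X * tilt_fps \<mu> * (1 + geo_fps) ^ 2"
    by (simp add: power_mult_distrib mult_ac)
  then have "D = fps_X * tilt_fps \<mu> * (1 + geo_fps) ^ 2"
    by (simp only: r power_one mult_1_left)
  then show ?thesis by (simp only: D_def) (simp add: algebra_simps)
qed

text \<open>
  The squared modulus is \<open>(1 - \<delta>)\<^sup>2 + \<beta>\<^sup>2\<close> with \<open>\<delta>\<close> the spread and \<open>\<beta>\<close> the imbalance, hence at most
  \<open>1 - 2 \<delta> + (1 + C\<^sup>2) \<delta>\<^sup>2\<close>, which is at most \<open>1 - \<delta>\<close>.
\<close>

lemma mom_1_decay:
  assumes "\<bar>imbalance \<mu>\<bar> \<le> C * spread \<mu>" "(1 + C\<^sup>2) * spread \<mu> \<le> 1"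
  shows "norm (mom \<mu> 1) \<le> exp (- spread \<mu> / 2)"
proof -
  define d where "d = spread \<mu>"
  have m: "mom \<mu> 1 = of_real (1 - d) + \<i> * of_real (imbalance \<mu>)"
    using one_minus_mom by (simp add: d_def algebra_simps)
  have d0: "0 \<le> d" unfolding d_def by (rule spread_nonneg)
  have "(imbalance \<mu>)\<^sup>2 \<le> (C * d)\<^sup>2"
    using assms(1) by (intro power2_le_iff_abs_le[THEN iffD2]) (auto simp: d_def)
  then have "(norm (mom \<mu> 1))\<^sup>2 \<le> (1 - d)\<^sup>2 + C\<^sup>2 * d\<^sup>2"
    unfolding m cmod_power2 by (simp add: power_mult_distrib)
  also have "\<dots> = 1 - 2 * d + (1 + C\<^sup>2) * d * d" by (simp add: power2_eq_square algebra_simps)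
  also have "\<dots> \<le> 1 - 2 * d + 1 * d"
    using assms(2) d0 by (intro add_left_mono mult_right_mono) (auto simp: d_def)
  also have "\<dots> \<le> exp (- d)" using exp_ge_add_one_self[of "- d"] by simp
  also have "\<dots> = (exp (- d / 2))\<^sup>2" by (simp add: exp_double[symmetric])
  finally show ?thesis unfolding d_def[symmetric] by (rule power2_le_imp_le) simp
qed

end

lemma inverse_exp_bound:
  fixes h :: complex
  assumes "norm h \<le> 1 / 2"
  shows "norm (exp (- h) / (1 - h) - 1) \<le> 4 * (norm h)\<^sup>2"
proof -
  have n: "1 / 2 \<le> norm (1 - h)" using norm_triangle_ineq2[of 1 h] assms by simp
  then have ne: "1 - h \<noteq> 0" by auto
  have "norm (exp (- h) - (\<Sum>k\<le>1. (- h) ^ k / fact k)) \<le> exp \<bar>Re (- h)\<bar> * (norm (- h) ^ Suc 1) / fact 1"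
    by (rule Taylor_exp)
  then have "norm (exp (- h) - (1 - h)) \<le> exp \<bar>Re h\<bar> * (norm h)\<^sup>2"
    by (simp add: power2_eq_square)
  also have "exp \<bar>Re h\<bar> \<le> 2"
  proof -
    have "\<bar>Re h\<bar> \<le> 1 / 2" using abs_Re_le_cmod[of h] assms by linarith
    then have "exp \<bar>Re h\<bar> \<le> exp (1 / 2)" by simp
    also have "\<dots> \<le> 2" using exp_bound_half[of "1/2 :: real"] by simp
    finally show ?thesis .
  qed
  finally have 1: "norm (exp (- h) - (1 - h)) \<le> 2 * (norm h)\<^sup>2"
    by (simp add: mult_right_mono)
  have "exp (- h) / (1 - h) - 1 = (exp (- h) - (1 - h)) / (1 - h)" using ne by (simp add: field_simps)
  then have "norm (exp (- h) / (1 - h) - 1) = norm (exp (- h) - (1 - h)) / norm (1 - h)" by (simp only: norm_divide)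
  also have "\<dots> \<le> (2 * (norm h)\<^sup>2) / (1 / 2)"
    using 1 n by (intro frac_le) auto
  finally show ?thesis by simp
qed

lemma prod_one_plus_bound:
  fixes e :: "nat \<Rightarrow> complex"
  shows "norm ((\<Prod>j\<in>A. 1 + e j) - 1) \<le> exp (\<Sum>j\<in>A. norm (e j)) - 1"
proof -
  have "norm ((\<Prod>j\<in>A. 1 + e j) - 1) \<le> (\<Prod>j\<in>A. 1 + norm (e j)) - 1"
    by (rule norm_prod_minus1_le_prod_minus1)
  also have "(\<Prod>j\<in>A. 1 + norm (e j)) \<le> (\<Prod>j\<in>A. exp (norm (e j)))"
    by (rule prod_mono) (auto simp: exp_ge_add_one_self)
  also have "\<dots> = exp (\<Sum>j\<in>A. norm (e j))"
    by (induction A rule: infinite_finite_induct) (auto simp: exp_add)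
  finally show ?thesis by simp
qed

section \<open>Triangular arrays\<close>

text \<open>
  The positions of the array with the row tending to infinity: orders of magnitude along this filter
  are uniform over each row.
\<close>

definition array_filter :: "(nat \<Rightarrow> nat) \<Rightarrow> (nat \<times> nat) filter" where
  "array_filter k = inf (filtercomap fst sequentially) (principal {(n, j). 1 \<le> n \<and> 1 \<le> j \<and> j \<le> k n})"

lemma eventually_array_filter:
  "eventually P (array_filter k) \<longleftrightarrow> (\<forall>\<^sub>F n in sequentially. \<forall>j. 1 \<le> j \<and> j \<le> k n \<longrightarrow> P (n, j))"
proof
  assume "eventually P (array_filter k)"
  then obtain Q where Q: "eventually Q sequentially"
    "\<And>x. Q (fst x) \<Longrightarrow> x \<in> {(n, j). 1 \<le> n \<and> 1 \<le> j \<and> j \<le> k n} \<longrightarrow> P x"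
    unfolding array_filter_def eventually_inf_principal eventually_filtercomap by blast
  show "\<forall>\<^sub>F n in sequentially. \<forall>j. 1 \<le> j \<and> j \<le> k n \<longrightarrow> P (n, j)"
    using Q(1) eventually_ge_at_top[of 1] by eventually_elim (use Q(2) in force)
next
  assume "\<forall>\<^sub>F n in sequentially. \<forall>j. 1 \<le> j \<and> j \<le> k n \<longrightarrow> P (n, j)"
  then show "eventually P (array_filter k)"
    unfolding array_filter_def eventually_inf_principal eventually_filtercomap by fastforce
qed

lemma infinitesimal_uniform:
  assumes "infinitesimal_array k \<nu>" "0 < \<epsilon>"
  shows "\<forall>\<^sub>F n in sequentially. \<forall>j. 1 \<le> j \<and> j \<le> k n \<longrightarrow> measure (\<nu> n j) {t \<in> circle. \<bar>Arg t\<bar> \<ge> \<epsilon>} \<le> \<epsilon>"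
proof -
  have "(\<lambda>n. MAX j\<in>{1..k n}. measure (\<nu> n j) {t \<in> circle. \<bar>Arg t\<bar> \<ge> \<epsilon>}) \<longlonglongrightarrow> 0"
    using assms unfolding infinitesimal_array_def by blast
  then have "\<forall>\<^sub>F n in sequentially. (MAX j\<in>{1..k n}. measure (\<nu> n j) {t \<in> circle. \<bar>Arg t\<bar> \<ge> \<epsilon>}) < \<epsilon>"
    using assms(2) by (rule order_tendstoD(2))
  then show ?thesis
  proof eventually_elim
    case (elim n)
    show ?case
    proof (intro allI impI)
      fix j assume j: "1 \<le> j \<and> j \<le> k n"
      have "measure (\<nu> n j) {t \<in> circle. \<bar>Arg t\<bar> \<ge> \<epsilon>} \<le> (MAX j\<in>{1..k n}. measure (\<nu> n j) {t \<in> circle. \<bar>Arg t\<bar> \<ge> \<epsilon>})"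
        by (rule Max_ge) (use j in auto)
      then show "measure (\<nu> n j) {t \<in> circle. \<bar>Arg t\<bar> \<ge> \<epsilon>} \<le> \<epsilon>" using elim by linarith
    qed
  qed
qed

lemma foldr_conv:
  assumes "\<And>\<mu>. \<mu> \<in> set ms \<Longrightarrow> \<mu> \<in> circle_prob_nz" "\<rho> \<in> circle_prob_nz"
  shows "foldr (\<boxtimes>) ms \<rho> \<in> circle_prob_nz"
    "Sigma_fps (foldr (\<boxtimes>) ms \<rho>) = prod_list (map Sigma_fps ms) * Sigma_fps \<rho>"
  using assms by (induction ms) (auto simp: free_mult_conv mult.assoc)

lemma Sigma_fps_nz: "\<mu> \<in> circle_prob_nz \<Longrightarrow> Sigma_fps \<mu> $ 0 = 1 / mom \<mu> 1 \<and> Sigma_fps \<mu> $ 0 \<noteq> 0"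
  using Sigma_fps_nth_0[of \<mu>] circle_prob_nzD(2)[of \<mu>] by (auto simp: field_simps)

lemma centered_nz:
  assumes "\<nu> \<in> circle_prob_nz"
  shows "centered \<tau> \<nu> \<in> circle_prob_nz"
    "Sigma_fps \<nu> = fps_const (1 / centering \<tau> \<nu>) * Sigma_fps (centered \<tau> \<nu>)"
proof -
  have \<nu>: "circle_prob \<nu>" "mom \<nu> 1 \<noteq> 0" using assms circle_prob_nzD by auto
  have b: "centering \<tau> \<nu> \<noteq> 0" using centering_circle[OF \<nu>(1), of \<tau>] by auto
  have 1: "mom (centered \<tau> \<nu>) 1 \<noteq> 0" using mom_centered[OF \<nu>(1), of 1 \<tau>] \<nu>(2) by auto
  show "centered \<tau> \<nu> \<in> circle_prob_nz"
    by (rule circle_prob_nzI[OF circle_prob_centered[OF \<nu>(1)] 1])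
  show "Sigma_fps \<nu> = fps_const (1 / centering \<tau> \<nu>) * Sigma_fps (centered \<tau> \<nu>)"
    by (rule rotate_Sigma[OF 1 b mom_centered[OF \<nu>(1)]])
qed

section \<open>Products over the rows of an array\<close>

lemma sum_squares_small:
  fixes d :: "nat \<Rightarrow> nat \<Rightarrow> real"
  assumes nonneg: "\<forall>\<^sub>F n in sequentially. \<forall>j\<in>{1..k n}. 0 \<le> d n j"
    and small: "\<And>\<eta>. 0 < \<eta> \<Longrightarrow> \<forall>\<^sub>F n in sequentially. \<forall>j\<in>{1..k n}. d n j \<le> \<eta>"
    and bound: "\<forall>\<^sub>F n in sequentially. (\<Sum>j=1..k n. d n j) \<le> B"
  shows "(\<lambda>n. \<Sum>j=1..k n. (d n j)\<^sup>2) \<longlonglongrightarrow> 0"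
proof (rule tendstoI)
  fix \<epsilon> :: real assume \<epsilon>: "0 < \<epsilon>"
  define \<eta> where "\<eta> = \<epsilon> / (2 * (\<bar>B\<bar> + 1))"
  have \<eta>: "0 < \<eta>" using \<epsilon> by (simp add: \<eta>_def)
  show "\<forall>\<^sub>F n in sequentially. dist (\<Sum>j=1..k n. (d n j)\<^sup>2) 0 < \<epsilon>"
    using nonneg small[OF \<eta>] bound
  proof eventually_elim
    case (elim n)
    have "(\<Sum>j=1..k n. (d n j)\<^sup>2) \<le> (\<Sum>j=1..k n. \<eta> * d n j)"
      using elim by (intro sum_mono) (auto simp: power2_eq_square intro!: mult_right_mono)
    also have "\<dots> = \<eta> * (\<Sum>j=1..k n. d n j)" by (simp add: sum_distrib_left)
    also have "\<dots> \<le> \<eta> * (\<bar>B\<bar> + 1)" using elim \<eta> by (intro mult_left_mono) auto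
    also have "\<dots> = \<epsilon> / 2" by (simp add: \<eta>_def field_simps)
    also have "\<dots> < \<epsilon>" using \<epsilon> by simp
    finally show ?case by (simp add: sum_nonneg)
  qed
qed

text \<open>
  Used to bound the masses of the row measures under either assertion of the limit theorem.
\<close>

lemma exp_bound_imp_bounded:
  fixes D :: "nat \<Rightarrow> real" and G :: "nat \<Rightarrow> complex"
  assumes "G \<longlonglongrightarrow> g" "\<forall>\<^sub>F n in sequentially. exp (D n / 2) \<le> norm (G n)"
  obtains B where "\<forall>\<^sub>F n in sequentially. D n \<le> B"
proof
  have "(\<lambda>n. norm (G n)) \<longlonglongrightarrow> norm g" using assms(1) by (rule tendsto_norm)
  then have "\<forall>\<^sub>F n in sequentially. norm (G n) < norm g + 1" by (rule order_tendstoD) simp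
  with assms(2) show "\<forall>\<^sub>F n in sequentially. D n \<le> 2 * ln (norm g + 1)"
  proof eventually_elim
    case (elim n)
    then have "exp (D n / 2) \<le> norm g + 1" by simp
    moreover have "0 < norm g + 1" by (simp add: add_nonneg_pos)
    ultimately have "D n / 2 \<le> ln (norm g + 1)" by (simp only: ln_ge_iff)
    then show ?case by simp
  qed
qed

context
  fixes k :: "nat \<Rightarrow> nat" and c :: "nat \<Rightarrow> nat \<Rightarrow> complex measure" and C :: real
  assumes nz: "\<And>n j. 1 \<le> n \<Longrightarrow> 1 \<le> j \<Longrightarrow> j \<le> k n \<Longrightarrow> c n j \<in> circle_prob_nz"
    and small: "\<And>\<eta>. 0 < \<eta> \<Longrightarrow> \<forall>\<^sub>F n in sequentially. \<forall>j. 1 \<le> j \<and> j \<le> k n \<longrightarrow> spread (c n j) \<le> \<eta>"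
    and imb: "\<forall>\<^sub>F n in sequentially. \<forall>j. 1 \<le> j \<and> j \<le> k n \<longrightarrow> \<bar>imbalance (c n j)\<bar> \<le> C * spread (c n j)"
begin

lemma row_prob: "1 \<le> n \<Longrightarrow> j \<in> {1..k n} \<Longrightarrow> circle_prob (c n j)"
  using nz circle_prob_nzD(1) by auto

lemma one_minus_mom_bound:
  assumes "circle_prob \<mu>" "\<bar>imbalance \<mu>\<bar> \<le> C * spread \<mu>"
  shows "norm (1 - mom \<mu> 1) \<le> (1 + C) * spread \<mu>"
proof -
  have "norm (1 - mom \<mu> 1) \<le> norm (complex_of_real (spread \<mu>)) + norm (\<i> * of_real (imbalance \<mu>))"
    unfolding one_minus_mom[OF assms(1)] by (rule norm_triangle_ineq4)
  also have "\<dots> = spread \<mu> + \<bar>imbalance \<mu>\<bar>"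
    using spread_nonneg[OF assms(1)] by (simp add: norm_mult)
  finally show ?thesis using assms(2) by (simp add: algebra_simps)
qed

lemma logder_Sigma_approx:
  obtains K where "\<forall>\<^sub>F n in sequentially. \<forall>j. 1 \<le> j \<and> j \<le> k n \<longrightarrow>
    norm (logder (Sigma_fps (c n j)) $ i - fps_deriv (tilt_fps (c n j)) $ i) \<le> K * (spread (c n j))\<^sup>2"
proof -
  define Ix where "Ix = {(n, j). 1 \<le> n \<and> 1 \<le> j \<and> j \<le> k n}"
  define M where "M m = c (fst m) (snd m)" for m
  define S where "S m = (if m \<in> Ix then Sigma_fps (M m) else 1)" for m
  define h where "h m = (if m \<in> Ix then tilt_fps (M m) else 0)" for m
  define L where "L m = (if m \<in> Ix then logder (Sigma_fps (M m)) else 0)" for m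
  have Mnz: "M m \<in> circle_prob_nz" if "m \<in> Ix" for m using that nz by (auto simp: Ix_def M_def)
  have evI: "\<forall>\<^sub>F m in array_filter k. m \<in> Ix"
    unfolding eventually_array_filter using eventually_ge_at_top[of 1] by eventually_elim (auto simp: Ix_def)
  have evC: "\<forall>\<^sub>F m in array_filter k. \<bar>imbalance (M m)\<bar> \<le> C * spread (M m)"
    unfolding eventually_array_filter M_def using imb by simp
  have "cO (array_filter k) (\<lambda>m. L m - fps_deriv (h m)) (\<lambda>m. of_real (spread (M m)) * of_real (spread (M m)))"
  proof (rule Sigma_linearization)
    show "((\<lambda>m. spread (M m)) \<longlongrightarrow> 0) (array_filter k)"
    proof (rule tendstoI)
      fix \<epsilon> :: real assume "0 < \<epsilon>"
      then have "\<forall>\<^sub>F m in array_filter k. spread (M m) \<le> \<epsilon> / 2"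
        unfolding eventually_array_filter M_def using small[of "\<epsilon> / 2"] by simp
      with evI show "\<forall>\<^sub>F m in array_filter k. dist (spread (M m)) 0 < \<epsilon>"
      proof eventually_elim
        case (elim m)
        then show ?case using spread_nonneg[OF circle_prob_nzD(1)[OF Mnz]] \<open>0 < \<epsilon>\<close> by simp
      qed
    qed
    show "cO (array_filter k) h (\<lambda>m. of_real (spread (M m)))"
      unfolding cO_def
    proof
      fix i
      show "(\<lambda>m. h m $ i) \<in> O[array_filter k](\<lambda>m. of_real (spread (M m)))"
      proof (rule bigoI)
        show "\<forall>\<^sub>F m in array_filter k. norm (h m $ i) \<le> (if i = 0 then 1 + C else 2) * norm (complex_of_real (spread (M m)))"
          using evI evC
        proof eventually_elim
          case (elim m)
          have cp: "circle_prob (M m)" using Mnz circle_prob_nzD(1) elim by blast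
          show ?case
            using elim one_minus_mom_bound[OF cp] tilt_bound[OF cp, of i] spread_nonneg[OF cp]
            by (simp add: h_def tilt_fps_def norm_mult)
        qed
      qed
    qed
    show "(1 - fps_X * S m) * (S m - 1) = S m * (h m oo (fps_X * S m)) * (1 - fps_X)" for m
      using Sigma_equation[OF psi_fps_tilt[OF circle_prob_nzD(1)[OF Mnz]] psi_fps_X_Sigma[OF circle_prob_nzD(2)[OF Mnz]]]
      by (simp add: S_def h_def)
    show "L m * S m = fps_deriv (S m)" for m
      using logder_mult_self[OF conjunct2[OF Sigma_fps_nz[OF Mnz]]] by (simp add: L_def S_def)
  qed
  then have "(\<lambda>m. (L m - fps_deriv (h m)) $ i) \<in> O[array_filter k](\<lambda>m. of_real (spread (M m)) * of_real (spread (M m)))"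
    by (simp only: cO_def)
  then obtain K where "\<forall>\<^sub>F m in array_filter k. norm ((L m - fps_deriv (h m)) $ i) \<le>
      K * norm (complex_of_real (spread (M m)) * of_real (spread (M m)))"
    by (elim landau_o.bigE)
  with evI have "\<forall>\<^sub>F m in array_filter k. norm (logder (Sigma_fps (M m)) $ i - fps_deriv (tilt_fps (M m)) $ i) \<le> K * (spread (M m))\<^sup>2"
    by eventually_elim (simp add: L_def h_def norm_mult power2_eq_square)
  then show ?thesis
    using that[of K] unfolding eventually_array_filter M_def by simp
qed

lemma row_spread_nonneg: "\<forall>\<^sub>F n in sequentially. \<forall>j\<in>{1..k n}. 0 \<le> spread (c n j)"
  using eventually_ge_at_top[of 1] by eventually_elim (use row_prob spread_nonneg in blast)

lemma row_squares:
  assumes "\<forall>\<^sub>F n in sequentially. (\<Sum>j=1..k n. spread (c n j)) \<le> B"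
  shows "(\<lambda>n. \<Sum>j=1..k n. (spread (c n j))\<^sup>2) \<longlonglongrightarrow> 0"
proof (rule sum_squares_small[OF row_spread_nonneg _ assms])
  fix \<eta> :: real assume "0 < \<eta>"
  from small[OF this] show "\<forall>\<^sub>F n in sequentially. \<forall>j\<in>{1..k n}. spread (c n j) \<le> \<eta>"
    by (rule eventually_mono) auto
qed

text \<open>
  The error is of the order of the sum of the squared spreads, that is, of the largest spread
  times a bounded sum.
\<close>

lemma logder_sum_approx:
  assumes "\<forall>\<^sub>F n in sequentially. (\<Sum>j=1..k n. spread (c n j)) \<le> B"
  shows "(\<lambda>n. (\<Sum>j=1..k n. logder (Sigma_fps (c n j))) $ i - (\<Sum>j=1..k n. fps_deriv (tilt_fps (c n j))) $ i) \<longlonglongrightarrow> 0"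
proof -
  obtain K where K: "\<forall>\<^sub>F n in sequentially. \<forall>j. 1 \<le> j \<and> j \<le> k n \<longrightarrow>
    norm (logder (Sigma_fps (c n j)) $ i - fps_deriv (tilt_fps (c n j)) $ i) \<le> K * (spread (c n j))\<^sup>2"
    by (rule logder_Sigma_approx)
  show ?thesis
  proof (rule Lim_null_comparison)
    show "(\<lambda>n. K * (\<Sum>j=1..k n. (spread (c n j))\<^sup>2)) \<longlonglongrightarrow> 0"
      using tendsto_mult_right_zero[OF row_squares[OF assms]] .
    show "\<forall>\<^sub>F n in sequentially. norm ((\<Sum>j=1..k n. logder (Sigma_fps (c n j))) $ i -
        (\<Sum>j=1..k n. fps_deriv (tilt_fps (c n j))) $ i) \<le> K * (\<Sum>j=1..k n. (spread (c n j))\<^sup>2)"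
      using K
    proof eventually_elim
      case (elim n)
      show ?case
        unfolding fps_sum_nth sum_subtractf[symmetric] sum_distrib_left
        by (rule sum_norm_le) (use elim in simp)
    qed
  qed
qed

text \<open>
  The constant terms. Each factor is \<open>exp (- h) / (1 - h)\<close> with \<open>h\<close> of the order of the spread, hence
  \<open>1\<close> up to a squared spread.
\<close>

lemma prod_Sigma_approx:
  assumes "\<forall>\<^sub>F n in sequentially. (\<Sum>j=1..k n. spread (c n j)) \<le> B"
  shows "(\<lambda>n. \<Prod>j=1..k n. exp (- (1 - mom (c n j) 1)) * Sigma_fps (c n j) $ 0) \<longlonglongrightarrow> 1"
proof -
  define h where "h n j = 1 - mom (c n j) 1" for n j
  define e where "e n j = exp (- h n j) / (1 - h n j) - 1" for n j
  define Q where "Q n = (\<Sum>j=1..k n. (spread (c n j))\<^sup>2)" for n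
  have "(\<lambda>n. (\<Prod>j=1..k n. exp (- h n j) * Sigma_fps (c n j) $ 0) - 1) \<longlonglongrightarrow> 0"
  proof (rule Lim_null_comparison)
    have "(\<lambda>n. exp (4 * (1 + C)\<^sup>2 * Q n) - 1) \<longlonglongrightarrow> exp (4 * (1 + C)\<^sup>2 * 0) - 1"
      unfolding Q_def by (intro tendsto_intros row_squares[OF assms])
    then show "(\<lambda>n. exp (4 * (1 + C)\<^sup>2 * Q n) - 1) \<longlonglongrightarrow> 0" by simp
    have "0 < 1 / (2 * (1 + \<bar>C\<bar>))" by simp
    from small[OF this] imb eventually_ge_at_top[of 1]
    show "\<forall>\<^sub>F n in sequentially. norm ((\<Prod>j=1..k n. exp (- h n j) * Sigma_fps (c n j) $ 0) - 1)
        \<le> exp (4 * (1 + C)\<^sup>2 * Q n) - 1"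
    proof eventually_elim
      case (elim n)
      have eb: "norm (e n j) \<le> 4 * (1 + C)\<^sup>2 * (spread (c n j))\<^sup>2" if j: "j \<in> {1..k n}" for j
      proof -
        have cp: "circle_prob (c n j)" using row_prob elim j by blast
        have hb: "norm (h n j) \<le> (1 + C) * spread (c n j)"
          unfolding h_def using elim j by (intro one_minus_mom_bound[OF cp]) auto
        also have "\<dots> \<le> (1 + \<bar>C\<bar>) * spread (c n j)"
          using spread_nonneg[OF cp] by (intro mult_right_mono) auto
        also have "\<dots> \<le> (1 + \<bar>C\<bar>) * (1 / (2 * (1 + \<bar>C\<bar>)))"
          using elim j by (intro mult_left_mono) auto
        also have "\<dots> = 1 / 2" by (simp add: field_simps)
        finally have "norm (e n j) \<le> 4 * (norm (h n j))\<^sup>2"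
          unfolding e_def by (rule inverse_exp_bound)
        also have "\<dots> \<le> 4 * ((1 + C) * spread (c n j))\<^sup>2"
          using hb by (intro mult_left_mono power_mono) auto
        finally show ?thesis by (simp add: power_mult_distrib)
      qed
      have "(\<Prod>j=1..k n. exp (- h n j) * Sigma_fps (c n j) $ 0) = (\<Prod>j=1..k n. 1 + e n j)"
      proof (rule prod.cong[OF refl])
        fix j assume "j \<in> {1..k n}"
        then have "c n j \<in> circle_prob_nz" using nz elim by auto
        then show "exp (- h n j) * Sigma_fps (c n j) $ 0 = 1 + e n j"
          using Sigma_fps_nz[of "c n j"] by (simp add: e_def h_def)
      qed
      then have "norm ((\<Prod>j=1..k n. exp (- h n j) * Sigma_fps (c n j) $ 0) - 1) \<le> exp (\<Sum>j=1..k n. norm (e n j)) - 1"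
        by (simp only: prod_one_plus_bound)
      also have "(\<Sum>j=1..k n. norm (e n j)) \<le> 4 * (1 + C)\<^sup>2 * Q n"
        unfolding Q_def sum_distrib_left by (rule sum_mono) (rule eb)
      finally show ?case by simp
    qed
  qed
  then show ?thesis unfolding h_def by (simp only: Lim_null[symmetric])
qed

text \<open>
  The lower bound that lets the convolutions control the masses: their first moments would tend to
  zero if the spreads of a row had unbounded sums.
\<close>

lemma prod_Sigma_growth:
  "\<forall>\<^sub>F n in sequentially. exp ((\<Sum>j=1..k n. spread (c n j)) / 2) \<le> norm (\<Prod>j=1..k n. Sigma_fps (c n j) $ 0)"
proof -
  have "0 < 1 / (1 + C\<^sup>2)" by (simp add: add_pos_nonneg)
  from small[OF this] imb eventually_ge_at_top[of 1] show ?thesis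
  proof eventually_elim
    case (elim n)
    have "exp ((\<Sum>j=1..k n. spread (c n j)) / 2) = (\<Prod>j=1..k n. exp (spread (c n j) / 2))"
      by (simp add: exp_sum sum_divide_distrib)
    also have "\<dots> \<le> (\<Prod>j=1..k n. norm (Sigma_fps (c n j) $ 0))"
    proof (intro prod_mono conjI)
      fix j assume j: "j \<in> {1..k n}"
      have cp: "circle_prob (c n j)" using row_prob elim j by blast
      have p: "0 < 1 + C\<^sup>2" by (simp add: add_pos_nonneg)
      have "spread (c n j) \<le> 1 / (1 + C\<^sup>2)" using elim j by auto
      then have "(1 + C\<^sup>2) * spread (c n j) \<le> 1" using p by (simp add: field_simps)
      then have "norm (mom (c n j) 1) \<le> exp (- spread (c n j) / 2)"
        using elim j by (intro mom_1_decay[OF cp]) auto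
      moreover have m: "c n j \<in> circle_prob_nz" using nz elim j by auto
      ultimately have "inverse (exp (- spread (c n j) / 2)) \<le> inverse (norm (mom (c n j) 1))"
        using circle_prob_nzD(2)[OF m] by (intro le_imp_inverse_le) auto
      then show "exp (spread (c n j) / 2) \<le> norm (Sigma_fps (c n j) $ 0)"
        using Sigma_fps_nz[OF m] by (simp add: exp_minus norm_divide inverse_eq_divide)
    qed simp
    finally show ?case by (simp add: prod_norm)
  qed
qed

text \<open>
  The constant term and the logarithmic derivative of the product over a row are compared with
  \<open>exp (U n $ 0)\<close> and the derivative of \<open>U n\<close>. Both comparisons need bounded sums of spreads; each
  side of the equivalence provides the bound through the modulus of the constant term.
\<close>

theorem array_limit:
  fixes \<theta> :: "nat \<Rightarrow> real" and V :: "complex fps"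
  defines "U \<equiv> \<lambda>n. fps_const (- \<i> * of_real (\<theta> n)) + (\<Sum>j=1..k n. tilt_fps (c n j))"
  shows "ctends (\<lambda>n. fps_const (exp (- \<i> * of_real (\<theta> n))) * (\<Prod>j=1..k n. Sigma_fps (c n j))) (exp_fps V) \<longleftrightarrow>
    (\<lambda>n. exp (U n $ 0)) \<longlonglongrightarrow> exp (V $ 0) \<and> ctends (\<lambda>n. fps_deriv (U n)) (fps_deriv V)"
    (is "ctends ?F _ \<longleftrightarrow> ?U0 \<and> ?U1")
proof -
  define D where "D n = (\<Sum>j=1..k n. spread (c n j))" for n
  define P where "P n = (\<Prod>j=1..k n. exp (- (1 - mom (c n j) 1)) * Sigma_fps (c n j) $ 0)" for n
  have nz': "Sigma_fps (c n j) $ 0 \<noteq> 0" if "1 \<le> n" "j \<in> {1..k n}" for n j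
    using conjunct2[OF Sigma_fps_nz[OF nz]] that by auto
  have F0: "?F n $ 0 = exp (- \<i> * of_real (\<theta> n)) * (\<Prod>j=1..k n. Sigma_fps (c n j) $ 0)" if "1 \<le> n" for n
    using logder_prod(1)[of "{1..k n}" "\<lambda>j. Sigma_fps (c n j)"] nz'[OF that] by simp
  have F1: "logder (?F n) = (\<Sum>j=1..k n. logder (Sigma_fps (c n j)))" if "1 \<le> n" for n
    using logder_prod[of "{1..k n}" "\<lambda>j. Sigma_fps (c n j)"] nz'[OF that] by (subst logder_const_mult) auto
  have U0: "U n $ 0 = - \<i> * of_real (\<theta> n) + (\<Sum>j=1..k n. 1 - mom (c n j) 1)" for n
    by (simp add: U_def fps_sum_nth tilt_fps_def)
  have U1: "fps_deriv (U n) = (\<Sum>j=1..k n. fps_deriv (tilt_fps (c n j)))" for n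
    by (simp add: U_def fps_deriv_sum)
  have FU: "?F n $ 0 = exp (U n $ 0) * P n" if "1 \<le> n" for n
  proof -
    have "exp (\<Sum>j=1..k n. 1 - mom (c n j) 1) * P n = (\<Prod>j=1..k n. Sigma_fps (c n j) $ 0)"
      unfolding P_def exp_sum[OF finite_atLeastAtMost] prod.distrib[symmetric]
      by (intro prod.cong refl) (simp add: mult.assoc[symmetric] exp_add[symmetric])
    then show ?thesis unfolding F0[OF that] U0 exp_add by (simp only: mult.assoc)
  qed
  have Unorm: "norm (exp (U n $ 0)) = exp (D n)" if "1 \<le> n" for n
  proof -
    have "Re (U n $ 0) = (\<Sum>j=1..k n. Re (1 - mom (c n j) 1))" by (simp add: U0)
    also have "\<dots> = D n"
      unfolding D_def by (intro sum.cong refl) (subst one_minus_mom[OF row_prob[OF that]], auto)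
    finally show ?thesis by simp
  qed
  have D0: "\<forall>\<^sub>F n in sequentially. 0 \<le> D n"
    using row_spread_nonneg unfolding D_def by eventually_elim (auto intro: sum_nonneg)
  have ev1: "\<forall>\<^sub>F n in sequentially. 1 \<le> (n :: nat)" by (rule eventually_ge_at_top)
  have equiv: "((\<lambda>n. ?F n $ 0) \<longlonglongrightarrow> exp (V $ 0)) = ?U0"
      "ctends (\<lambda>n. logder (?F n)) (fps_deriv V) = ?U1"
    if B: "\<forall>\<^sub>F n in sequentially. D n \<le> B" for B
  proof -
    have P1: "P \<longlonglongrightarrow> 1" unfolding P_def by (rule prod_Sigma_approx) (use B in \<open>simp add: D_def\<close>)
    have P0: "\<forall>\<^sub>F n in sequentially. P n \<noteq> 0" using tendsto_imp_eventually_ne[OF P1] by simp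
    show "((\<lambda>n. ?F n $ 0) \<longlonglongrightarrow> exp (V $ 0)) = ?U0"
    proof
      assume "(\<lambda>n. ?F n $ 0) \<longlonglongrightarrow> exp (V $ 0)"
      then have "(\<lambda>n. ?F n $ 0 / P n) \<longlonglongrightarrow> exp (V $ 0) / 1" by (intro tendsto_divide P1) simp_all
      then have "(\<lambda>n. ?F n $ 0 / P n) \<longlonglongrightarrow> exp (V $ 0)" by simp
      then show ?U0
        by (rule Lim_transform_eventually) (use P0 ev1 in \<open>eventually_elim, simp only: FU, simp\<close>)
    next
      assume ?U0
      then have "(\<lambda>n. exp (U n $ 0) * P n) \<longlonglongrightarrow> exp (V $ 0) * 1" by (intro tendsto_mult P1)
      then have "(\<lambda>n. exp (U n $ 0) * P n) \<longlonglongrightarrow> exp (V $ 0)" by simp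
      then show "(\<lambda>n. ?F n $ 0) \<longlonglongrightarrow> exp (V $ 0)"
        by (rule Lim_transform_eventually) (use ev1 in \<open>eventually_elim, simp only: FU\<close>)
    qed
    have diff: "(\<lambda>n. logder (?F n) $ i - fps_deriv (U n) $ i) \<longlonglongrightarrow> 0" for i
    proof (rule Lim_transform_eventually)
      show "(\<lambda>n. (\<Sum>j=1..k n. logder (Sigma_fps (c n j))) $ i - (\<Sum>j=1..k n. fps_deriv (tilt_fps (c n j))) $ i) \<longlonglongrightarrow> 0"
        by (rule logder_sum_approx) (use B in \<open>simp add: D_def\<close>)
      show "\<forall>\<^sub>F n in sequentially. (\<Sum>j=1..k n. logder (Sigma_fps (c n j))) $ i - (\<Sum>j=1..k n. fps_deriv (tilt_fps (c n j))) $ i =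
          logder (?F n) $ i - fps_deriv (U n) $ i"
        using ev1 by eventually_elim (simp only: F1 U1)
    qed
    have "((\<lambda>n. logder (?F n) $ i) \<longlonglongrightarrow> fps_deriv V $ i) = ((\<lambda>n. fps_deriv (U n) $ i) \<longlonglongrightarrow> fps_deriv V $ i)" for i
      using Lim_transform[OF _ diff[of i]] Lim_transform2[OF _ diff[of i]] by blast
    then show "ctends (\<lambda>n. logder (?F n)) (fps_deriv V) = ?U1" unfolding ctends_def by simp
  qed
  have "ctends ?F (exp_fps V) \<longleftrightarrow>
      (\<lambda>n. ?F n $ 0) \<longlonglongrightarrow> exp (V $ 0) \<and> ctends (\<lambda>n. logder (?F n)) (fps_deriv V)"
  proof -
    have "\<forall>\<^sub>F n in sequentially. ?F n $ 0 \<noteq> 0"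
      using ev1 by eventually_elim (simp only: F0, use nz' in auto)
    then show ?thesis by (subst ctends_iff_logder) (simp_all add: exp_fps_nth_0 logder_exp_fps)
  qed
  moreover have "\<exists>B. \<forall>\<^sub>F n in sequentially. D n \<le> B" if "(\<lambda>n. ?F n $ 0) \<longlonglongrightarrow> exp (V $ 0)"
  proof -
    have "\<forall>\<^sub>F n in sequentially. exp (D n / 2) \<le> norm (?F n $ 0)"
      using ev1 prod_Sigma_growth by eventually_elim (simp only: F0, simp add: norm_mult D_def)
    with that show ?thesis by (rule exp_bound_imp_bounded) blast
  qed
  moreover have "\<exists>B. \<forall>\<^sub>F n in sequentially. D n \<le> B" if ?U0
  proof -
    have "\<forall>\<^sub>F n in sequentially. exp (D n / 2) \<le> norm (exp (U n $ 0))"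
      using ev1 D0 by eventually_elim (simp only: Unorm, simp)
    with that show ?thesis by (rule exp_bound_imp_bounded) blast
  qed
  ultimately show ?thesis using equiv by meson
qed

end

lemma prod_fps_const: "(\<Prod>j\<in>A. fps_const (f j)) = fps_const (\<Prod>j\<in>A. f j)"
  for f :: "'a \<Rightarrow> complex"
  by (induction A rule: infinite_finite_induct) auto

text \<open>
  A complex number different from zero is recovered continuously from the logarithm of its modulus and from its phase.
\<close>

lemma polar_limit:
  fixes D g :: "nat \<Rightarrow> real"
  shows "(\<lambda>n. exp (complex_of_real (D n) - \<i> * of_real (g n))) \<longlonglongrightarrow> exp (complex_of_real d - \<i> * of_real \<gamma>) \<longleftrightarrow>
    D \<longlonglongrightarrow> d \<and> (\<lambda>n. exp (\<i> * of_real (g n))) \<longlonglongrightarrow> exp (\<i> * of_real \<gamma>)"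
    (is "?E \<longlonglongrightarrow> ?e \<longleftrightarrow> _ \<and> ?G \<longlonglongrightarrow> ?g")
proof -
  have quot: "exp (complex_of_real x - \<i> * of_real y) = exp (complex_of_real x) / exp (\<i> * of_real y)" for x y
    by (rule exp_diff)
  show ?thesis
  proof (intro iffI conjI)
    assume E: "?E \<longlonglongrightarrow> ?e"
    have "(\<lambda>n. norm (?E n)) \<longlonglongrightarrow> norm ?e" using E by (rule tendsto_norm)
    then have "(\<lambda>n. exp (D n)) \<longlonglongrightarrow> exp d" by simp
    then have "(\<lambda>n. ln (exp (D n))) \<longlonglongrightarrow> ln (exp d)" by (rule tendsto_ln) simp
    then show D: "D \<longlonglongrightarrow> d" by simp
    have "(\<lambda>n. exp (complex_of_real (D n)) / ?E n) \<longlonglongrightarrow> exp (complex_of_real d) / ?e"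
      by (intro tendsto_intros D E) simp
    then show "?G \<longlonglongrightarrow> ?g" unfolding quot by simp
  next
    assume "D \<longlonglongrightarrow> d \<and> ?G \<longlonglongrightarrow> ?g"
    then have "(\<lambda>n. exp (complex_of_real (D n)) / ?G n) \<longlonglongrightarrow> exp (complex_of_real d) / ?g"
      by (intro tendsto_divide tendsto_exp[OF tendsto_of_real]) simp_all
    then show "?E \<longlonglongrightarrow> ?e" unfolding quot .
  qed
qed

section \<open>The limit theorem\<close>

theorem theorem4p3:
  fixes k :: "nat \<Rightarrow> nat"
    and \<nu> :: "nat \<Rightarrow> nat \<Rightarrow> complex measure"
    and \<tau> \<gamma> :: real
    and l :: "nat \<Rightarrow> complex"
    and \<sigma> :: "complex measure"
  assumes "\<And>n. n \<ge> 1 \<Longrightarrow> k n \<ge> 1"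
    and "\<And>n j. n \<ge> 1 \<Longrightarrow> 1 \<le> j \<Longrightarrow> j \<le> k n \<Longrightarrow> \<nu> n j \<in> circle_prob_nz"
    and "infinitesimal_array k \<nu>"
    and "0 < \<tau>" "\<tau> < pi"
    and "\<And>n. n \<ge> 1 \<Longrightarrow> l n \<in> circle"
    and "finite_measure \<sigma>" "sets \<sigma> = sets circle_borel"
  shows "weak_conv_circle
           (\<lambda>n. foldr (\<boxtimes>) (map (\<nu> n) [1..<Suc (k n)]) (return circle_borel (l n)))
           (nu_boxtimes \<gamma> \<sigma>)
     \<longleftrightarrow>
         weak_conv_circle (\<lambda>n. sigma_row \<tau> (k n) (\<nu> n)) \<sigma> \<and>
         (\<lambda>n. exp (\<i> * of_real (gamma_row \<tau> (k n) (\<nu> n) (l n)))) \<longlonglongrightarrow> exp (\<i> * of_real \<gamma>)"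
proof -
  note nz = assms(2) and inf = assms(3) and \<tau> = assms(4,5) and l = assms(6)
  define c where "c n j = centered \<tau> (\<nu> n j)" for n j
  define b where "b n j = centering \<tau> (\<nu> n j)" for n j
  define C where "C = pi + (1 + pi) / (1 - cos (\<tau> / 2))"
  define \<theta> where "\<theta> n = Arg (l n) + (\<Sum>j=1..k n. Arg (b n j))" for n
  define V where "V = u_fps \<gamma> \<sigma>"
  define U where "U n = fps_const (- \<i> * of_real (\<theta> n)) + (\<Sum>j=1..k n. tilt_fps (c n j))" for n
  define \<mu> where "\<mu> n = foldr (\<boxtimes>) (map (\<nu> n) [1..<Suc (k n)]) (return circle_borel (l n))" for n
  define D where "D n = (\<Sum>j=1..k n. spread (c n j))" for n
  have ev1: "\<forall>\<^sub>F n in sequentially. 1 \<le> (n :: nat)" by (rule eventually_ge_at_top)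
  have \<sigma>: "circle_measure \<sigma>" using assms(7,8) by (simp add: circle_measure_def)
  have \<nu>p: "circle_prob (\<nu> n j)" if "1 \<le> n" "1 \<le> j" "j \<le> k n" for n j
    using nz[OF that] circle_prob_nzD(1) by blast
  have cnz: "c n j \<in> circle_prob_nz" if "1 \<le> n" "1 \<le> j" "j \<le> k n" for n j
    unfolding c_def by (rule centered_nz(1)[OF nz[OF that]])
  have c_small: "\<forall>\<^sub>F n in sequentially. \<forall>j. 1 \<le> j \<and> j \<le> k n \<longrightarrow> spread (c n j) \<le> \<eta>" if \<eta>: "0 < \<eta>" for \<eta>
  proof -
    have e: "0 < \<eta> / 8" using \<eta> by simp
    show ?thesis
      using infinitesimal_uniform[OF inf e] ev1
    proof eventually_elim
      case (elim n)
      then show ?case using angle_spread_small(2)[OF \<nu>p \<tau> e] unfolding c_def by fastforce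
    qed
  qed
  have c_imb: "\<forall>\<^sub>F n in sequentially. \<forall>j. 1 \<le> j \<and> j \<le> k n \<longrightarrow> \<bar>imbalance (c n j)\<bar> \<le> C * spread (c n j)"
  proof -
    \<comment> \<open>The factor 5 is the one in \<open>angle_spread_small\<close>.\<close>
    define \<epsilon> where "\<epsilon> = min (\<tau> / 2) (pi - \<tau>) / 5"
    have e: "0 < \<epsilon>" using \<tau> by (simp add: \<epsilon>_def)
    have e5: "5 * \<epsilon> \<le> \<tau> / 2" "5 * \<epsilon> \<le> pi - \<tau>"
      using min.cobounded1[of "\<tau> / 2" "pi - \<tau>"] min.cobounded2[of "\<tau> / 2" "pi - \<tau>"]
      unfolding \<epsilon>_def by simp_all
    show ?thesis
      using infinitesimal_uniform[OF inf e] ev1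
    proof eventually_elim
      case (elim n)
      show ?case
      proof (intro allI impI)
        fix j assume j: "1 \<le> j \<and> j \<le> k n"
        have p: "circle_prob (\<nu> n j)" using \<nu>p elim j by blast
        have "\<bar>angle \<tau> (\<nu> n j)\<bar> \<le> 5 * \<epsilon>" using elim j by (intro angle_spread_small(1)[OF p \<tau> e]) auto
        then show "\<bar>imbalance (c n j)\<bar> \<le> C * spread (c n j)"
          unfolding c_def C_def using e5 by (intro imbalance_bound[OF p \<tau>]) auto
      qed
    qed
  qed
  have b_circle: "b n j \<in> circle" if "1 \<le> n" "1 \<le> j" "j \<le> k n" for n j
    unfolding b_def by (rule centering_circle[OF \<nu>p[OF that]])
  have exp_Arg: "1 / t = exp (- \<i> * of_real (Arg t))" if "t \<in> circle" for t
  proof -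
    have "t = exp (\<i> * of_real (Arg t))" using circle_Arg[OF that] by (simp add: cis_conv_exp)
    then show ?thesis by (metis exp_minus inverse_eq_divide mult_minus_left)
  qed
  have \<mu>_nz: "\<mu> n \<in> circle_prob_nz"
    and \<mu>_Sigma: "Sigma_fps (\<mu> n) = fps_const (exp (- \<i> * of_real (\<theta> n))) * (\<Prod>j=1..k n. Sigma_fps (c n j))"
    if n: "1 \<le> n" for n
  proof -
    have ms: "\<rho> \<in> circle_prob_nz" if "\<rho> \<in> set (map (\<nu> n) [1..<Suc (k n)])" for \<rho>
      using that nz[OF n] by auto
    show "\<mu> n \<in> circle_prob_nz"
      unfolding \<mu>_def by (rule foldr_conv(1)[OF ms return_Sigma(1)[OF l[OF n]]])
    have "Sigma_fps (\<mu> n) = prod_list (map Sigma_fps (map (\<nu> n) [1..<Suc (k n)])) * fps_const (1 / l n)"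
      unfolding \<mu>_def return_Sigma(2)[OF l[OF n], symmetric]
      by (rule foldr_conv(2)[OF ms return_Sigma(1)[OF l[OF n]]])
    also have "prod_list (map Sigma_fps (map (\<nu> n) [1..<Suc (k n)])) = (\<Prod>j=1..k n. Sigma_fps (\<nu> n j))"
      by (simp add: prod.distinct_set_conv_list[symmetric] atLeastLessThanSuc_atLeastAtMost comp_def del: upt_Suc)
    also have "\<dots> = (\<Prod>j=1..k n. fps_const (1 / b n j) * Sigma_fps (c n j))"
      unfolding b_def c_def by (intro prod.cong refl centered_nz(2) nz n) auto
    also have "\<dots> = fps_const (\<Prod>j=1..k n. 1 / b n j) * (\<Prod>j=1..k n. Sigma_fps (c n j))"
      by (simp only: prod.distrib prod_fps_const)
    also have "(\<Prod>j=1..k n. 1 / b n j) = exp (\<Sum>j=1..k n. - \<i> * of_real (Arg (b n j)))"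
      unfolding exp_sum[OF finite_atLeastAtMost] using exp_Arg b_circle n by (intro prod.cong refl) auto
    also have "1 / l n = exp (- \<i> * of_real (Arg (l n)))" by (rule exp_Arg[OF l[OF n]])
    also have "fps_const (exp (\<Sum>j=1..k n. - \<i> * of_real (Arg (b n j)))) * (\<Prod>j=1..k n. Sigma_fps (c n j)) *
        fps_const (exp (- \<i> * of_real (Arg (l n)))) =
        fps_const (exp (- \<i> * of_real (\<theta> n))) * (\<Prod>j=1..k n. Sigma_fps (c n j))"
    proof -
      have "(\<Sum>j=1..k n. - \<i> * of_real (Arg (b n j))) + - \<i> * of_real (Arg (l n)) = - \<i> * of_real (\<theta> n)"
        unfolding \<theta>_def of_real_add of_real_sum sum_distrib_left[symmetric] distrib_left by (rule add.commute)
      then have "exp (\<Sum>j=1..k n. - \<i> * of_real (Arg (b n j))) * exp (- \<i> * of_real (Arg (l n))) = exp (- \<i> * of_real (\<theta> n))"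
        by (simp only: exp_add[symmetric])
      moreover have "fps_const x * F * fps_const y = fps_const (x * y) * F" for x y :: complex and F
        by (simp only: fps_const_mult[symmetric] mult_ac)
      ultimately show ?thesis by (simp only:)
    qed
    finally show "Sigma_fps (\<mu> n) = fps_const (exp (- \<i> * of_real (\<theta> n))) * (\<Prod>j=1..k n. Sigma_fps (c n j))" .
  qed
  have row: "circle_measure (sigma_row \<tau> (k n) (\<nu> n))"
      "mom (sigma_row \<tau> (k n) (\<nu> n)) i = (\<Sum>j=1..k n. tilt (c n j) i)" if "1 \<le> n" for n i
    using row_measure[of "k n" "c n"] circle_prob_nzD(1)[OF cnz[OF that]]
    unfolding sigma_row_def c_def by auto
  have nu: "nu_boxtimes \<gamma> \<sigma> \<in> circle_prob_nz" "Sigma_fps (nu_boxtimes \<gamma> \<sigma>) = exp_fps V"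
    unfolding V_def by (rule nu_boxtimes[OF \<sigma>])+
  have prob_measure: "circle_measure \<rho>" if "\<rho> \<in> circle_prob_nz" for \<rho>
    using circle_prob_nzD(1)[OF that] by (rule circle_prob_measure)
  have \<mu>_ev: "\<forall>\<^sub>F n in sequentially. \<mu> n \<in> circle_prob_nz" using ev1 by eventually_elim (rule \<mu>_nz)
  have "weak_conv_circle \<mu> (nu_boxtimes \<gamma> \<sigma>) \<longleftrightarrow> ctends (\<lambda>n. Sigma_fps (\<mu> n)) (exp_fps V)"
    unfolding nu(2)[symmetric] mom_tendsto_iff_Sigma[OF \<mu>_ev nu(1), symmetric]
    by (rule weak_conv_iff_moments) (use \<mu>_ev prob_measure nu(1) in \<open>auto elim: eventually_mono\<close>)
  also have "\<dots> \<longleftrightarrow> ctends (\<lambda>n. fps_const (exp (- \<i> * of_real (\<theta> n))) * (\<Prod>j=1..k n. Sigma_fps (c n j))) (exp_fps V)"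
    by (intro ctends_cong eventually_mono[OF ev1 \<mu>_Sigma])
  also have "\<dots> \<longleftrightarrow> (\<lambda>n. exp (U n $ 0)) \<longlonglongrightarrow> exp (V $ 0) \<and> ctends (\<lambda>n. fps_deriv (U n)) (fps_deriv V)"
    unfolding U_def by (rule array_limit[OF cnz c_small c_imb])
  also have "(\<lambda>n. exp (U n $ 0)) \<longlonglongrightarrow> exp (V $ 0) \<longleftrightarrow>
      (\<lambda>n. mom (sigma_row \<tau> (k n) (\<nu> n)) 0) \<longlonglongrightarrow> mom \<sigma> 0 \<and>
      (\<lambda>n. exp (\<i> * of_real (gamma_row \<tau> (k n) (\<nu> n) (l n)))) \<longlonglongrightarrow> exp (\<i> * of_real \<gamma>)"
  proof -
    define d where "d = measure \<sigma> (space \<sigma>)"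
    have m0: "mom \<sigma> 0 = of_real d" by (simp add: mom_def d_def scaleR_conv_of_real)
    have V0: "V $ 0 = of_real d - \<i> * of_real \<gamma>" by (simp add: V_def u_fps_def psi_fps_def m0)
    have U0: "U n $ 0 = of_real (D n) - \<i> * of_real (gamma_row \<tau> (k n) (\<nu> n) (l n))" if n: "1 \<le> n" for n
    proof -
      have "U n $ 0 = - \<i> * of_real (\<theta> n) + (\<Sum>j=1..k n. 1 - mom (c n j) 1)"
        by (simp add: U_def fps_sum_nth tilt_fps_def)
      also have "(\<Sum>j=1..k n. 1 - mom (c n j) 1) =
          (\<Sum>j=1..k n. of_real (spread (c n j)) - \<i> * of_real (imbalance (c n j)))"
        by (intro sum.cong refl one_minus_mom circle_prob_nzD(1) cnz n) auto
      also have "\<dots> = of_real (D n) - \<i> * of_real (\<Sum>j=1..k n. imbalance (c n j))"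
        by (simp add: D_def sum_subtractf sum_distrib_left)
      also have "gamma_row \<tau> (k n) (\<nu> n) (l n) = \<theta> n + (\<Sum>j=1..k n. imbalance (c n j))"
        by (simp add: gamma_row_def \<theta>_def b_def c_def imbalance_def sum.distrib)
      ultimately show ?thesis by (simp add: algebra_simps)
    qed
    have M0: "mom (sigma_row \<tau> (k n) (\<nu> n)) 0 = of_real (D n)" if n: "1 \<le> n" for n
      unfolding row(2)[OF n] D_def of_real_sum
      by (intro sum.cong refl tilt_0 circle_prob_nzD(1) cnz n) auto
    have "(\<lambda>n. exp (U n $ 0)) \<longlonglongrightarrow> exp (V $ 0) \<longleftrightarrow>
        (\<lambda>n. exp (complex_of_real (D n) - \<i> * of_real (gamma_row \<tau> (k n) (\<nu> n) (l n)))) \<longlonglongrightarrow>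
          exp (complex_of_real d - \<i> * of_real \<gamma>)"
      unfolding V0 by (rule tendsto_cong) (use ev1 in \<open>eventually_elim, simp only: U0\<close>)
    also have "\<dots> \<longleftrightarrow> D \<longlonglongrightarrow> d \<and>
        (\<lambda>n. exp (\<i> * of_real (gamma_row \<tau> (k n) (\<nu> n) (l n)))) \<longlonglongrightarrow> exp (\<i> * of_real \<gamma>)"
      by (rule polar_limit)
    also have "D \<longlonglongrightarrow> d \<longleftrightarrow> (\<lambda>n. complex_of_real (D n)) \<longlonglongrightarrow> complex_of_real d"
      by (rule tendsto_of_real_iff[symmetric])
    also have "\<dots> \<longleftrightarrow> (\<lambda>n. mom (sigma_row \<tau> (k n) (\<nu> n)) 0) \<longlonglongrightarrow> mom \<sigma> 0"
      unfolding m0 by (rule tendsto_cong) (use ev1 in \<open>eventually_elim, simp only: M0\<close>)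
    finally show ?thesis .
  qed
  also have "ctends (\<lambda>n. fps_deriv (U n)) (fps_deriv V) \<longleftrightarrow>
      (\<forall>i. (\<lambda>n. mom (sigma_row \<tau> (k n) (\<nu> n)) (Suc i)) \<longlonglongrightarrow> mom \<sigma> (Suc i))"
    unfolding ctends_def
  proof (intro iff_allI)
    fix i
    define a where "a = 2 * complex_of_nat (Suc i)"
    have a: "a \<noteq> 0" unfolding a_def by (simp del: of_nat_Suc)
    have V1: "fps_deriv V $ i = a * mom \<sigma> (Suc i)"
      by (simp add: V_def u_fps_def psi_fps_def a_def del: of_nat_Suc)
    have U1: "fps_deriv (U n) $ i = a * mom (sigma_row \<tau> (k n) (\<nu> n)) (Suc i)" if "1 \<le> n" for n
      unfolding row(2)[OF that]
      by (simp add: U_def fps_sum_nth tilt_fps_def a_def sum_distrib_left mult_ac del: of_nat_Suc)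
    have "(\<lambda>n. fps_deriv (U n) $ i) \<longlonglongrightarrow> fps_deriv V $ i \<longleftrightarrow>
        (\<lambda>n. a * mom (sigma_row \<tau> (k n) (\<nu> n)) (Suc i)) \<longlonglongrightarrow> a * mom \<sigma> (Suc i)"
      unfolding V1 by (rule tendsto_cong) (use ev1 in \<open>eventually_elim, simp only: U1\<close>)
    also have "\<dots> \<longleftrightarrow> (\<lambda>n. mom (sigma_row \<tau> (k n) (\<nu> n)) (Suc i)) \<longlonglongrightarrow> mom \<sigma> (Suc i)"
      using a by (rule tendsto_mult_left_iff)
    finally show "(\<lambda>n. fps_deriv (U n) $ i) \<longlonglongrightarrow> fps_deriv V $ i \<longleftrightarrow>
        (\<lambda>n. mom (sigma_row \<tau> (k n) (\<nu> n)) (Suc i)) \<longlonglongrightarrow> mom \<sigma> (Suc i)" .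
  qed
  also have "((\<lambda>n. mom (sigma_row \<tau> (k n) (\<nu> n)) 0) \<longlonglongrightarrow> mom \<sigma> 0 \<and>
        (\<lambda>n. exp (\<i> * of_real (gamma_row \<tau> (k n) (\<nu> n) (l n)))) \<longlonglongrightarrow> exp (\<i> * of_real \<gamma>)) \<and>
      (\<forall>i. (\<lambda>n. mom (sigma_row \<tau> (k n) (\<nu> n)) (Suc i)) \<longlonglongrightarrow> mom \<sigma> (Suc i)) \<longleftrightarrow>
      (\<forall>i. (\<lambda>n. mom (sigma_row \<tau> (k n) (\<nu> n)) i) \<longlonglongrightarrow> mom \<sigma> i) \<and>
      (\<lambda>n. exp (\<i> * of_real (gamma_row \<tau> (k n) (\<nu> n) (l n)))) \<longlonglongrightarrow> exp (\<i> * of_real \<gamma>)"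
    by (metis not0_implies_Suc)
  also have "(\<forall>i. (\<lambda>n. mom (sigma_row \<tau> (k n) (\<nu> n)) i) \<longlonglongrightarrow> mom \<sigma> i) \<longleftrightarrow>
      weak_conv_circle (\<lambda>n. sigma_row \<tau> (k n) (\<nu> n)) \<sigma>"
    by (rule weak_conv_iff_moments[OF eventually_mono[OF ev1 row(1)] \<sigma>, symmetric])
  finally show ?thesis unfolding \<mu>_def .
qed

end
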